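(* For all $v_h\in\mathcal V^h$, $\Vert Q_\varepsilon v_h\Vert_{1,k}\lesssim\dfrac{k^2}{\vert\varepsilon\vert}\Vert v_h\Vert_{1,k}$.
   Context: Setting. $d\in\{2,3\}$; $\Omega\subset\mathbb{R}^d$ bounded open Lipschitz polygonal/polyhedral domain, boundary $\Gamma$. $k>0$, $\varepsilon\in\mathbb{R}\setminus\{0\}$, $\eta\in\mathbb{C}$; $z=\sqrt{k^2+{\rm i}\varepsilon}$ (branch cut on positive real axis). Standing assumptions: $\vert\varepsilon\vert\lesssim k^2$, $\vert\eta\vert\lesssim k$, $k\ge k_0>0$ fixed, $\Re(\overline z\eta)\ge0$. $A\lesssim B$ means $A\le cB$ with $c$ independent of $k,\varepsilon,\eta,h,H,H_{\text{sub}},\delta$. Forms. $a_\varepsilon(u,v)=\int_\Omega\nabla u\cdot\nabla\overline v-(k^2+{\rm i}\varepsilon)\int_\Omega u\overline v-{\rm i}\eta\int_\Gamma u\overline v$ on $H^1(\Omega)$; $(v,w)_{1,k}=(\nabla v,\nabla w)_{L^2(\Omega)}+k^2(v,w)_{L^2(\Omega)}$, $\Vert v\Vert_{1,k}=(v,v)_{1,k}^{1/2}$. Spaces. $\mathcal{T}^h$ conforming shape-regular simplicial mesh (diameter $h$); $\mathcal{V}^h$ continuous $P1$ functions. Subdomains $\Omega_\ell=\widetilde\Omega_\ell\cap\overline\Omega$, $\ell=1,\dots,N$ (open sets covering $\overline\Omega$), each $\overline\Omega_\ell$ a nonempty union of fine elements and a shape-regular Lipschitz polyhedron of diameter $H_\ell$,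 volume $\sim H_\ell^d$, surface $\sim H_\ell^{d-1}$; $H_{\text{sub}}=\max H_\ell$; $\vert\partial\Omega_\ell\setminus\Gamma\vert\sim H_{\text{sub}}^{d-1}$; overlap $\Omega_{\ell,c\delta}\subset\Omega_\ell\setminus\mathring\Omega_\ell\subset\Omega_{\ell,\delta}$ ($\mathring\Omega_\ell$: part of $\Omega_\ell$ not overlapped by others; $\Omega_{\ell,\mu}$: points within distance $\mu$ of $\partial\Omega_\ell$); finite overlap $\#\{\ell':\Omega_\ell\cap\Omega_{\ell'}\neq\emptyset\}\lesssim1$. $\mathcal{V}_\ell=\{v_h\in\mathcal{V}^h:\mathrm{supp}\,v_h\subset\overline\Omega_\ell\}$, $\ell\ge1$. Coarse mesh $\mathcal{T}^H$ shape-regular simplicial of diameter $H$, elements unions of fine elements; $\mathcal V_0\subset\mathcal V^h$ the continuous $P1$ functions on $\mathcal T^H$. Projections. For $\ell=0,\dots,N$, $Q_{\varepsilon,\ell}:H^1(\Omega)\to\mathcal V_\ell$ is defined by $a_\varepsilon(Q_{\varepsilon,\ell}v,w)=a_\varepsilon(v,w)$ for all $w\in\mathcal V_\ell$; $Q_\varepsilon=\sum_{\ell=0}^NQ_{\varepsilon,\ell}$. *)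

theory Defs
  imports "HOL-Analysis.Analysis"
begin

text \<open>Points of the physical domain live in real^'n with d = CARD('n).
  Finite element functions are complex valued; by convention they are
  extended by zero outside the closed domain.\<close>

definition lipschitz_domain :: "(real^'n) set \<Rightarrow> bool" where
  "lipschitz_domain D \<longleftrightarrow> open D \<and> bounded D \<and> D \<noteq> {} \<and>
     (\<forall>x\<in>frontier D. \<exists>U R (e::'n) (f::real^'n \<Rightarrow> real) L.
        open U \<and> x \<in> U \<and> orthogonal_transformation R \<and>
        (\<forall>y z. \<bar>f y - f z\<bar> \<le> L * norm (y - z)) \<and>
        (\<forall>y t. f (y + t *\<^sub>R axis e 1) = f y) \<and>
        D \<inter> U = {y\<in>U. f (R y) < (R y) $ e})"

definition sr_mesh :: "real \<Rightarrow> (real^'n) set set \<Rightarrow> (real^'n) set \<Rightarrow> bool" where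
  "sr_mesh \<sigma> \<T> D \<longleftrightarrow> finite \<T> \<and> \<T> \<noteq> {} \<and> \<Union>\<T> = D \<and>
     (\<forall>T\<in>\<T>. (int CARD('n)) simplex T \<and> (\<exists>x. ball x (diameter T / \<sigma>) \<subseteq> T)) \<and>
     (\<forall>T\<in>\<T>. \<forall>T'\<in>\<T>. T \<noteq> T' \<longrightarrow> (T \<inter> T') face_of T \<and> (T \<inter> T') face_of T')"

definition mesh_faces :: "(real^'n) set set \<Rightarrow> (real^'n) set set" where
  "mesh_faces \<T> = {F. \<exists>T\<in>\<T>. F face_of T \<and> aff_dim F = int CARD('n) - 1}"

definition face_normal :: "(real^'n) set \<Rightarrow> real^'n" where
  "face_normal F = (SOME \<nu>. norm \<nu> = 1 \<and> (\<forall>x\<in>F. \<forall>y\<in>F. \<nu> \<bullet> (x - y) = 0))"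

definition face_point :: "(real^'n) set \<Rightarrow> real^'n" where
  "face_point F = (SOME c. c \<in> F)"

definition face_prism :: "(real^'n) set \<Rightarrow> (real^'n) set" where
  "face_prism F = {y + s *\<^sub>R face_normal F | y s. y \<in> F \<and> 0 \<le> s \<and> s \<le> 1}"

text \<open>Surface integral over a flat face (by Fubini over the unit prism):
  the integrand is evaluated at the orthogonal projection onto the face.\<close>
definition face_integral :: "(real^'n) set \<Rightarrow> (real^'n \<Rightarrow> complex) \<Rightarrow> complex" where
  "face_integral F f = (LINT x : face_prism F | lebesgue.
      f (x - (face_normal F \<bullet> (x - face_point F)) *\<^sub>R face_normal F))"

definition face_area :: "(real^'n) set \<Rightarrow> real" where
  "face_area F = measure lebesgue (face_prism F)"

definition bdry_integral :: "(real^'n) set set \<Rightarrow> (real^'n) set \<Rightarrow> (real^'n \<Rightarrow> complex) \<Rightarrow> complex" where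
  "bdry_integral \<T> \<Omega> f = (\<Sum>F\<in>{F\<in>mesh_faces \<T>. F \<subseteq> frontier \<Omega>}. face_integral F f)"

definition P1 :: "(real^'n) set set \<Rightarrow> (real^'n) set \<Rightarrow> (real^'n \<Rightarrow> complex) set" where
  "P1 \<T> D = {v. continuous_on D v \<and> (\<forall>x. x \<notin> D \<longrightarrow> v x = 0) \<and>
      (\<forall>T\<in>\<T>. \<exists>(c::complex) (g::'n \<Rightarrow> complex).
          \<forall>x\<in>T. v x = c + (\<Sum>i\<in>UNIV. g i * complex_of_real (x $ i)))}"

definition grad :: "(real^'n \<Rightarrow> complex) \<Rightarrow> real^'n \<Rightarrow> complex^'n" where
  "grad v x = (\<chi> i. vector_derivative (\<lambda>t. v (x + t *\<^sub>R axis i 1)) (at 0))"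

definition L2_inner :: "(real^'n) set \<Rightarrow> (real^'n \<Rightarrow> complex) \<Rightarrow> (real^'n \<Rightarrow> complex) \<Rightarrow> complex" where
  "L2_inner \<Omega> u v = (LINT x : \<Omega> | lebesgue. u x * cnj (v x))"

definition H1_semi_inner :: "(real^'n) set \<Rightarrow> (real^'n \<Rightarrow> complex) \<Rightarrow> (real^'n \<Rightarrow> complex) \<Rightarrow> complex" where
  "H1_semi_inner \<Omega> u v = (LINT x : \<Omega> | lebesgue. (\<Sum>i\<in>UNIV. grad u x $ i * cnj (grad v x $ i)))"

definition a_eps :: "(real^'n) set set \<Rightarrow> (real^'n) set \<Rightarrow> real \<Rightarrow> real \<Rightarrow> complex
    \<Rightarrow> (real^'n \<Rightarrow> complex) \<Rightarrow> (real^'n \<Rightarrow> complex) \<Rightarrow> complex" where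
  "a_eps \<T> \<Omega> k \<epsilon> \<eta> u v =
     H1_semi_inner \<Omega> u v - (complex_of_real (k\<^sup>2) + \<i> * complex_of_real \<epsilon>) * L2_inner \<Omega> u v
     - \<i> * \<eta> * bdry_integral \<T> \<Omega> (\<lambda>x. u x * cnj (v x))"

definition norm_1k :: "(real^'n) set \<Rightarrow> real \<Rightarrow> (real^'n \<Rightarrow> complex) \<Rightarrow> real" where
  "norm_1k \<Omega> k v = sqrt ((LINT x : \<Omega> | lebesgue. (\<Sum>i\<in>UNIV. (cmod (grad v x $ i))\<^sup>2))
                          + k\<^sup>2 * (LINT x : \<Omega> | lebesgue. (cmod (v x))\<^sup>2))"

text \<open>z = sqrt(k^2 + i eps) with branch cut on the positive real axis, i.e. Im z > 0
  (for eps \<noteq> 0).\<close>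
definition z_of :: "real \<Rightarrow> real \<Rightarrow> complex" where
  "z_of k \<epsilon> = complex_of_real (sgn \<epsilon>) * csqrt (complex_of_real (k\<^sup>2) + \<i> * complex_of_real \<epsilon>)"

definition Vloc :: "(real^'n) set set \<Rightarrow> (real^'n) set set \<Rightarrow> (real^'n) set \<Rightarrow> (nat \<Rightarrow> (real^'n) set)
    \<Rightarrow> nat \<Rightarrow> (real^'n \<Rightarrow> complex) set" where
  "Vloc \<T> \<T>H \<Omega> Om l = (if l = 0 then P1 \<T>H (closure \<Omega>)
      else {v\<in>P1 \<T> (closure \<Omega>). closure {x. v x \<noteq> 0} \<subseteq> closure (Om l)})"

definition proj_a :: "((real^'n \<Rightarrow> complex) \<Rightarrow> (real^'n \<Rightarrow> complex) \<Rightarrow> complex)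
    \<Rightarrow> (real^'n \<Rightarrow> complex) set \<Rightarrow> (real^'n \<Rightarrow> complex) \<Rightarrow> (real^'n \<Rightarrow> complex)" where
  "proj_a a V v = (THE w. w \<in> V \<and> (\<forall>\<phi>\<in>V. a w \<phi> = a v \<phi>))"

definition Q_eps :: "(real^'n) set set \<Rightarrow> (real^'n) set set \<Rightarrow> (real^'n) set \<Rightarrow> (nat \<Rightarrow> (real^'n) set)
    \<Rightarrow> nat \<Rightarrow> real \<Rightarrow> real \<Rightarrow> complex \<Rightarrow> (real^'n \<Rightarrow> complex) \<Rightarrow> (real^'n \<Rightarrow> complex)" where
  "Q_eps \<T> \<T>H \<Omega> Om N k \<epsilon> \<eta> v =
     (\<lambda>x. \<Sum>l\<le>N. proj_a (a_eps \<T> \<Omega> k \<epsilon> \<eta>) (Vloc \<T> \<T>H \<Omega> Om l) v x)"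

definition nonoverlap :: "(nat \<Rightarrow> (real^'n) set) \<Rightarrow> nat \<Rightarrow> nat \<Rightarrow> (real^'n) set" where
  "nonoverlap Om N l = Om l - (\<Union>l'\<in>{1..N}-{l}. Om l')"

text \<open>Points of Omega_l within distance mu of the (relative, interior) boundary
  of Omega_l, i.e. of closure Omega_l minus Omega_l.\<close>
definition bd_strip :: "(nat \<Rightarrow> (real^'n) set) \<Rightarrow> nat \<Rightarrow> real \<Rightarrow> (real^'n) set" where
  "bd_strip Om l \<mu> = {x\<in>Om l. \<exists>y\<in>closure (Om l) - Om l. dist x y < \<mu>}"

text \<open>All standing assumptions on the discretisation, with the hidden
  constants (sigma, overlap constants, equivalence constants) as parameters.\<close>
definition dd_setting ::
  "real \<Rightarrow> nat \<Rightarrow> real \<Rightarrow> real \<Rightarrow> real \<Rightarrow> real \<Rightarrow> real \<Rightarrow> real \<Rightarrow> real \<Rightarrow>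
   (real^'n) set \<Rightarrow> (real^'n) set set \<Rightarrow> (real^'n) set set \<Rightarrow> nat \<Rightarrow> (nat \<Rightarrow> (real^'n) set)
   \<Rightarrow> (nat \<Rightarrow> (real^'n) set) \<Rightarrow> real \<Rightarrow> bool" where
  "dd_setting \<sigma> Cov c\<delta> cv Cv cs Cs cb Cb \<Omega> \<T> \<T>H N Omt Om \<delta> \<longleftrightarrow>
     sr_mesh \<sigma> \<T> (closure \<Omega>) \<and>
     sr_mesh \<sigma> \<T>H (closure \<Omega>) \<and> (\<forall>K\<in>\<T>H. \<exists>S\<subseteq>\<T>. K = \<Union>S) \<and>
     1 \<le> N \<and> 0 < \<delta> \<and>
     closure \<Omega> \<subseteq> (\<Union>l\<in>{1..N}. Omt l) \<and>
     (\<forall>l\<in>{1..N}. open (Omt l) \<and> Om l = Omt l \<inter> closure \<Omega> \<and>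
        (\<exists>S\<subseteq>\<T>. S \<noteq> {} \<and> closure (Om l) = \<Union>S) \<and>
        lipschitz_domain (interior (closure (Om l))) \<and>
        closure (interior (closure (Om l))) = closure (Om l) \<and>
        (\<exists>x. ball x (diameter (Om l) / \<sigma>) \<subseteq> closure (Om l)) \<and>
        cv * diameter (Om l) ^ CARD('n) \<le> measure lebesgue (Om l) \<and>
        measure lebesgue (Om l) \<le> Cv * diameter (Om l) ^ CARD('n) \<and>
        cs * diameter (Om l) ^ (CARD('n) - 1)
           \<le> (\<Sum>F\<in>{F\<in>mesh_faces \<T>. F \<subseteq> frontier (Om l)}. face_area F) \<and>
        (\<Sum>F\<in>{F\<in>mesh_faces \<T>. F \<subseteq> frontier (Om l)}. face_area F)
           \<le> Cs * diameter (Om l) ^ (CARD('n) - 1) \<and>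
        cb * (MAX l'\<in>{1..N}. diameter (Om l')) ^ (CARD('n) - 1)
           \<le> (\<Sum>F\<in>{F\<in>mesh_faces \<T>. F \<subseteq> frontier (Om l) \<and> \<not> F \<subseteq> frontier \<Omega>}. face_area F) \<and>
        (\<Sum>F\<in>{F\<in>mesh_faces \<T>. F \<subseteq> frontier (Om l) \<and> \<not> F \<subseteq> frontier \<Omega>}. face_area F)
           \<le> Cb * (MAX l'\<in>{1..N}. diameter (Om l')) ^ (CARD('n) - 1) \<and>
        bd_strip Om l (c\<delta> * \<delta>) \<subseteq> Om l - nonoverlap Om N l \<and>
        Om l - nonoverlap Om N l \<subseteq> bd_strip Om l \<delta> \<and>
        card {l'\<in>{1..N}. Om l \<inter> Om l' \<noteq> {}} \<le> Cov)"

end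

theory Submission
  imports Defs
begin

text \<open>
  Write \<open>w\<^sub>l = Q\<^sub>l v\<close> and \<open>\<theta> = - cnj z / |z|\<close>. Testing the equations that define \<open>w\<^sub>l\<close> with \<open>w\<^sub>l\<close> itself and
  summing gives \<open>\<Sum>\<^sub>l Im (\<theta> a(w\<^sub>l, w\<^sub>l)) = Im (\<theta> a(v, \<Sum>\<^sub>l w\<^sub>l))\<close>. The left-hand side dominates
  \<open>(|\<epsilon>| / k\<^sup>2) \<Sum>\<^sub>l \<parallel>w\<^sub>l\<parallel>\<^sup>2\<close>, and finite overlap bounds \<open>\<parallel>\<Sum>\<^sub>l w\<^sub>l\<parallel>\<^sup>2\<close> by a multiple of \<open>\<Sum>\<^sub>l \<parallel>w\<^sub>l\<parallel>\<^sup>2\<close>, so what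
  remains is the boundedness of \<open>a\<close> uniformly in \<open>k\<close>. Its boundary term requires the trace inequality
  \<open>k \<parallel>v\<parallel>\<^sup>2\<^bsub>\<Gamma>\<^esub> \<lesssim> \<parallel>v\<parallel>\<^sup>2\<^bsub>1,k\<^esub>\<close>, obtained by writing \<open>|v|\<^sup>2\<close> on \<open>\<Gamma>\<close> as an integral along the direction in which the
  domain lies above a Lipschitz graph.
\<close>

section \<open>Galerkin projections for sesquilinear forms\<close>

text \<open>The weight \<open>-cnj z\<close> is dictated by
  \<open>z\<^sup>2 = k\<^sup>2 + i \<epsilon>\<close>: it turns the indefinite mass term with factor
  \<open>-z\<^sup>2\<close> into one with factor \<open>|z|\<^sup>2 z\<close>, so gradient and mass
  terms both pick up the positive factor \<open>Im z\<close>, and \<open>Im z / |z|\<close> is at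
  least \<open>|\<epsilon>| / (2 |z|\<^sup>2)\<close>. Coercivity passes to every subspace, so each
  local problem is uniquely solvable on any mesh and the description operator in
  \<open>proj_a\<close> denotes its solution. The obstacle in the trace inequality is uniformity:
  surface integrals are sums over mesh faces, whose number is unbounded under refinement, and any
  face-by-face constant would see the mesh size. The charts are therefore fixed by the domain alone.
  Over each face the normal prism of the surface measure is traded for an oblique one along the
  chart direction, at the cost of a Jacobian at most \<open>sqrt (1 + L\<^sup>2)\<close>; since all
  faces in a chart lie on one graph, their oblique prisms overlap only in a null set and add up to
  one volume integral.\<close>

locale sesquilinear_on =
  fixes V :: "(real^'n \<Rightarrow> complex) set"
    and a :: "(real^'n \<Rightarrow> complex) \<Rightarrow> (real^'n \<Rightarrow> complex) \<Rightarrow> complex"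
  assumes zero: "(\<lambda>x. 0) \<in> V"
    and add: "u \<in> V \<Longrightarrow> v \<in> V \<Longrightarrow> (\<lambda>x. u x + v x) \<in> V"
    and scale: "u \<in> V \<Longrightarrow> (\<lambda>x. c * u x) \<in> V"
    and add_left: "\<lbrakk>u \<in> V; v \<in> V; w \<in> V\<rbrakk> \<Longrightarrow> a (\<lambda>x. u x + v x) w = a u w + a v w"
    and add_right: "\<lbrakk>u \<in> V; v \<in> V; w \<in> V\<rbrakk> \<Longrightarrow> a w (\<lambda>x. u x + v x) = a w u + a w v"
    and scale_left: "\<lbrakk>u \<in> V; w \<in> V\<rbrakk> \<Longrightarrow> a (\<lambda>x. c * u x) w = c * a u w"
    and scale_right: "\<lbrakk>u \<in> V; w \<in> V\<rbrakk> \<Longrightarrow> a w (\<lambda>x. c * u x) = cnj c * a w u"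
begin

lemma sum_in:
  assumes "finite I" "\<And>i. i \<in> I \<Longrightarrow> w i \<in> V"
  shows "(\<lambda>x. \<Sum>i\<in>I. w i x) \<in> V"
  using assms by (induction I rule: finite_induct) (auto simp: zero intro: add)

lemma zero_right: "w \<in> V \<Longrightarrow> a w (\<lambda>x. 0) = 0"
  using scale_right[of "\<lambda>x. 0" w 0] zero by simp

lemma sum_right:
  assumes "finite I" "\<And>i. i \<in> I \<Longrightarrow> w i \<in> V" "v \<in> V"
  shows "a v (\<lambda>x. \<Sum>i\<in>I. w i x) = (\<Sum>i\<in>I. a v (w i))"
  using assms(1,2)
proof (induction I rule: finite_induct)
  case empty
  then show ?case using zero_right[OF assms(3)] by simp
next
  case (insert i I)
  have *: "(\<lambda>x. \<Sum>j\<in>I. w j x) \<in> V"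
    using insert by (intro sum_in) auto
  have "a v (\<lambda>x. w i x + (\<Sum>j\<in>I. w j x)) = a v (w i) + a v (\<lambda>x. \<Sum>j\<in>I. w j x)"
    using add_right[OF _ * assms(3)] insert.prems by blast
  then show ?case using insert by auto
qed

lemma diff_left:
  assumes "u \<in> V" "v \<in> V" "w \<in> V"
  shows "a (\<lambda>x. u x - v x) w = a u w - a v w"
  using add_left[of u "\<lambda>x. - 1 * v x" w] scale[of v "- 1"] scale_left[of v w "-1"] assms by simp

text \<open>Point evaluations separating the trial space stand in for finite dimensionality: splitting off
  one evaluation at a time is a Gram--Schmidt step.\<close>

lemma ex_projection:
  assumes "finite X"
    and "S \<subseteq> V" "(\<lambda>x. 0) \<in> S"
    and "\<And>u v. u \<in> S \<Longrightarrow> v \<in> S \<Longrightarrow> (\<lambda>x. u x + v x) \<in> S"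
    and "\<And>u c. u \<in> S \<Longrightarrow> (\<lambda>x. c * u x) \<in> S"
    and "\<And>v. v \<in> S \<Longrightarrow> (\<And>x. x \<in> X \<Longrightarrow> v x = 0) \<Longrightarrow> v = (\<lambda>x. 0)"
    and "\<And>w. w \<in> S \<Longrightarrow> a w w = 0 \<Longrightarrow> w = (\<lambda>x. 0)"
    and "v \<in> V"
  shows "\<exists>w\<in>S. \<forall>\<phi>\<in>S. a w \<phi> = a v \<phi>"
  using assms
proof (induction X arbitrary: S v rule: finite_induct)
  case empty
  then have "S = {\<lambda>x. 0}" by blast
  then show ?case using zero_right[OF zero] zero_right[OF empty.prems(7)] by simp
next
  case (insert p X)
  define S0 where "S0 = {u\<in>S. u p = 0}"
  have S0: "S0 \<subseteq> S" by (auto simp: S0_def)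
  have IH: "\<exists>w\<in>S0. \<forall>\<phi>\<in>S0. a w \<phi> = a u \<phi>" if "u \<in> V" for u
  proof (rule insert.IH)
    show "S0 \<subseteq> V" using S0 insert.prems by blast
    show "u = (\<lambda>x. 0)" if "u \<in> S0" "\<And>x. x \<in> X \<Longrightarrow> u x = 0" for u
      using that insert.prems(5)[of u] unfolding S0_def by blast
    show "(\<lambda>x. 0) \<in> S0" using insert.prems(2) by (simp add: S0_def)
    show "(\<lambda>x. u x + v x) \<in> S0" if "u \<in> S0" "v \<in> S0" for u v
      using that insert.prems(3) by (simp add: S0_def)
    show "(\<lambda>x. c * u x) \<in> S0" if "u \<in> S0" for u c
      using that insert.prems(4) by (simp add: S0_def)
    show "w = (\<lambda>x. 0)" if "w \<in> S0" "a w w = 0" for w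
      using that insert.prems(6) S0 by blast
  qed (use that in blast)
  show ?case
  proof (cases "S = S0")
    case True
    then show ?thesis using IH insert.prems by blast
  next
    case False
    then obtain b0 where b0: "b0 \<in> S" "b0 p \<noteq> 0" by (auto simp: S0_def)
    have SV: "\<And>x. x \<in> S \<Longrightarrow> x \<in> V" using insert.prems(1) by blast
    obtain q where q: "q \<in> S0" "\<forall>\<phi>\<in>S0. a q \<phi> = a b0 \<phi>" using IH[OF SV[OF b0(1)]] by blast
    \<comment> \<open>Orthogonality is one-sided because \<open>a\<close> is not Hermitian:
      \<open>a b \<phi>\<close> vanishes for \<open>\<phi> \<in> S0\<close>, while
      \<open>a \<phi> b\<close> need not. This is the side on which adding a multiple of
      \<open>b\<close> to \<open>w\<close> leaves the equations on \<open>S0\<close> intact.\<close>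
    define b where "b = (\<lambda>x. b0 x - q x)"
    have bS: "b \<in> S" using insert.prems(3)[OF b0(1) insert.prems(4)[of q "-1"]] q(1) S0
      unfolding b_def by (simp add: subset_iff)
    have bp: "b p \<noteq> 0" using b0 q by (simp add: b_def S0_def)
    have b_orth: "a b \<phi> = 0" if "\<phi> \<in> S0" for \<phi>
      using diff_left[OF SV[OF b0(1)] SV SV, of q \<phi>] q that S0 unfolding b_def by (simp add: subset_iff)
    have bb: "a b b \<noteq> 0" using insert.prems(6)[OF bS] bp by fastforce
    obtain w where w: "w \<in> S0" "\<forall>\<phi>\<in>S0. a w \<phi> = a v \<phi>" using IH[OF \<open>v \<in> V\<close>] by blast
    have wS: "w \<in> S" using w S0 by blast
    \<comment> \<open>Chosen so that the one remaining equation, with test function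
      \<open>b\<close>, holds; definiteness keeps the denominator away from 0.\<close>
    define c where "c = (a v b - a w b) / a b b"
    define w' where "w' = (\<lambda>x. w x + c * b x)"
    have cb: "(\<lambda>x. c * b x) \<in> S" using insert.prems(4)[OF bS] .
    have w'S: "w' \<in> S" unfolding w'_def using insert.prems(3)[OF wS cb] .
    have w'a: "a w' \<phi> = a w \<phi> + c * a b \<phi>" if "\<phi> \<in> V" for \<phi>
      unfolding w'_def using add_left[of w "\<lambda>x. c * b x" \<phi>] scale_left[of b \<phi> c] that wS bS cb SV
      by simp
    have "a w' \<phi> = a v \<phi>" if phi: "\<phi> \<in> S" for \<phi>
    proof -
      define d where "d = \<phi> p / b p"
      define \<psi> where "\<psi> = (\<lambda>x. \<phi> x - d * b x)"
      have db: "(\<lambda>x. d * b x) \<in> S" using insert.prems(4)[OF bS] .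
      have psi: "\<psi> \<in> S0"
        using insert.prems(3)[OF phi insert.prems(4)[OF bS, of "-d"]] bp
        unfolding \<psi>_def S0_def d_def by simp
      have phi_eq: "\<phi> = (\<lambda>x. \<psi> x + d * b x)" by (simp add: \<psi>_def)
      have split: "a u \<phi> = a u \<psi> + cnj d * a u b" if "u \<in> V" for u
        using add_right[of \<psi> "\<lambda>x. d * b x" u] scale_right[of b u d] that psi S0 SV bS db
        by (subst phi_eq) (auto simp: subset_iff)
      have "a w' \<psi> = a v \<psi>" using w'a[of \<psi>] b_orth[OF psi] w psi S0 SV by (auto simp: subset_iff)
      moreover have "a w' b = a v b" using w'a[of b] bS SV bb by (simp add: c_def)
      ultimately show ?thesis using split w'S SV \<open>v \<in> V\<close> by simp
    qed
    then show ?thesis using w'S by blast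
  qed
qed

text \<open>Definiteness also yields uniqueness: the difference of two solutions is itself a test
  function and has zero energy. Hence the description in \<open>proj_a\<close> is well
  defined.\<close>

lemma proj_a_works:
  assumes "finite X"
    and "S \<subseteq> V" "(\<lambda>x. 0) \<in> S"
    and "\<And>u v. u \<in> S \<Longrightarrow> v \<in> S \<Longrightarrow> (\<lambda>x. u x + v x) \<in> S"
    and "\<And>u c. u \<in> S \<Longrightarrow> (\<lambda>x. c * u x) \<in> S"
    and "\<And>v. v \<in> S \<Longrightarrow> (\<And>x. x \<in> X \<Longrightarrow> v x = 0) \<Longrightarrow> v = (\<lambda>x. 0)"
    and definite: "\<And>w. w \<in> S \<Longrightarrow> a w w = 0 \<Longrightarrow> w = (\<lambda>x. 0)"
    and v: "v \<in> V"
  shows "proj_a a S v \<in> S \<and> (\<forall>\<phi>\<in>S. a (proj_a a S v) \<phi> = a v \<phi>)"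
proof -
  obtain w where w: "w \<in> S" "\<forall>\<phi>\<in>S. a w \<phi> = a v \<phi>"
    using ex_projection[OF assms] by blast
  have "u = w" if u: "u \<in> S" "\<forall>\<phi>\<in>S. a u \<phi> = a v \<phi>" for u
  proof -
    have d: "(\<lambda>x. u x - w x) \<in> S" using assms(4)[of u "\<lambda>x. - 1 * w x"] assms(5)[of w "-1"] u w by auto
    have "a (\<lambda>x. u x - w x) (\<lambda>x. u x - w x) = 0"
      using diff_left[of u w "\<lambda>x. u x - w x"] d u w assms(2) by (simp add: subset_iff)
    from definite[OF d this] show ?thesis by (auto simp: fun_eq_iff)
  qed
  with w have "(THE w. w \<in> S \<and> (\<forall>\<phi>\<in>S. a w \<phi> = a v \<phi>)) = w" by (intro the_equality) blast+
  with w show ?thesis unfolding proj_a_def by simp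
qed

text \<open>Passing from \<open>u\<close>, \<open>v\<close> to \<open>s u\<close>,
  \<open>v / s\<close> leaves \<open>a u v\<close> unchanged but shifts weight between the two terms
  of the additive bound; optimising over \<open>s\<close> gives the product. Additive bounds can
  thus be proved term by term and converted once for the whole form.\<close>

lemma product_bound:
  assumes N_nonneg: "\<And>u. 0 \<le> N u"
    and N_scale: "\<And>u c. u \<in> V \<Longrightarrow> N (\<lambda>x. c * u x) = cmod c * N u"
    and bound: "\<And>u v. u \<in> V \<Longrightarrow> v \<in> V \<Longrightarrow> cmod (a u v) \<le> C * ((N u)\<^sup>2 + (N v)\<^sup>2)"
    and u: "u \<in> V" and v: "v \<in> V" and C: "0 < C"
  shows "cmod (a u v) \<le> 2 * C * N u * N v"
proof -
  have *: "cmod (a u v) \<le> C * (s\<^sup>2 * (N u)\<^sup>2 + (N v)\<^sup>2 / s\<^sup>2)" if s: "s > 0" for s :: real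
  proof -
    have "a (\<lambda>x. of_real s * u x) (\<lambda>x. of_real (1/s) * v x) = a u v"
      using scale_left[OF u scale[OF v, of "of_real (1/s)"], of "of_real s"]
        scale_right[OF v u, of "of_real (1/s)"] s by simp
    with bound[OF scale[OF u, of "of_real s"] scale[OF v, of "of_real (1/s)"]]
    show ?thesis using s N_scale[OF u, of "of_real s"] N_scale[OF v, of "of_real (1/s)"]
      by (simp add: power_mult_distrib power_divide norm_divide)
  qed
  show ?thesis
  proof (cases "N u = 0 \<or> N v = 0")
    case False
    then have pos: "N u > 0" "N v > 0" using N_nonneg[of u] N_nonneg[of v] by linarith+
    \<comment> \<open>The balancing value: both terms become \<open>N u * N v\<close>.\<close>
    define s where "s = sqrt (N v / N u)"
    have "s > 0" "s\<^sup>2 = N v / N u" using pos by (auto simp: s_def)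
    moreover from this pos have "s\<^sup>2 * (N u)\<^sup>2 = N u * N v" "(N v)\<^sup>2 / s\<^sup>2 = N u * N v"
      by (simp_all add: power2_eq_square)
    ultimately show ?thesis using *[of s] by simp
  next
    case True
    have "cmod (a u v) \<le> 0"
    proof (rule ccontr)
      assume "\<not> ?thesis"
      then have ap: "cmod (a u v) > 0" by simp
      define M where "M = C * ((N u)\<^sup>2 + (N v)\<^sup>2)"
      have M: "M > 0" using less_le_trans[OF ap, of M] *[of 1] by (simp add: M_def)
      consider "N u = 0" | "N v = 0" using True by blast
      then show False
      proof cases
        case 1
        \<comment> \<open>With \<open>N u = 0\<close> only \<open>M / s\<^sup>2\<close> survives,
          and this \<open>s\<close> makes it half of \<open>cmod (a u v)\<close>, a contradiction.
          The other case uses the reciprocal.\<close>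
        define s where "s = sqrt (2 * M / cmod (a u v))"
        have s: "s > 0" "s\<^sup>2 = 2 * M / cmod (a u v)" using M ap by (auto simp: s_def)
        have "C * (s\<^sup>2 * (N u)\<^sup>2 + (N v)\<^sup>2 / s\<^sup>2) = M / s\<^sup>2" using 1 by (simp add: M_def)
        also have "\<dots> = cmod (a u v) / 2" unfolding s(2) using M ap by simp
        finally show False using *[OF s(1)] ap by simp
      next
        case 2
        define s where "s = sqrt (cmod (a u v) / (2 * M))"
        have s: "s > 0" "s\<^sup>2 = cmod (a u v) / (2 * M)" using M ap by (auto simp: s_def)
        have "C * (s\<^sup>2 * (N u)\<^sup>2 + (N v)\<^sup>2 / s\<^sup>2) = s\<^sup>2 * M" using 2 by (simp add: M_def)
        also have "\<dots> = cmod (a u v) / 2" unfolding s(2) using M ap by simp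
        finally show False using *[OF s(1)] ap by simp
      qed
    qed
    then show ?thesis using True by auto
  qed
qed

text \<open>With \<open>W\<close> the sum of the \<open>w l\<close>, the chain is \<open>\<alpha> (N
  W)\<^sup>2 \<le> \<alpha> M \<Sum> (N (w l))\<^sup>2 \<le> 2 C M (N v) (N W)\<close>. One factor
  \<open>N W\<close> cancels, so \<open>1 / \<alpha>\<close> enters to the first power only. The
  hypothesis \<open>stable\<close> takes the place of a triangle inequality, which would bring in
  the number of subspaces.\<close>

lemma norm_sum_projections_le:
  assumes I: "finite I"
    and w: "\<And>l. l \<in> I \<Longrightarrow> w l \<in> V" and v: "v \<in> V"
    and proj: "\<And>l. l \<in> I \<Longrightarrow> a (w l) (w l) = a v (w l)"
    and N_nonneg: "\<And>u. 0 \<le> N u"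
    and N_scale: "\<And>u c. u \<in> V \<Longrightarrow> N (\<lambda>x. c * u x) = cmod c * N u"
    and bound: "\<And>u v. u \<in> V \<Longrightarrow> v \<in> V \<Longrightarrow> cmod (a u v) \<le> C * ((N u)\<^sup>2 + (N v)\<^sup>2)"
    and C: "0 < C"
    and coercive: "\<And>u. u \<in> V \<Longrightarrow> \<alpha> * (N u)\<^sup>2 \<le> Im (\<theta> * a u u)"
    and \<theta>: "cmod \<theta> \<le> 1" and \<alpha>: "0 < \<alpha>"
    and stable: "(N (\<lambda>x. \<Sum>l\<in>I. w l x))\<^sup>2 \<le> M * (\<Sum>l\<in>I. (N (w l))\<^sup>2)" and M: "0 \<le> M"
  shows "N (\<lambda>x. \<Sum>l\<in>I. w l x) \<le> 2 * C * M / \<alpha> * N v"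
proof -
  define W where "W = (\<lambda>x. \<Sum>l\<in>I. w l x)"
  have W: "W \<in> V" unfolding W_def using I w by (rule sum_in)
  have "\<alpha> * (\<Sum>l\<in>I. (N (w l))\<^sup>2) \<le> (\<Sum>l\<in>I. Im (\<theta> * a v (w l)))"
    unfolding sum_distrib_left using coercive[OF w] proj by (intro sum_mono) auto
  also have "\<dots> = Im (\<theta> * a v W)"
  proof -
    have "a v W = (\<Sum>l\<in>I. a v (w l))" unfolding W_def using I w v by (intro sum_right)
    then show ?thesis by (simp only: sum_distrib_left Im_sum)
  qed
  also have "\<dots> \<le> cmod (\<theta> * a v W)" using abs_Im_le_cmod abs_le_D1 by blast
  also have "\<dots> \<le> cmod (a v W)" using \<theta> by (simp add: norm_mult mult_left_le_one_le)
  also have "\<dots> \<le> 2 * C * N v * N W"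
    using product_bound[OF N_nonneg N_scale bound v W C] by blast
  finally have "\<alpha> * (\<Sum>l\<in>I. (N (w l))\<^sup>2) \<le> 2 * C * N v * N W" .
  from mult_left_mono[OF this M]
  have 1: "\<alpha> * (M * (\<Sum>l\<in>I. (N (w l))\<^sup>2)) \<le> N W * (2 * C * M * N v)"
    by (simp only: mult_ac)
  have "N W * (\<alpha> * N W) = \<alpha> * (N W)\<^sup>2" by (simp only: power2_eq_square mult_ac)
  also have "\<dots> \<le> \<alpha> * (M * (\<Sum>l\<in>I. (N (w l))\<^sup>2))"
    unfolding W_def using stable \<alpha> by (intro mult_left_mono) auto
  also note 1
  finally have "N W * (\<alpha> * N W) \<le> N W * (2 * C * M * N v)" .
  then have "\<alpha> * N W \<le> 2 * C * M * N v"
  proof (cases "N W = 0")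
    case True
    then show ?thesis using C M N_nonneg[of v] by simp
  next
    case False
    then have "N W > 0" using N_nonneg[of W] by linarith
    with \<open>N W * (\<alpha> * N W) \<le> N W * (2 * C * M * N v)\<close> show ?thesis by simp
  qed
  then show ?thesis using \<alpha> by (simp add: W_def field_simps)
qed

end

section \<open>Piecewise linear functions on a mesh\<close>

lemma P1_local_coeffs:
  fixes v :: "real^'n \<Rightarrow> complex"
  assumes "v \<in> P1 \<T> D"
  obtains c g where "\<And>T x. T \<in> \<T> \<Longrightarrow> x \<in> T \<Longrightarrow> v x = c T + (\<Sum>i\<in>UNIV. g T i * complex_of_real (x $ i))"
proof -
  have "\<forall>T\<in>\<T>. \<exists>p::complex \<times> ('n \<Rightarrow> complex). \<forall>x\<in>T. v x = fst p + (\<Sum>i\<in>UNIV. snd p i * complex_of_real (x $ i))"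
    using assms unfolding P1_def by auto
  from bchoice[OF this] obtain p where
    "\<forall>T\<in>\<T>. \<forall>x\<in>T. v x = fst (p T) + (\<Sum>i\<in>UNIV. snd (p T) i * complex_of_real (x $ i))"
    by blast
  then show ?thesis using that[of "fst \<circ> p" "snd \<circ> p"] by simp
qed

lemma P1_continuous: "v \<in> P1 \<T> D \<Longrightarrow> continuous_on D v"
  by (simp add: P1_def)

lemma P1_outside: "v \<in> P1 \<T> D \<Longrightarrow> x \<notin> D \<Longrightarrow> v x = 0"
  by (simp add: P1_def)

lemma P1_zero: "(\<lambda>x. 0) \<in> P1 \<T> D"
  unfolding P1_def by (auto intro!: exI[of _ 0] exI[of _ "\<lambda>_. 0"])

lemma P1_add:
  assumes "u \<in> P1 \<T> D" "v \<in> P1 \<T> D"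
  shows "(\<lambda>x. u x + v x) \<in> P1 \<T> D"
proof -
  obtain c g where u: "\<And>T x. T \<in> \<T> \<Longrightarrow> x \<in> T \<Longrightarrow> u x = c T + (\<Sum>i\<in>UNIV. g T i * complex_of_real (x $ i))"
    using P1_local_coeffs[OF assms(1)] by metis
  obtain c' g' where v: "\<And>T x. T \<in> \<T> \<Longrightarrow> x \<in> T \<Longrightarrow> v x = c' T + (\<Sum>i\<in>UNIV. g' T i * complex_of_real (x $ i))"
    using P1_local_coeffs[OF assms(2)] by metis
  have "\<exists>c g. \<forall>x\<in>T. u x + v x = c + (\<Sum>i\<in>UNIV. g i * complex_of_real (x $ i))" if "T \<in> \<T>" for T
    using u[OF that] v[OF that]
    by (intro exI[of _ "c T + c' T"] exI[of _ "\<lambda>i. g T i + g' T i"]) (simp add: algebra_simps sum.distrib)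
  then show ?thesis using assms unfolding P1_def by (auto intro: continuous_intros)
qed

lemma P1_scale:
  assumes "u \<in> P1 \<T> D"
  shows "(\<lambda>x. a * u x) \<in> P1 \<T> D"
proof -
  obtain c g where u: "\<And>T x. T \<in> \<T> \<Longrightarrow> x \<in> T \<Longrightarrow> u x = c T + (\<Sum>i\<in>UNIV. g T i * complex_of_real (x $ i))"
    using P1_local_coeffs[OF assms(1)] by metis
  have "\<exists>c g. \<forall>x\<in>T. a * u x = c + (\<Sum>i\<in>UNIV. g i * complex_of_real (x $ i))" if "T \<in> \<T>" for T
    using u[OF that]
    by (intro exI[of _ "a * c T"] exI[of _ "\<lambda>i. a * g T i"]) (simp add: algebra_simps sum_distrib_left)
  then show ?thesis using assms unfolding P1_def by (auto intro: continuous_intros)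
qed

lemma P1_sum:
  assumes "finite I" "\<And>i. i \<in> I \<Longrightarrow> w i \<in> P1 \<T> D"
  shows "(\<lambda>x. \<Sum>i\<in>I. w i x) \<in> P1 \<T> D"
  using assms by (induction I rule: finite_induct) (auto simp: P1_zero intro: P1_add)

text \<open>\<open>T\<close> is an arbitrary set: the lemma serves mesh elements and also, with zero
  coefficients, the zero set of \<open>v\<close>. Interior points are required because
  \<open>grad\<close> is a classical pointwise derivative.\<close>

lemma grad_affine:
  fixes v :: "real^'n \<Rightarrow> complex"
  assumes v: "\<And>y. y \<in> T \<Longrightarrow> v y = c + (\<Sum>i\<in>UNIV. g i * complex_of_real (y $ i))"
    and x: "x \<in> interior T"
  shows "grad v x $ i = g i"
proof -
  let ?f = "\<lambda>t::real. c + (\<Sum>j\<in>UNIV. g j * complex_of_real (x $ j)) + of_real t * g i"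
  let ?S = "(\<lambda>t::real. x + t *\<^sub>R axis i 1) -` interior T"
  have S: "open ?S" by (intro open_vimage continuous_intros) auto
  have eq: "v (x + t *\<^sub>R axis i 1) = ?f t" if "t \<in> ?S" for t
  proof -
    have "(\<Sum>j\<in>UNIV. g j * complex_of_real ((x + t *\<^sub>R axis i 1) $ j))
        = (\<Sum>j\<in>UNIV. g j * complex_of_real (x $ j) + (if j = i then of_real t * g i else 0))"
      by (rule sum.cong) (auto simp: axis_def algebra_simps)
    then show ?thesis using v[of "x + t *\<^sub>R axis i 1"] that interior_subset[of T]
      by (auto simp: sum.distrib)
  qed
  have "(?f has_vector_derivative g i) (at 0)"
    by (auto intro!: derivative_eq_intros simp: has_vector_derivative_def scaleR_conv_of_real)
  then have "((\<lambda>t. v (x + t *\<^sub>R axis i 1)) has_vector_derivative g i) (at 0)"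
    by (rule has_vector_derivative_transform_within_open[OF _ S]) (use x eq in auto)
  then show ?thesis by (simp add: grad_def vector_derivative_at)
qed

lemma grad_eq_0_outside_support:
  fixes v :: "real^'n \<Rightarrow> complex"
  assumes "x \<notin> closure {y. v y \<noteq> 0}"
  shows "grad v x = 0"
proof -
  have *: "x \<in> interior {y. v y = 0}"
    using assms by (simp add: closure_interior Collect_neg_eq[symmetric] Compl_eq)
  have "grad v x $ i = 0" for i
    using grad_affine[of "{y. v y = 0}" v 0 "\<lambda>_. 0" x i] * by simp
  then show ?thesis by (simp add: vec_eq_iff)
qed

section \<open>Conforming meshes and elementwise constant gradients\<close>

locale fe_mesh =
  fixes \<sigma> :: real and \<T> :: "(real^'n) set set" and \<Omega> :: "(real^'n) set"
  assumes mesh: "sr_mesh \<sigma> \<T> (closure \<Omega>)" and open_domain: "open \<Omega>" and bounded_domain: "bounded \<Omega>"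
begin

text \<open>The null set off which each point of the closed domain is interior to an element;
  identities for \<open>grad\<close> are claimed only there.\<close>

definition skeleton :: "(real^'n) set" where "skeleton = \<Union>(frontier ` \<T>)"

lemma finite_mesh: "finite \<T>" and Union_mesh: "\<Union>\<T> = closure \<Omega>"
  and simplex_mesh: "T \<in> \<T> \<Longrightarrow> int CARD('n) simplex T"
  and mesh_inter1: "T \<in> \<T> \<Longrightarrow> T' \<in> \<T> \<Longrightarrow> T \<noteq> T' \<Longrightarrow> (T \<inter> T') face_of T"
  and mesh_inter2: "T \<in> \<T> \<Longrightarrow> T' \<in> \<T> \<Longrightarrow> T \<noteq> T' \<Longrightarrow> (T \<inter> T') face_of T'"
  using mesh unfolding sr_mesh_def by auto

lemma mesh_convex: "T \<in> \<T> \<Longrightarrow> convex T"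
  and mesh_compact: "T \<in> \<T> \<Longrightarrow> compact T"
  and mesh_closed: "T \<in> \<T> \<Longrightarrow> closed T"
  using simplex_mesh convex_simplex compact_simplex compact_imp_closed by blast+

lemma mesh_aff_dim: "T \<in> \<T> \<Longrightarrow> aff_dim T = int CARD('n)"
  using simplex_mesh aff_dim_simplex by blast

lemma mesh_interior:
  assumes "T \<in> \<T>"
  shows "interior T \<noteq> {}"
proof
  assume "interior T = {}"
  then obtain a b where "a \<noteq> 0" "T \<subseteq> {x. a \<bullet> x = b}"
    using empty_interior_subset_hyperplane[OF mesh_convex[OF assms]] by blast
  then have "aff_dim T \<le> int CARD('n) - 1"
    using aff_dim_subset[of T "{x. a \<bullet> x = b}"] aff_dim_hyperplane[of a b] by simp
  then show False using mesh_aff_dim[OF assms] by simp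
qed

lemma mesh_subset: "T \<in> \<T> \<Longrightarrow> T \<subseteq> closure \<Omega>"
  using Union_mesh by blast

lemma compact_closure_domain: "compact (closure \<Omega>)"
  using bounded_domain compact_closure by blast

lemma negligible_skeleton: "negligible skeleton"
  unfolding skeleton_def using finite_mesh mesh_convex
  by (intro negligible_Union) (auto intro: negligible_convex_frontier)

lemma off_skeleton:
  assumes "x \<in> closure \<Omega>" "x \<notin> skeleton"
  obtains T where "T \<in> \<T>" "x \<in> interior T"
proof -
  obtain T where T: "T \<in> \<T>" "x \<in> T" using assms(1) Union_mesh by blast
  then have "x \<notin> frontier T" using assms(2) unfolding skeleton_def by blast
  then show ?thesis using that[OF T(1)] T mesh_closed by (simp add: frontier_def)
qed

lemma grad_add:
  assumes "u \<in> P1 \<T> D" "v \<in> P1 \<T> D" "x \<in> closure \<Omega>" "x \<notin> skeleton"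
  shows "grad (\<lambda>x. u x + v x) x $ i = grad u x $ i + grad v x $ i"
proof -
  obtain T where T: "T \<in> \<T>" "x \<in> interior T" using off_skeleton assms by blast
  obtain c g where u: "\<And>T x. T \<in> \<T> \<Longrightarrow> x \<in> T \<Longrightarrow> u x = c T + (\<Sum>i\<in>UNIV. g T i * complex_of_real (x $ i))"
    using P1_local_coeffs[OF assms(1)] by metis
  obtain c' g' where v: "\<And>T x. T \<in> \<T> \<Longrightarrow> x \<in> T \<Longrightarrow> v x = c' T + (\<Sum>i\<in>UNIV. g' T i * complex_of_real (x $ i))"
    using P1_local_coeffs[OF assms(2)] by metis
  have "grad u x $ i = g T i" "grad v x $ i = g' T i"
    using grad_affine[of T u "c T" "g T" x i] grad_affine[of T v "c' T" "g' T" x i] u v T by auto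
  moreover have "grad (\<lambda>x. u x + v x) x $ i = g T i + g' T i"
    by (rule grad_affine[of T _ "c T + c' T" "\<lambda>i. g T i + g' T i"])
      (use u v T in \<open>auto simp: algebra_simps sum.distrib\<close>)
  ultimately show ?thesis by simp
qed

lemma grad_scale:
  assumes "u \<in> P1 \<T> D" "x \<in> closure \<Omega>" "x \<notin> skeleton"
  shows "grad (\<lambda>x. a * u x) x $ i = a * grad u x $ i"
proof -
  obtain T where T: "T \<in> \<T>" "x \<in> interior T" using off_skeleton assms by blast
  obtain c g where u: "\<And>T x. T \<in> \<T> \<Longrightarrow> x \<in> T \<Longrightarrow> u x = c T + (\<Sum>i\<in>UNIV. g T i * complex_of_real (x $ i))"
    using P1_local_coeffs[OF assms(1)] by metis
  have "grad u x $ i = g T i"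
    using grad_affine[of T u "c T" "g T" x i] u T by auto
  moreover have "grad (\<lambda>x. a * u x) x $ i = a * g T i"
    by (rule grad_affine[of T _ "a * c T" "\<lambda>i. a * g T i"])
      (use u T in \<open>auto simp: algebra_simps sum_distrib_left\<close>)
  ultimately show ?thesis by simp
qed

lemma grad_sum:
  assumes "finite I" "\<And>l. l \<in> I \<Longrightarrow> w l \<in> P1 \<T> D" "x \<in> closure \<Omega>" "x \<notin> skeleton"
  shows "grad (\<lambda>x. \<Sum>l\<in>I. w l x) x $ i = (\<Sum>l\<in>I. grad (w l) x $ i)"
  using assms(1,2)
proof (induction I rule: finite_induct)
  case empty
  then show ?case using grad_eq_0_outside_support[of x "\<lambda>x. 0"] by simp
next
  case (insert l I)
  then have "(\<lambda>x. \<Sum>l\<in>I. w l x) \<in> P1 \<T> D" by (intro P1_sum) auto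
  from grad_add[OF _ this assms(3,4), of "w l" i] insert show ?case by simp
qed

text \<open>The open pieces \<open>\<Omega> \<inter> interior T\<close> are finitely many and
  exhaust \<open>\<Omega>\<close> up to the skeleton, so whatever value \<open>f\<close> takes on
  the skeleton is immaterial. This covers \<open>grad\<close>, which is unspecified where
  \<open>v\<close> has a kink.\<close>

lemma integrable_elementwise_constant:
  fixes f :: "real^'n \<Rightarrow> 'b::euclidean_space"
  assumes "\<And>T. T \<in> \<T> \<Longrightarrow> \<exists>k. \<forall>x\<in>interior T. f x = k"
  shows "f absolutely_integrable_on \<Omega>"
proof -
  have 1: "f absolutely_integrable_on (\<Omega> \<inter> interior T)" if T: "T \<in> \<T>" for T
  proof -
    obtain k where k: "\<forall>x\<in>interior T. f x = k" using assms[OF T] by blast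
    have "(\<lambda>x. k) absolutely_integrable_on (\<Omega> \<inter> interior T)"
      using open_domain bounded_domain
      by (intro absolutely_integrable_on_const lmeasurable_open bounded_Int) auto
    then show ?thesis
      by (rule absolutely_integrable_spike[OF _ negligible_empty]) (use k in auto)
  qed
  have 2: "f absolutely_integrable_on (\<Union>T\<in>\<T>. \<Omega> \<inter> interior T)"
  proof (rule set_integrable_UN[OF finite_mesh])
    fix T assume "T \<in> \<T>"
    then show "f absolutely_integrable_on (\<Omega> \<inter> interior T)" by (rule 1)
    show "\<Omega> \<inter> interior T \<in> sets lebesgue"
      using open_domain by (intro lmeasurable_open[THEN fmeasurableD]) (auto intro: bounded_Int simp: bounded_domain)
  qed
  have "\<Omega> - (\<Union>T\<in>\<T>. \<Omega> \<inter> interior T) \<subseteq> skeleton"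
    using off_skeleton closure_subset by blast
  then have n1: "negligible {x \<in> \<Omega> - (\<Union>T\<in>\<T>. \<Omega> \<inter> interior T). f x \<noteq> 0}"
    by (intro negligible_subset[OF negligible_skeleton]) auto
  have "{x \<in> (\<Union>T\<in>\<T>. \<Omega> \<inter> interior T) - \<Omega>. f x \<noteq> 0} = {}" by blast
  then have n2: "negligible {x \<in> (\<Union>T\<in>\<T>. \<Omega> \<inter> interior T) - \<Omega>. f x \<noteq> 0}" by (simp only: negligible_empty)
  show ?thesis by (rule absolutely_integrable_spike_set_eq[OF n1 n2, THEN iffD2, OF 2])
qed

lemma grad_elementwise_constant:
  assumes "u \<in> P1 \<T> D" "T \<in> \<T>"
  shows "\<exists>k. \<forall>x\<in>interior T. grad u x = k"
proof -
  obtain c g where u: "\<And>T x. T \<in> \<T> \<Longrightarrow> x \<in> T \<Longrightarrow> u x = c T + (\<Sum>i\<in>UNIV. g T i * complex_of_real (x $ i))"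
    using P1_local_coeffs[OF assms(1)] by metis
  show ?thesis
    using grad_affine[of T u "c T" "g T"] u assms(2)
    by (intro exI[of _ "\<chi> i. g T i"]) (auto simp: vec_eq_iff)
qed

lemma integrable_grad:
  fixes f :: "complex^'n \<Rightarrow> complex^'n \<Rightarrow> 'b::euclidean_space"
  assumes "u \<in> P1 \<T> D" "v \<in> P1 \<T> D"
  shows "(\<lambda>x. f (grad u x) (grad v x)) absolutely_integrable_on \<Omega>"
proof (rule integrable_elementwise_constant)
  fix T assume "T \<in> \<T>"
  then obtain k k' where "\<forall>x\<in>interior T. grad u x = k" "\<forall>x\<in>interior T. grad v x = k'"
    using grad_elementwise_constant assms by meson
  then show "\<exists>k. \<forall>x\<in>interior T. f (grad u x) (grad v x) = k"
    by (intro exI[of _ "f k k'"]) simp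
qed

lemma integrable_continuous:
  fixes f :: "real^'n \<Rightarrow> 'b::euclidean_space"
  assumes "continuous_on (closure \<Omega>) f"
  shows "f absolutely_integrable_on \<Omega>"
proof -
  have "integrable lebesgue (\<lambda>x. indicator (closure \<Omega>) x *\<^sub>R f x)"
    using borel_integrable_compact[OF compact_closure_domain assms]
    by (intro integrable_completion[THEN iffD2]) auto
  then have "f absolutely_integrable_on closure \<Omega>"
    by (simp add: set_integrable_def)
  then show ?thesis
    by (rule set_integrable_subset[OF _ _ closure_subset])
      (use open_domain bounded_domain in \<open>auto intro: lmeasurable_open[THEN fmeasurableD]\<close>)
qed

text \<open>\<open>X\<close> collects the vertices of all elements: an affine function vanishing at
  the vertices vanishes on their convex hull. These are the point evaluations on which the existence
  proof for projections runs its induction.\<close>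

lemma P1_separated:
  obtains X where "finite X" "\<And>v. v \<in> P1 \<T> (closure \<Omega>) \<Longrightarrow> (\<And>x. x \<in> X \<Longrightarrow> v x = 0) \<Longrightarrow> v = (\<lambda>x. 0)"
proof -
  have "\<forall>T\<in>\<T>. \<exists>C. finite C \<and> T = convex hull C"
    using simplex_mesh unfolding simplex by blast
  then obtain C where C: "\<And>T. T \<in> \<T> \<Longrightarrow> finite (C T)" "\<And>T. T \<in> \<T> \<Longrightarrow> T = convex hull (C T)"
    by metis
  show ?thesis
  proof (rule that[of "\<Union>T\<in>\<T>. C T"])
    show "finite (\<Union>T\<in>\<T>. C T)" using C finite_mesh by blast
    fix v assume v: "v \<in> P1 \<T> (closure \<Omega>)" and z: "\<And>x. x \<in> (\<Union>T\<in>\<T>. C T) \<Longrightarrow> v x = 0"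
    obtain c g where cg: "\<And>T x. T \<in> \<T> \<Longrightarrow> x \<in> T \<Longrightarrow> v x = c T + (\<Sum>i\<in>UNIV. g T i * complex_of_real (x $ i))"
      using P1_local_coeffs[OF v] by metis
    have "v x = 0" if "T \<in> \<T>" "x \<in> T" for T x
    proof -
      let ?Z = "{y. c T + (\<Sum>i\<in>UNIV. g T i * complex_of_real (y $ i)) = 0}"
      have "convex ?Z"
      proof (rule convexI)
        fix x y and p q :: real assume "x \<in> ?Z" "y \<in> ?Z" "0 \<le> p" "0 \<le> q" and pq: "p + q = 1"
        then have X: "(\<Sum>i\<in>UNIV. g T i * complex_of_real (x $ i)) = - c T"
          and Y: "(\<Sum>i\<in>UNIV. g T i * complex_of_real (y $ i)) = - c T"
          by (auto simp: eq_neg_iff_add_eq_0 add.commute)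
        have "(\<Sum>i\<in>UNIV. g T i * complex_of_real ((p *\<^sub>R x + q *\<^sub>R y) $ i))
          = of_real p * (\<Sum>i\<in>UNIV. g T i * complex_of_real (x $ i))
            + of_real q * (\<Sum>i\<in>UNIV. g T i * complex_of_real (y $ i))"
          by (simp add: algebra_simps sum.distrib sum_distrib_left)
        also have "\<dots> = - (of_real (p + q) * c T)" unfolding X Y by (simp add: algebra_simps)
        finally show "p *\<^sub>R x + q *\<^sub>R y \<in> ?Z" using pq by simp
      qed
      moreover have "C T \<subseteq> ?Z"
        using z cg[OF that(1)] C(2)[OF that(1)] hull_subset[of "C T" convex] that(1) by fastforce
      ultimately have "T \<subseteq> ?Z" using C(2)[OF that(1)] hull_minimal[of "C T" ?Z convex] by auto
      then show ?thesis using cg that by auto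
    qed
    then show "v = (\<lambda>x. 0)" using P1_outside[OF v] Union_mesh by blast
  qed
qed

end

section \<open>Boundedness and coercivity of the Helmholtz form\<close>

lemma set_lebesgue_integral_spike:
  fixes f :: "'a::euclidean_space \<Rightarrow> 'b::euclidean_space"
  assumes f: "f absolutely_integrable_on S" and N: "negligible N" "\<And>x. x \<in> S - N \<Longrightarrow> g x = f x"
  shows "(LINT x:S|lebesgue. g x) = (LINT x:S|lebesgue. f x)"
  using absolutely_integrable_spike[OF f N] f integral_spike[OF N]
  by (simp add: set_lebesgue_integral_eq_integral)

lemma cmod_mult_cnj_le: "cmod (a * cnj b) \<le> ((cmod a)\<^sup>2 + (cmod b)\<^sup>2) / 2"
  using sum_squares_bound[of "cmod a" "cmod b"] by (simp add: norm_mult)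

lemma norm_set_integral_mult_cnj_le:
  assumes "set_integrable M S (\<lambda>x. u x * cnj (v x))"
    and "set_integrable M S (\<lambda>x. (cmod (u x))\<^sup>2)" "set_integrable M S (\<lambda>x. (cmod (v x))\<^sup>2)"
  shows "cmod (LINT x:S|M. u x * cnj (v x))
    \<le> ((LINT x:S|M. (cmod (u x))\<^sup>2) + (LINT x:S|M. (cmod (v x))\<^sup>2)) / 2"
proof -
  have "cmod (LINT x:S|M. u x * cnj (v x)) \<le> (LINT x:S|M. cmod (u x * cnj (v x)))"
    by (rule set_integral_norm_bound[OF assms(1)])
  also have "\<dots> \<le> (LINT x:S|M. ((cmod (u x))\<^sup>2 + (cmod (v x))\<^sup>2) / 2)"
    by (rule set_integral_mono[OF set_integrable_norm[OF assms(1)]])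
      (use assms cmod_mult_cnj_le in \<open>auto intro: set_integral_add\<close>)
  finally show ?thesis using assms by simp
qed

section \<open>Surface integrals over flat faces\<close>

definition face_proj :: "(real^'n) set \<Rightarrow> real^'n \<Rightarrow> real^'n" where
  "face_proj F x = x - (face_normal F \<bullet> (x - face_point F)) *\<^sub>R face_normal F"

lemma continuous_face_proj: "continuous_on A (face_proj F)"
  unfolding face_proj_def by (intro continuous_intros)

lemma face_point_in: "F \<noteq> {} \<Longrightarrow> face_point F \<in> F"
  unfolding face_point_def by (simp add: some_in_eq)

text \<open>A set of codimension one lies in a hyperplane, whose normalised normal witnesses the
  choice. The orientation stays undetermined, which is why later bounds involve only the absolute
  value of \<open>face_normal F \<bullet> e\<close>.\<close>

lemma face_normal:
  fixes F :: "(real^'n) set"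
  assumes "aff_dim F = int CARD('n) - 1"
  shows "norm (face_normal F) = 1" "x \<in> F \<Longrightarrow> y \<in> F \<Longrightarrow> face_normal F \<bullet> (x - y) = 0"
proof -
  obtain a b where a: "a \<noteq> 0" "F \<subseteq> {x. a \<bullet> x = b}"
    using aff_lowdim_subset_hyperplane[of F] assms by auto
  have "\<exists>\<nu>. norm \<nu> = 1 \<and> (\<forall>x\<in>F. \<forall>y\<in>F. \<nu> \<bullet> (x - y) = 0)"
    using a by (intro exI[of _ "a /\<^sub>R norm a"]) (auto simp: inner_diff_right subset_iff)
  from someI_ex[OF this] show "norm (face_normal F) = 1"
    "x \<in> F \<Longrightarrow> y \<in> F \<Longrightarrow> face_normal F \<bullet> (x - y) = 0"
    unfolding face_normal_def by auto
qed

text \<open>Coordinates of the prism: foot point on the face and signed height. In this form its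
  indicator factorises, as Fubini requires.\<close>

lemma face_prism_eq:
  fixes F :: "(real^'n) set"
  assumes dim: "aff_dim F = int CARD('n) - 1"
  shows "face_prism F = {x. face_proj F x \<in> F \<and> face_normal F \<bullet> (x - face_point F) \<in> {0..1}}"
proof (intro equalityI subsetI)
  let ?\<nu> = "face_normal F" and ?p = "face_point F"
  fix x assume "x \<in> face_prism F"
  then obtain y s where x: "x = y + s *\<^sub>R ?\<nu>" "y \<in> F" "0 \<le> s" "s \<le> 1"
    by (auto simp: face_prism_def)
  have p: "?p \<in> F" using x by (intro face_point_in) auto
  have "?\<nu> \<bullet> (x - ?p) = ?\<nu> \<bullet> (y - ?p) + s * (norm ?\<nu>)\<^sup>2"
    by (simp add: x inner_diff_right inner_add_right power2_norm_eq_inner)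
  then have "?\<nu> \<bullet> (x - ?p) = s" using face_normal[OF dim] p x by simp
  then show "x \<in> {x. face_proj F x \<in> F \<and> ?\<nu> \<bullet> (x - ?p) \<in> {0..1}}"
    using x by (simp add: face_proj_def)
next
  fix x assume "x \<in> {x. face_proj F x \<in> F \<and> face_normal F \<bullet> (x - face_point F) \<in> {0..1}}"
  then show "x \<in> face_prism F" unfolding face_prism_def face_proj_def
    by (intro CollectI exI[of _ "face_proj F x"] exI[of _ "face_normal F \<bullet> (x - face_point F)"])
      (auto simp: face_proj_def)
qed

lemma compact_face_prism:
  assumes "compact F"
  shows "compact (face_prism F)"
proof -
  have "face_prism F = (\<lambda>(y, s). y + s *\<^sub>R face_normal F) ` (F \<times> {0..1})"
    unfolding face_prism_def by force
  then show ?thesis using assms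
    by (auto intro!: compact_continuous_image compact_Times continuous_intros simp: case_prod_unfold)
qed

context fe_mesh
begin

definition boundary_faces :: "(real^'n) set set" where
  "boundary_faces = {F\<in>mesh_faces \<T>. F \<subseteq> frontier \<Omega>}"

lemma finite_boundary_faces: "finite boundary_faces"
proof -
  have "boundary_faces \<subseteq> (\<Union>T\<in>\<T>. {F. F face_of T})"
    by (auto simp: boundary_faces_def mesh_faces_def)
  moreover have "finite (\<Union>T\<in>\<T>. {F. F face_of T})"
    using finite_mesh simplex_mesh simplex_imp_polytope finite_polytope_faces by blast
  ultimately show ?thesis by (rule finite_subset)
qed

lemma boundary_face:
  assumes "F \<in> boundary_faces"
  shows "compact F" "convex F" "F \<noteq> {}" "F \<subseteq> closure \<Omega>" "F \<subseteq> frontier \<Omega>" "aff_dim F = int CARD('n) - 1"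
proof -
  obtain T where T: "T \<in> \<T>" "F face_of T" "aff_dim F = int CARD('n) - 1" "F \<subseteq> frontier \<Omega>"
    using assms by (auto simp: boundary_faces_def mesh_faces_def)
  show "compact F" "convex F" "F \<subseteq> closure \<Omega>" "aff_dim F = int CARD('n) - 1" "F \<subseteq> frontier \<Omega>"
    using T mesh_compact mesh_convex face_of_imp_compact face_of_imp_convex face_of_imp_subset mesh_subset
    by blast+
  show "F \<noteq> {}" using T(3) by auto
qed

lemma integrable_face:
  fixes f :: "real^'n \<Rightarrow> 'b::euclidean_space"
  assumes "continuous_on (closure \<Omega>) f" "F \<in> boundary_faces"
  shows "(\<lambda>x. f (face_proj F x)) absolutely_integrable_on (face_prism F)"
proof -
  note F = boundary_face[OF assms(2)]
  have "continuous_on (face_prism F) (\<lambda>x. f (face_proj F x))"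
    by (rule continuous_on_compose2[OF assms(1) continuous_face_proj])
      (use F(4) face_prism_eq[OF F(6)] in auto)
  from borel_integrable_compact[OF compact_face_prism[OF F(1)] this] show ?thesis
    unfolding set_integrable_def by (intro integrable_completion[THEN iffD2]) auto
qed

definition bdry_form :: "(real^'n \<Rightarrow> complex) \<Rightarrow> (real^'n \<Rightarrow> complex) \<Rightarrow> complex" where
  "bdry_form u v = bdry_integral \<T> \<Omega> (\<lambda>x. u x * cnj (v x))"

lemma bdry_form_eq:
  "bdry_form u v = (\<Sum>F\<in>boundary_faces. LINT x:face_prism F|lebesgue. u (face_proj F x) * cnj (v (face_proj F x)))"
  by (simp add: bdry_form_def bdry_integral_def boundary_faces_def face_integral_def face_proj_def)

definition bdry_sq :: "(real^'n \<Rightarrow> complex) \<Rightarrow> real" where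
  "bdry_sq v = (\<Sum>F\<in>boundary_faces. LINT x:face_prism F|lebesgue. (cmod (v (face_proj F x)))\<^sup>2)"

definition grad_sq :: "(real^'n \<Rightarrow> complex) \<Rightarrow> real" where
  "grad_sq v = (LINT x:\<Omega>|lebesgue. \<Sum>i\<in>UNIV. (cmod (grad v x $ i))\<^sup>2)"

definition mass_sq :: "(real^'n \<Rightarrow> complex) \<Rightarrow> real" where
  "mass_sq v = (LINT x:\<Omega>|lebesgue. (cmod (v x))\<^sup>2)"

lemma grad_sq_nonneg: "0 \<le> grad_sq v"
  unfolding grad_sq_def set_lebesgue_integral_def by (intro integral_nonneg_AE) (simp add: sum_nonneg)

lemma mass_sq_nonneg: "0 \<le> mass_sq v"
  unfolding mass_sq_def set_lebesgue_integral_def by (intro integral_nonneg_AE) simp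

lemma bdry_sq_nonneg: "0 \<le> bdry_sq v"
  unfolding bdry_sq_def set_lebesgue_integral_def by (intro sum_nonneg integral_nonneg_AE) simp

lemma norm_1k_sq: "(norm_1k \<Omega> k v)\<^sup>2 = grad_sq v + k\<^sup>2 * mass_sq v"
  unfolding norm_1k_def grad_sq_def[symmetric] mass_sq_def[symmetric]
  using grad_sq_nonneg mass_sq_nonneg by simp

lemma norm_1k_nonneg: "0 \<le> norm_1k \<Omega> k v"
  unfolding norm_1k_def grad_sq_def[symmetric] mass_sq_def[symmetric]
  using grad_sq_nonneg mass_sq_nonneg by simp

lemma H1_self: "H1_semi_inner \<Omega> v v = of_real (grad_sq v)"
  unfolding H1_semi_inner_def grad_sq_def
  by (simp flip: set_integral_complex_of_real complex_norm_square)

lemma L2_self: "L2_inner \<Omega> v v = of_real (mass_sq v)"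
  unfolding L2_inner_def mass_sq_def
  by (simp flip: set_integral_complex_of_real complex_norm_square)

lemma bdry_form_self: "bdry_form v v = of_real (bdry_sq v)"
  unfolding bdry_form_eq bdry_sq_def
  by (simp flip: set_integral_complex_of_real complex_norm_square)

abbreviation Vh :: "(real^'n \<Rightarrow> complex) set" where "Vh \<equiv> P1 \<T> (closure \<Omega>)"

lemma integrable_grad_inner:
  "u \<in> Vh \<Longrightarrow> v \<in> Vh \<Longrightarrow>
   (\<lambda>x. \<Sum>i\<in>UNIV. grad u x $ i * cnj (grad v x $ i)) absolutely_integrable_on \<Omega>"
  using integrable_grad[where u=u and v=v and f="\<lambda>a b. \<Sum>i\<in>UNIV. a $ i * cnj (b $ i)"] by blast

lemma integrable_grad_sq:
  "u \<in> Vh \<Longrightarrow> (\<lambda>x. \<Sum>i\<in>UNIV. (cmod (grad u x $ i))\<^sup>2) absolutely_integrable_on \<Omega>"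
  using integrable_grad[where u=u and v=u and f="\<lambda>a b. \<Sum>i\<in>UNIV. (cmod (a $ i))\<^sup>2"] by blast

lemma integrable_inner:
  "u \<in> Vh \<Longrightarrow> v \<in> Vh \<Longrightarrow> (\<lambda>x. u x * cnj (v x)) absolutely_integrable_on \<Omega>"
  by (intro integrable_continuous continuous_intros P1_continuous)

lemma integrable_sq: "u \<in> Vh \<Longrightarrow> (\<lambda>x. (cmod (u x))\<^sup>2) absolutely_integrable_on \<Omega>"
  by (intro integrable_continuous continuous_intros P1_continuous)

lemma integrable_face_inner:
  assumes "u \<in> Vh" "v \<in> Vh" "F \<in> boundary_faces"
  shows "(\<lambda>x. u (face_proj F x) * cnj (v (face_proj F x))) absolutely_integrable_on (face_prism F)"
  by (intro integrable_face[where f="\<lambda>x. u x * cnj (v x)"] continuous_intros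
      P1_continuous[OF assms(1)] P1_continuous[OF assms(2)] assms)

lemma integrable_face_sq:
  assumes "u \<in> Vh" "F \<in> boundary_faces"
  shows "(\<lambda>x. (cmod (u (face_proj F x)))\<^sup>2) absolutely_integrable_on (face_prism F)"
  by (intro integrable_face[where f="\<lambda>x. (cmod (u x))\<^sup>2"] continuous_intros P1_continuous[OF assms(1)] assms)

text \<open>\<open>grad\<close> is known to be additive only off the skeleton, so the two integrands
  are compared after removing a null set.\<close>

lemma H1_add_left:
  assumes "u \<in> Vh" "v \<in> Vh" "w \<in> Vh"
  shows "H1_semi_inner \<Omega> (\<lambda>x. u x + v x) w = H1_semi_inner \<Omega> u w + H1_semi_inner \<Omega> v w"
proof -
  have "H1_semi_inner \<Omega> (\<lambda>x. u x + v x) w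
      = (LINT x:\<Omega>|lebesgue. (\<Sum>i\<in>UNIV. grad u x $ i * cnj (grad w x $ i)) + (\<Sum>i\<in>UNIV. grad v x $ i * cnj (grad w x $ i)))"
    unfolding H1_semi_inner_def
  proof (rule set_lebesgue_integral_spike[OF _ negligible_skeleton])
    fix x assume "x \<in> \<Omega> - skeleton"
    then have "x \<in> closure \<Omega>" "x \<notin> skeleton" using closure_subset by auto
    then show "(\<Sum>i\<in>UNIV. grad (\<lambda>x. u x + v x) x $ i * cnj (grad w x $ i)) =
       (\<Sum>i\<in>UNIV. grad u x $ i * cnj (grad w x $ i)) + (\<Sum>i\<in>UNIV. grad v x $ i * cnj (grad w x $ i))"
      using grad_add[OF assms(1,2)] by (simp add: sum.distrib algebra_simps)
  qed (use integrable_grad_inner assms in auto)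
  then show ?thesis using integrable_grad_inner assms unfolding H1_semi_inner_def by simp
qed

lemma H1_scale_left:
  assumes "u \<in> Vh" "w \<in> Vh"
  shows "H1_semi_inner \<Omega> (\<lambda>x. c * u x) w = c * H1_semi_inner \<Omega> u w"
proof -
  have "H1_semi_inner \<Omega> (\<lambda>x. c * u x) w
      = (LINT x:\<Omega>|lebesgue. c * (\<Sum>i\<in>UNIV. grad u x $ i * cnj (grad w x $ i)))"
    unfolding H1_semi_inner_def
  proof (rule set_lebesgue_integral_spike[OF _ negligible_skeleton])
    fix x assume "x \<in> \<Omega> - skeleton"
    then have "x \<in> closure \<Omega>" "x \<notin> skeleton" using closure_subset by auto
    then show "(\<Sum>i\<in>UNIV. grad (\<lambda>x. c * u x) x $ i * cnj (grad w x $ i)) =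
       c * (\<Sum>i\<in>UNIV. grad u x $ i * cnj (grad w x $ i))"
      using grad_scale[OF assms(1)] by (simp add: sum_distrib_left algebra_simps)
  qed (use integrable_grad_inner assms in auto)
  then show ?thesis unfolding H1_semi_inner_def by simp
qed

lemma set_integral_cnj: "(LINT x:S|M. cnj (f x)) = cnj (LINT x:S|M. f x)"
  using Bochner_Integration.integral_cnj[of M "\<lambda>x. indicator S x *\<^sub>R f x"]
  by (simp add: set_lebesgue_integral_def scaleR_conv_of_real)

text \<open>Hermitian symmetry of each of the three ingredients transfers linearity from the first
  argument to conjugate linearity in the second. The full form lacks this symmetry because of its
  complex coefficients.\<close>

lemma H1_cnj: "H1_semi_inner \<Omega> u v = cnj (H1_semi_inner \<Omega> v u)"
  unfolding H1_semi_inner_def set_integral_cnj[symmetric] by (simp add: mult.commute)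

lemma L2_cnj: "L2_inner \<Omega> u v = cnj (L2_inner \<Omega> v u)"
  unfolding L2_inner_def set_integral_cnj[symmetric] by (simp add: mult.commute)

lemma bdry_form_cnj: "bdry_form u v = cnj (bdry_form v u)"
  unfolding bdry_form_eq cnj_sum set_integral_cnj[symmetric] by (simp add: mult.commute)

lemma L2_add_left:
  assumes "u \<in> Vh" "v \<in> Vh" "w \<in> Vh"
  shows "L2_inner \<Omega> (\<lambda>x. u x + v x) w = L2_inner \<Omega> u w + L2_inner \<Omega> v w"
  using assms integrable_inner unfolding L2_inner_def by (simp add: distrib_right)

lemma L2_scale_left: "L2_inner \<Omega> (\<lambda>x. c * u x) w = c * L2_inner \<Omega> u w"
  unfolding L2_inner_def by (simp add: mult.assoc)

lemma bdry_form_add_left: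
  assumes "u \<in> Vh" "v \<in> Vh" "w \<in> Vh"
  shows "bdry_form (\<lambda>x. u x + v x) w = bdry_form u w + bdry_form v w"
  using assms integrable_face_inner unfolding bdry_form_eq
  by (simp add: distrib_right flip: sum.distrib)

lemma bdry_form_scale_left: "bdry_form (\<lambda>x. c * u x) w = c * bdry_form u w"
  unfolding bdry_form_eq by (simp add: mult.assoc sum_distrib_left)

lemma a_eps_alt: "a_eps \<T> \<Omega> k \<epsilon> \<eta> u v = H1_semi_inner \<Omega> u v
    - (complex_of_real (k\<^sup>2) + \<i> * complex_of_real \<epsilon>) * L2_inner \<Omega> u v - \<i> * \<eta> * bdry_form u v"
  by (simp add: a_eps_def bdry_form_def)

lemma sesquilinear_a_eps: "sesquilinear_on Vh (a_eps \<T> \<Omega> k \<epsilon> \<eta>)"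
proof
  fix u v w assume V: "u \<in> Vh" "v \<in> Vh" "w \<in> Vh"
  show "a_eps \<T> \<Omega> k \<epsilon> \<eta> (\<lambda>x. u x + v x) w = a_eps \<T> \<Omega> k \<epsilon> \<eta> u w + a_eps \<T> \<Omega> k \<epsilon> \<eta> v w"
    by (simp add: a_eps_alt H1_add_left L2_add_left bdry_form_add_left V algebra_simps)
  have "H1_semi_inner \<Omega> w (\<lambda>x. u x + v x) = H1_semi_inner \<Omega> w u + H1_semi_inner \<Omega> w v"
    "L2_inner \<Omega> w (\<lambda>x. u x + v x) = L2_inner \<Omega> w u + L2_inner \<Omega> w v"
    "bdry_form w (\<lambda>x. u x + v x) = bdry_form w u + bdry_form w v"
    using H1_add_left[OF V] L2_add_left[OF V] bdry_form_add_left[OF V]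
      H1_cnj[of w] L2_cnj[of w] bdry_form_cnj[of w] by simp_all
  then show "a_eps \<T> \<Omega> k \<epsilon> \<eta> w (\<lambda>x. u x + v x) = a_eps \<T> \<Omega> k \<epsilon> \<eta> w u + a_eps \<T> \<Omega> k \<epsilon> \<eta> w v"
    by (simp add: a_eps_alt algebra_simps)
next
  fix u w c assume V: "u \<in> Vh" "w \<in> Vh"
  show "a_eps \<T> \<Omega> k \<epsilon> \<eta> (\<lambda>x. c * u x) w = c * a_eps \<T> \<Omega> k \<epsilon> \<eta> u w"
    by (simp add: a_eps_alt H1_scale_left L2_scale_left bdry_form_scale_left V algebra_simps)
  have "H1_semi_inner \<Omega> w (\<lambda>x. c * u x) = cnj c * H1_semi_inner \<Omega> w u"
    "L2_inner \<Omega> w (\<lambda>x. c * u x) = cnj c * L2_inner \<Omega> w u"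
    "bdry_form w (\<lambda>x. c * u x) = cnj c * bdry_form w u"
    using H1_scale_left[OF V, of c] L2_scale_left[of c u w] bdry_form_scale_left[of c u w]
      H1_cnj[of w] L2_cnj[of w] bdry_form_cnj[of w] by simp_all
  then show "a_eps \<T> \<Omega> k \<epsilon> \<eta> w (\<lambda>x. c * u x) = cnj c * a_eps \<T> \<Omega> k \<epsilon> \<eta> w u"
    by (simp add: a_eps_alt algebra_simps)
qed (auto intro: P1_zero P1_add P1_scale)

lemma norm_1k_scale:
  assumes "u \<in> Vh"
  shows "norm_1k \<Omega> k (\<lambda>x. c * u x) = cmod c * norm_1k \<Omega> k u"
proof -
  have cc: "c * cnj c = of_real ((cmod c)\<^sup>2)" by (simp only: complex_norm_square)
  have "complex_of_real (grad_sq (\<lambda>x. c * u x)) = c * cnj c * of_real (grad_sq u)"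
    using H1_scale_left[OF assms P1_scale[OF assms], of c c] H1_cnj[of u "\<lambda>x. c * u x"]
      H1_scale_left[OF assms assms] by (simp add: H1_self)
  then have "grad_sq (\<lambda>x. c * u x) = (cmod c)\<^sup>2 * grad_sq u"
    unfolding cc of_real_mult[symmetric] of_real_eq_iff .
  moreover have "mass_sq (\<lambda>x. c * u x) = (cmod c)\<^sup>2 * mass_sq u"
    by (simp add: mass_sq_def norm_mult power_mult_distrib)
  ultimately have "(norm_1k \<Omega> k (\<lambda>x. c * u x))\<^sup>2 = (cmod c * norm_1k \<Omega> k u)\<^sup>2"
    by (simp add: norm_1k_sq power_mult_distrib algebra_simps)
  then show ?thesis by (rule power2_eq_imp_eq) (auto simp: norm_1k_nonneg)
qed

section \<open>Boundedness and coercivity uniformly in the wave number\<close>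

lemma cmod_H1_le:
  assumes "u \<in> Vh" "v \<in> Vh"
  shows "cmod (H1_semi_inner \<Omega> u v) \<le> (grad_sq u + grad_sq v) / 2"
proof -
  have "cmod (H1_semi_inner \<Omega> u v) \<le> (LINT x:\<Omega>|lebesgue. cmod (\<Sum>i\<in>UNIV. grad u x $ i * cnj (grad v x $ i)))"
    unfolding H1_semi_inner_def by (intro set_integral_norm_bound integrable_grad_inner assms)
  also have "\<dots> \<le> (LINT x:\<Omega>|lebesgue. ((\<Sum>i\<in>UNIV. (cmod (grad u x $ i))\<^sup>2) + (\<Sum>i\<in>UNIV. (cmod (grad v x $ i))\<^sup>2)) / 2)"
  proof (rule set_integral_mono)
    fix x
    have "cmod (\<Sum>i\<in>UNIV. grad u x $ i * cnj (grad v x $ i)) \<le> (\<Sum>i\<in>UNIV. ((cmod (grad u x $ i))\<^sup>2 + (cmod (grad v x $ i))\<^sup>2) / 2)"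
      by (intro sum_norm_le cmod_mult_cnj_le)
    then show "cmod (\<Sum>i\<in>UNIV. grad u x $ i * cnj (grad v x $ i))
        \<le> ((\<Sum>i\<in>UNIV. (cmod (grad u x $ i))\<^sup>2) + (\<Sum>i\<in>UNIV. (cmod (grad v x $ i))\<^sup>2)) / 2"
      by (simp add: sum.distrib flip: sum_divide_distrib)
  qed (use integrable_grad_inner integrable_grad_sq assms in \<open>auto intro: set_integrable_norm\<close>)
  also have "\<dots> = (grad_sq u + grad_sq v) / 2"
    using integrable_grad_sq assms by (simp add: grad_sq_def)
  finally show ?thesis .
qed

lemma cmod_L2_le:
  assumes "u \<in> Vh" "v \<in> Vh"
  shows "cmod (L2_inner \<Omega> u v) \<le> (mass_sq u + mass_sq v) / 2"
  unfolding L2_inner_def mass_sq_def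
  by (intro norm_set_integral_mult_cnj_le integrable_inner integrable_sq assms)

lemma cmod_bdry_form_le:
  assumes "u \<in> Vh" "v \<in> Vh"
  shows "cmod (bdry_form u v) \<le> (bdry_sq u + bdry_sq v) / 2"
proof -
  have "cmod (bdry_form u v) \<le> (\<Sum>F\<in>boundary_faces. ((LINT x:face_prism F|lebesgue. (cmod (u (face_proj F x)))\<^sup>2)
      + (LINT x:face_prism F|lebesgue. (cmod (v (face_proj F x)))\<^sup>2)) / 2)"
    unfolding bdry_form_eq
    by (intro sum_norm_le norm_set_integral_mult_cnj_le integrable_face_inner integrable_face_sq assms)
  then show ?thesis by (simp add: bdry_sq_def sum.distrib flip: sum_divide_distrib)
qed

text \<open>Each coefficient is matched with a power of \<open>k\<close>:
  \<open>|k\<^sup>2 + i \<epsilon>|\<close> is at most a multiple of \<open>k\<^sup>2\<close>, the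
  weight of the mass term, and \<open>|\<eta>|\<close> at most a multiple of \<open>k\<close>, which
  is the factor available in the trace hypothesis. The absolute values allow for constants of
  unknown sign.\<close>

lemma a_eps_bounded:
  assumes "u \<in> Vh" "v \<in> Vh" and \<epsilon>: "\<bar>\<epsilon>\<bar> \<le> Ce * k\<^sup>2" and \<eta>: "cmod \<eta> \<le> Ch * k" and k: "0 < k"
    and trace: "\<And>w. w \<in> Vh \<Longrightarrow> k * bdry_sq w \<le> Ct * (norm_1k \<Omega> k w)\<^sup>2"
  shows "cmod (a_eps \<T> \<Omega> k \<epsilon> \<eta> u v) \<le> (1 + \<bar>Ce\<bar> + \<bar>Ch\<bar> * \<bar>Ct\<bar>) * ((norm_1k \<Omega> k u)\<^sup>2 + (norm_1k \<Omega> k v)\<^sup>2)"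
proof -
  let ?N = "(norm_1k \<Omega> k u)\<^sup>2 + (norm_1k \<Omega> k v)\<^sup>2"
  have N: "0 \<le> ?N" by simp
  have "\<bar>\<epsilon>\<bar> \<le> \<bar>Ce\<bar> * k\<^sup>2" using \<epsilon> by (rule order_trans) (simp add: mult_right_mono)
  moreover have "cmod (complex_of_real (k\<^sup>2) + \<i> * complex_of_real \<epsilon>) \<le> k\<^sup>2 + \<bar>\<epsilon>\<bar>"
    using norm_triangle_ineq[of "complex_of_real (k\<^sup>2)" "\<i> * complex_of_real \<epsilon>"] by (simp add: norm_mult norm_power)
  ultimately have z: "cmod (complex_of_real (k\<^sup>2) + \<i> * complex_of_real \<epsilon>) \<le> (1 + \<bar>Ce\<bar>) * k\<^sup>2"
    by (simp add: algebra_simps)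
  have h: "cmod \<eta> \<le> \<bar>Ch\<bar> * k" using \<eta> by (rule order_trans) (use k in \<open>simp add: mult_right_mono\<close>)
  have t: "k * bdry_sq w \<le> \<bar>Ct\<bar> * (norm_1k \<Omega> k w)\<^sup>2" if "w \<in> Vh" for w
    using trace[OF that] by (rule order_trans) (simp add: mult_right_mono)
  have "cmod (a_eps \<T> \<Omega> k \<epsilon> \<eta> u v) \<le> cmod (H1_semi_inner \<Omega> u v)
     + cmod (complex_of_real (k\<^sup>2) + \<i> * complex_of_real \<epsilon>) * cmod (L2_inner \<Omega> u v) + cmod \<eta> * cmod (bdry_form u v)"
    unfolding a_eps_alt
    by (rule order_trans[OF norm_triangle_ineq4], rule add_mono[OF order_trans[OF norm_triangle_ineq4]])
      (simp_all add: norm_mult)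
  also have "\<dots> \<le> ((grad_sq u + grad_sq v) / 2 + (1 + \<bar>Ce\<bar>) * k\<^sup>2 * ((mass_sq u + mass_sq v) / 2))
       + \<bar>Ch\<bar> * k * ((bdry_sq u + bdry_sq v) / 2)"
    using assms(1,2) z h k
    by (intro add_mono mult_mono cmod_H1_le cmod_L2_le cmod_bdry_form_le) (auto simp: mass_sq_nonneg)
  also have "\<dots> \<le> (1 + \<bar>Ce\<bar>) * (?N / 2) + \<bar>Ch\<bar> * (\<bar>Ct\<bar> * ?N / 2)"
  proof (rule add_mono)
    have "0 \<le> \<bar>Ce\<bar> * (grad_sq u + grad_sq v)" by (simp add: grad_sq_nonneg)
    then show "(grad_sq u + grad_sq v) / 2 + (1 + \<bar>Ce\<bar>) * k\<^sup>2 * ((mass_sq u + mass_sq v) / 2) \<le> (1 + \<bar>Ce\<bar>) * (?N / 2)"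
      by (simp add: norm_1k_sq field_simps)
    have "k * (bdry_sq u + bdry_sq v) \<le> \<bar>Ct\<bar> * ?N"
      using t[OF assms(1)] t[OF assms(2)] by (simp add: algebra_simps)
    from mult_left_mono[OF this, of "\<bar>Ch\<bar> / 2"]
    show "\<bar>Ch\<bar> * k * ((bdry_sq u + bdry_sq v) / 2) \<le> \<bar>Ch\<bar> * (\<bar>Ct\<bar> * ?N / 2)"
      by (simp add: mult_ac)
  qed
  also have "\<dots> = (1 + \<bar>Ce\<bar> + \<bar>Ch\<bar> * \<bar>Ct\<bar>) * ?N / 2" by (simp add: field_simps)
  also have "\<dots> \<le> (1 + \<bar>Ce\<bar> + \<bar>Ch\<bar> * \<bar>Ct\<bar>) * ?N"
    using mult_nonneg_nonneg[OF _ N, of "1 + \<bar>Ce\<bar> + \<bar>Ch\<bar> * \<bar>Ct\<bar>"] by simp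
  finally show ?thesis .
qed

text \<open>In \<open>- cnj z * a(v, v)\<close> the gradient term has imaginary part
  \<open>Im z * grad_sq v\<close>, the mass term \<open>Im z * |z|\<^sup>2 * mass_sq v\<close>, and
  the boundary term \<open>Re (cnj z * \<eta>) * bdry_sq v\<close>, nonnegative by the sign
  condition. Dividing by \<open>|z|\<close> normalises the weight, and
  \<open>k\<^sup>2 \<le> |z|\<^sup>2\<close> recovers the energy norm.\<close>

lemma a_eps_coercive:
  assumes k: "0 < k" and \<epsilon>0: "\<epsilon> \<noteq> 0" and \<epsilon>: "\<bar>\<epsilon>\<bar> \<le> Ce * k\<^sup>2"
    and \<eta>: "0 \<le> Re (cnj (z_of k \<epsilon>) * \<eta>)"
  shows "\<bar>\<epsilon>\<bar> / (2 * (1 + Ce) * k\<^sup>2) * (norm_1k \<Omega> k v)\<^sup>2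
    \<le> Im (- cnj (z_of k \<epsilon>) / of_real (cmod (z_of k \<epsilon>)) * a_eps \<T> \<Omega> k \<epsilon> \<eta> v v)"
proof -
  define z where "z = z_of k \<epsilon>"
  have z2: "z\<^sup>2 = complex_of_real (k\<^sup>2) + \<i> * complex_of_real \<epsilon>"
    using \<epsilon>0 by (simp add: z_def z_of_def power_mult_distrib sgn_if)
  have Re2: "(Re z)\<^sup>2 - (Im z)\<^sup>2 = k\<^sup>2" and Im2: "2 * Re z * Im z = \<epsilon>"
    using arg_cong[OF z2, of Re] arg_cong[OF z2, of Im] by (simp_all add: power2_eq_square mult_ac)
  \<comment> \<open>\<open>csqrt\<close> has nonnegative real part, so \<open>Re z\<close> carries
    the sign of \<open>\<epsilon>\<close>. Since \<open>2 * Re z * Im z = \<epsilon>\<close>,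
    \<open>Im z\<close> is positive for either sign.\<close>
  have "0 \<le> sgn \<epsilon> * Re z"
    using \<epsilon>0 Re_csqrt by (simp add: z_def z_of_def sgn_if)
  with Im2 \<epsilon>0 have Imz: "0 < Im z"
    by (cases "\<epsilon> > 0") (auto simp: sgn_if mult_less_0_iff zero_less_mult_iff split: if_splits)
  have norm_z2: "(cmod z)\<^sup>2 = cmod (complex_of_real (k\<^sup>2) + \<i> * complex_of_real \<epsilon>)"
    unfolding z2[symmetric] by (simp add: norm_power)
  have zk: "k\<^sup>2 \<le> (cmod z)\<^sup>2" unfolding cmod_power2 using Re2 zero_le_power2[of "Im z"] by linarith
  have "(cmod z)\<^sup>2 \<le> k\<^sup>2 + \<bar>\<epsilon>\<bar>" unfolding norm_z2
    using norm_triangle_ineq[of "complex_of_real (k\<^sup>2)" "\<i> * complex_of_real \<epsilon>"] by (simp add: norm_mult norm_power)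
  with \<epsilon> have zC: "(cmod z)\<^sup>2 \<le> (1 + Ce) * k\<^sup>2" by (simp add: algebra_simps)
  have z0: "0 < cmod z" using Imz by auto
  \<comment> \<open>The source of the rate: \<open>Im z / |z|\<close> is at least
    \<open>|\<epsilon>| / (2 |z|\<^sup>2)\<close>, and \<open>|z|\<^sup>2\<close> is comparable to
    \<open>k\<^sup>2\<close>.\<close>
  have "\<bar>\<epsilon>\<bar> = 2 * \<bar>Re z\<bar> * Im z" using Imz by (simp flip: Im2 add: abs_mult)
  also have "\<dots> \<le> 2 * cmod z * Im z" using Imz abs_Re_le_cmod by (intro mult_right_mono) auto
  finally have e: "\<bar>\<epsilon>\<bar> \<le> 2 * cmod z * Im z" .
  define X where "X = (1 + Ce) * k\<^sup>2"
  have "0 < X" unfolding X_def using z0 by (intro order_less_le_trans[OF _ zC]) simp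
  then have "\<bar>\<epsilon>\<bar> / (2 * X) \<le> \<bar>\<epsilon>\<bar> / (2 * (cmod z)\<^sup>2)"
    using zC[folded X_def] z0 by (intro divide_left_mono) auto
  then have "\<bar>\<epsilon>\<bar> / (2 * (1 + Ce) * k\<^sup>2) \<le> \<bar>\<epsilon>\<bar> / (2 * (cmod z)\<^sup>2)"
    by (simp only: X_def mult.assoc)
  also have "\<dots> \<le> Im z / cmod z"
    using e z0 by (simp add: field_simps power2_eq_square)
  finally have \<alpha>: "\<bar>\<epsilon>\<bar> / (2 * (1 + Ce) * k\<^sup>2) \<le> Im z / cmod z" .
  have "(norm_1k \<Omega> k v)\<^sup>2 \<le> grad_sq v + (cmod z)\<^sup>2 * mass_sq v"
    unfolding norm_1k_sq using zk mass_sq_nonneg by (intro add_mono mult_right_mono) auto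
  then have "\<bar>\<epsilon>\<bar> / (2 * (1 + Ce) * k\<^sup>2) * (norm_1k \<Omega> k v)\<^sup>2 \<le> Im z / cmod z * (grad_sq v + (cmod z)\<^sup>2 * mass_sq v)"
    using Imz \<alpha> by (intro mult_mono) auto
  also have "\<dots> \<le> (Im z * (grad_sq v + (cmod z)\<^sup>2 * mass_sq v) + Re (cnj z * \<eta>) * bdry_sq v) / cmod z"
    using z0 \<eta> bdry_sq_nonneg by (simp add: z_def divide_right_mono mult_nonneg_nonneg)
  also have "\<dots> = Im (- cnj z * a_eps \<T> \<Omega> k \<epsilon> \<eta> v v) / cmod z"
  proof -
    have "- cnj z * a_eps \<T> \<Omega> k \<epsilon> \<eta> v v
      = - cnj z * of_real (grad_sq v) + (z * cnj z) * z * of_real (mass_sq v) + \<i> * (cnj z * \<eta>) * of_real (bdry_sq v)"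
      unfolding a_eps_alt H1_self L2_self bdry_form_self z2[symmetric] by (simp add: power2_eq_square algebra_simps)
    also have "z * cnj z = of_real ((cmod z)\<^sup>2)" by (simp only: complex_norm_square)
    finally have eq: "- cnj z * a_eps \<T> \<Omega> k \<epsilon> \<eta> v v = - cnj z * of_real (grad_sq v)
      + of_real ((cmod z)\<^sup>2) * z * of_real (mass_sq v) + \<i> * (cnj z * \<eta>) * of_real (bdry_sq v)" .
    show ?thesis unfolding eq by (simp add: algebra_simps)
  qed
  also have "\<dots> = Im (- cnj z / of_real (cmod z) * a_eps \<T> \<Omega> k \<epsilon> \<eta> v v)"
    by (simp add: diff_divide_distrib)
  finally show ?thesis by (simp add: z_def)
qed

text \<open>The mass term alone decides: the part of \<open>\<Omega>\<close> where \<open>v\<close>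
  is nonzero is both open and null, hence empty. Continuity then reaches the closure, and extension
  by zero covers the rest of the space.\<close>

lemma norm_1k_eq_0:
  assumes v: "v \<in> Vh" and "norm_1k \<Omega> k v = 0" "0 < k"
  shows "v = (\<lambda>x. 0)"
proof -
  have "mass_sq v = 0"
    using norm_1k_sq[of k v] assms grad_sq_nonneg[of v] mass_sq_nonneg[of v]
    by (simp add: add_nonneg_eq_0_iff)
  then have "AE x in lebesgue. indicator \<Omega> x *\<^sub>R (cmod (v x))\<^sup>2 = 0"
    using integrable_sq[OF v] unfolding mass_sq_def set_lebesgue_integral_def set_integrable_def
    by (subst (asm) integral_nonneg_eq_0_iff_AE) auto
  then obtain N where "N \<in> null_sets lebesgue" and N: "{x. indicator \<Omega> x *\<^sub>R (cmod (v x))\<^sup>2 \<noteq> 0} \<subseteq> N"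
    unfolding eventually_ae_filter by auto
  then have "negligible N" by (simp add: negligible_iff_null_sets)
  then have "negligible {x\<in>\<Omega>. v x \<noteq> 0}"
    by (rule negligible_subset) (use N in \<open>auto simp: indicator_def\<close>)
  moreover have "open {x\<in>\<Omega>. v x \<noteq> 0}"
  proof -
    have "continuous_on \<Omega> v" using P1_continuous[OF v] closure_subset continuous_on_subset by blast
    then have "open (\<Omega> \<inter> v -` (- {0}))"
      using open_domain continuous_open_preimage by blast
    moreover have "\<Omega> \<inter> v -` (- {0}) = {x\<in>\<Omega>. v x \<noteq> 0}" by auto
    ultimately show ?thesis by simp
  qed
  ultimately have "{x\<in>\<Omega>. v x \<noteq> 0} = {}" using open_not_negligible by blast
  then have z: "\<And>x. x \<in> \<Omega> \<Longrightarrow> v x = 0" by blast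
  have "v x = 0" if "x \<in> closure \<Omega>" for x
    using continuous_constant_on_closure[OF P1_continuous[OF v] z that] .
  then show ?thesis using P1_outside[OF v] by blast
qed

end

section \<open>Oblique prisms and boundary charts\<close>

lemma nn_integral_lborel_translate:
  fixes c :: "'a::euclidean_space"
  assumes [measurable]: "f \<in> borel_measurable borel"
  shows "(\<integral>\<^sup>+x. f (c + x) \<partial>lborel) = (\<integral>\<^sup>+x. f x \<partial>lborel)"
proof -
  have "(\<integral>\<^sup>+x. f x \<partial>lborel) = (\<integral>\<^sup>+x. f x \<partial>distr lborel borel ((+) c))"
    by (simp add: lborel_distr_plus)
  also have "\<dots> = (\<integral>\<^sup>+x. f (c + x) \<partial>lborel)" by (rule nn_integral_distr) auto
  finally show ?thesis ..
qed

text \<open>The prism over a flat piece in the normal direction is compared with the one in a transversal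
  direction \<open>e\<close> by two shears and one affine substitution on the real line, so no determinant is needed.\<close>

lemma nn_integral_oblique_prism:
  fixes \<nu> e p :: "'a::euclidean_space" and \<psi> :: "'a \<Rightarrow> ennreal"
  assumes A[measurable]: "A \<in> sets borel" and J[measurable]: "J \<in> sets borel"
    and \<psi>[measurable]: "\<psi> \<in> borel_measurable borel"
    and \<nu>: "\<nu> \<bullet> \<nu> = 1" and \<kappa>: "\<nu> \<bullet> e \<noteq> 0"
  shows "(\<integral>\<^sup>+t. (\<integral>\<^sup>+x. indicator J t * indicator A (x - (\<nu> \<bullet> (x - p)) *\<^sub>R \<nu>) * indicator {0..1} (\<nu> \<bullet> (x - p))
            * \<psi> (x - (\<nu> \<bullet> (x - p)) *\<^sub>R \<nu> + t *\<^sub>R e) \<partial>lborel) \<partial>lborel)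
    = ennreal (1 / \<bar>\<nu> \<bullet> e\<bar>) * (\<integral>\<^sup>+x. indicator A (x - (\<nu> \<bullet> (x - p) / (\<nu> \<bullet> e)) *\<^sub>R e)
            * indicator J (\<nu> \<bullet> (x - p) / (\<nu> \<bullet> e)) * \<psi> x \<partial>lborel)"
    (is "?L = _ * ?R")
proof -
  define \<kappa> where "\<kappa> = \<nu> \<bullet> e"
  define l where "l x = \<nu> \<bullet> (x - p)" for x
  have [measurable]: "l \<in> borel_measurable borel" unfolding l_def by measurable
  have k0: "\<kappa> \<noteq> 0" using \<kappa> by (simp add: \<kappa>_def)
  have l_e: "l (- (t *\<^sub>R e) + x) = l x - \<kappa> * t" for t x
    by (simp add: l_def \<kappa>_def algebra_simps)
  have l_\<nu>: "l (s *\<^sub>R \<nu> + x) = l x + s" for s x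
    using \<nu> by (simp add: l_def algebra_simps)
  \<comment> \<open>\<open>H\<close> is the integrand after translating \<open>x\<close> by
    \<open>t *\<^sub>R e\<close>. \<open>K\<close> is what it becomes when \<open>t\<close> is
    replaced by the normal height \<open>s = l x - \<kappa> * t\<close>, a substitution that yields
    the factor \<open>1 / \<bar>\<kappa>\<bar>\<close>.\<close>
  define H where "H t x = indicator J t * indicator A (x - t *\<^sub>R e - (l x - \<kappa> * t) *\<^sub>R \<nu>)
      * indicator {0..1} (l x - \<kappa> * t) * \<psi> (x - (l x - \<kappa> * t) *\<^sub>R \<nu>)" for t x
  define K where "K s x = indicator J ((l x - s) / \<kappa>) * indicator A (x - ((l x - s) / \<kappa>) *\<^sub>R e - s *\<^sub>R \<nu>)
      * indicator {0..1} s * \<psi> (x - s *\<^sub>R \<nu>)" for s x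
  have H[measurable]: "(\<lambda>(t, x). H t x) \<in> borel_measurable (lborel \<Otimes>\<^sub>M lborel)"
    unfolding H_def by measurable
  have K[measurable]: "(\<lambda>(s, x). K s x) \<in> borel_measurable (lborel \<Otimes>\<^sub>M lborel)"
    unfolding K_def by measurable
  have "?L = (\<integral>\<^sup>+t. (\<integral>\<^sup>+x. H t x \<partial>lborel) \<partial>lborel)"
  proof (rule nn_integral_cong)
    fix t
    let ?g = "\<lambda>x. indicator J t * indicator A (x - l x *\<^sub>R \<nu>) * indicator {0..1} (l x) * \<psi> (x - l x *\<^sub>R \<nu> + t *\<^sub>R e)"
    have "(\<integral>\<^sup>+x. ?g (- (t *\<^sub>R e) + x) \<partial>lborel) = (\<integral>\<^sup>+x. ?g x \<partial>lborel)"
      by (rule nn_integral_lborel_translate) measurable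
    moreover have "?g (- (t *\<^sub>R e) + x) = H t x" for x
      unfolding l_e H_def by (simp add: algebra_simps)
    ultimately show "(\<integral>\<^sup>+x. indicator J t * indicator A (x - (\<nu> \<bullet> (x - p)) *\<^sub>R \<nu>) * indicator {0..1} (\<nu> \<bullet> (x - p))
            * \<psi> (x - (\<nu> \<bullet> (x - p)) *\<^sub>R \<nu> + t *\<^sub>R e) \<partial>lborel) = (\<integral>\<^sup>+x. H t x \<partial>lborel)"
      by (simp add: l_def)
  qed
  also have "\<dots> = (\<integral>\<^sup>+x. (\<integral>\<^sup>+t. H t x \<partial>lborel) \<partial>lborel)"
    by (rule lborel_pair.Fubini'[OF H, symmetric])
  also have "\<dots> = (\<integral>\<^sup>+x. ennreal (1 / \<bar>\<kappa>\<bar>) * (\<integral>\<^sup>+s. K s x \<partial>lborel) \<partial>lborel)"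
  proof (rule nn_integral_cong)
    fix x
    have [measurable]: "(\<lambda>t. H t x) \<in> borel_measurable borel" unfolding H_def by measurable
    have "(\<integral>\<^sup>+t. H t x \<partial>lborel) = \<bar>- 1 / \<kappa>\<bar> * (\<integral>\<^sup>+s. H (l x / \<kappa> + (- 1 / \<kappa>) * s) x \<partial>lborel)"
      by (rule nn_integral_real_affine) (use k0 in auto)
    moreover have "H (l x / \<kappa> + (- 1 / \<kappa>) * s) x = K s x" for s
    proof -
      have *: "l x / \<kappa> + (- 1 / \<kappa>) * s = (l x - s) / \<kappa>" by (simp add: diff_divide_distrib)
      have **: "l x - \<kappa> * ((l x - s) / \<kappa>) = s" using k0 by simp
      show ?thesis unfolding H_def K_def * ** ..
    qed
    ultimately show "(\<integral>\<^sup>+t. H t x \<partial>lborel) = ennreal (1 / \<bar>\<kappa>\<bar>) * (\<integral>\<^sup>+s. K s x \<partial>lborel)"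
      by simp
  qed
  also have "\<dots> = ennreal (1 / \<bar>\<kappa>\<bar>) * (\<integral>\<^sup>+x. (\<integral>\<^sup>+s. K s x \<partial>lborel) \<partial>lborel)"
    using K by (intro nn_integral_cmult lborel.borel_measurable_nn_integral) measurable
  also have "(\<integral>\<^sup>+x. (\<integral>\<^sup>+s. K s x \<partial>lborel) \<partial>lborel) = (\<integral>\<^sup>+s. (\<integral>\<^sup>+x. K s x \<partial>lborel) \<partial>lborel)"
    by (rule lborel_pair.Fubini'[OF K])
  \<comment> \<open>Translating by \<open>s *\<^sub>R \<nu>\<close> removes \<open>s\<close> from
    everything but \<open>indicator {0..1} s\<close>, so the unit height of the normal prism
    integrates to 1.\<close>
  also have "\<dots> = (\<integral>\<^sup>+s. indicator {0..1} (s::real) * ?R \<partial>lborel)"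
  proof (rule nn_integral_cong)
    fix s
    have "(\<integral>\<^sup>+x. K s x \<partial>lborel) = (\<integral>\<^sup>+x. K s (s *\<^sub>R \<nu> + x) \<partial>lborel)"
      by (rule nn_integral_lborel_translate[symmetric]) (unfold K_def, measurable)
    also have "\<dots> = (\<integral>\<^sup>+x. indicator {0..1} s * (indicator A (x - (l x / \<kappa>) *\<^sub>R e) * indicator J (l x / \<kappa>) * \<psi> x) \<partial>lborel)"
      unfolding K_def l_\<nu> by (intro nn_integral_cong) (simp add: algebra_simps)
    also have "\<dots> = indicator {0..1} s * ?R"
      unfolding \<kappa>_def[symmetric] l_def[symmetric] by (rule nn_integral_cmult) measurable
    finally show "(\<integral>\<^sup>+x. K s x \<partial>lborel) = indicator {0..1} s * ?R" .
  qed
  also have "\<dots> = ?R" by (simp add: nn_integral_multc)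
  finally show ?thesis by (simp add: \<kappa>_def)
qed

text \<open>A flat piece of a graph with Lipschitz constant \<open>L\<close> is nowhere close to
  parallel to \<open>e\<close>. Testing the slope bound in the steepest direction of the hyperplane
  gives \<open>1 - (\<nu> \<bullet> e)\<^sup>2 \<le> L\<^sup>2 (\<nu> \<bullet> e)\<^sup>2\<close>.
  This will bound the Jacobian of the oblique prism independently of the face.\<close>

lemma hyperplane_transversal:
  fixes F :: "'a::euclidean_space set"
  assumes F: "convex F" "aff_dim F = int DIM('a) - 1"
    and \<nu>: "norm \<nu> = 1" "\<And>x y. x \<in> F \<Longrightarrow> y \<in> F \<Longrightarrow> \<nu> \<bullet> (x - y) = 0" and e: "norm e = 1"
    and U: "open U" "F \<inter> U \<noteq> {}" and L: "0 \<le> L"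
    and graph: "\<And>x y. x \<in> F \<inter> U \<Longrightarrow> y \<in> F \<inter> U \<Longrightarrow>
        \<bar>(x - y) \<bullet> e\<bar> \<le> L * norm ((x - y) - ((x - y) \<bullet> e) *\<^sub>R e)"
  shows "1 \<le> (1 + L\<^sup>2) * (\<nu> \<bullet> e)\<^sup>2"
proof -
  define \<kappa> where "\<kappa> = \<nu> \<bullet> e"
  \<comment> \<open>\<open>F\<close> need only touch \<open>U\<close>; a relative interior point
    inside \<open>U\<close> is needed so that a short step within the hyperplane stays in
    both.\<close>
  have "U \<inter> closure (rel_interior F) \<noteq> {}"
    unfolding convex_closure_rel_interior[OF F(1)] using U(2) closure_subset[of F] by blast
  then have "U \<inter> rel_interior F \<noteq> {}" by (simp only: open_Int_closure_eq_empty[OF U(1)] not_False_eq_True)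
  then obtain c where c: "c \<in> rel_interior F" "c \<in> U" by blast
  have cF: "c \<in> F" using c rel_interior_subset by blast
  from c(1) obtain d1 where d1: "d1 > 0" "ball c d1 \<inter> affine hull F \<subseteq> F"
    unfolding mem_rel_interior_ball by (elim conjE exE)
  from U(1) c(2) have "\<exists>d>0. ball c d \<subseteq> U" unfolding open_contains_ball by (rule bspec)
  then obtain d2 where d2: "d2 > 0" "ball c d2 \<subseteq> U" by (elim conjE exE)
  have "F \<subseteq> {x. \<nu> \<bullet> x = \<nu> \<bullet> c}"
    using \<nu>(2)[OF _ cF] by (auto simp: inner_diff_right)
  then have sub: "affine hull F \<subseteq> {x. \<nu> \<bullet> x = \<nu> \<bullet> c}"
    by (rule hull_minimal[where S = affine, OF _ affine_hyperplane])
  have "\<nu> \<noteq> 0" using \<nu>(1) by auto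
  then have "aff_dim (affine hull F) = aff_dim {x. \<nu> \<bullet> x = \<nu> \<bullet> c}"
    using F(2) by (simp add: aff_dim_hyperplane)
  moreover have "affine hull F \<noteq> {}" using cF by auto
  ultimately have hull: "affine hull F = {x. \<nu> \<bullet> x = \<nu> \<bullet> c}"
    using sub by (intro affine_dim_equal affine_affine_hull affine_hyperplane) auto
  have \<nu>\<nu>: "\<nu> \<bullet> \<nu> = 1" and ee: "e \<bullet> e = 1"
    using \<nu>(1) e unfolding power2_norm_eq_inner[symmetric] by auto
  \<comment> \<open>The projection of \<open>e\<close> onto the hyperplane, the direction of
    steepest ascent in it; \<open>m\<close> is its squared length and also its component along
    \<open>e\<close>.\<close>
  define q where "q = e - \<kappa> *\<^sub>R \<nu>"
  define m where "m = 1 - \<kappa>\<^sup>2"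
  have qe: "q \<bullet> e = m" using ee by (simp add: q_def m_def \<kappa>_def inner_diff_left power2_eq_square)
  have q\<nu>: "\<nu> \<bullet> q = 0" using \<nu>\<nu> by (simp add: q_def \<kappa>_def inner_diff_right)
  have qq: "q \<bullet> q = m" using q\<nu> qe by (simp add: q_def inner_diff_right inner_commute)
  have m0: "0 \<le> m" using qq inner_ge_zero[of q] by simp
  show ?thesis
  proof (cases "q = 0")
    case True
    then have "\<kappa>\<^sup>2 = 1" using qq by (simp add: m_def)
    then show ?thesis by (simp add: \<kappa>_def[symmetric])
  next
    case False
    then have m: "0 < m" using qq m0 by (metis inner_eq_zero_iff order_le_less)
    define s where "s = min d1 d2 / (2 * norm q)"
    have s: "s > 0" "s * norm q < d1" "s * norm q < d2"
      using d1 d2 False by (auto simp: s_def)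
    let ?x = "c + s *\<^sub>R q"
    have "?x \<in> ball c d1" "?x \<in> ball c d2" using s by (auto simp: dist_norm)
    moreover have "?x \<in> affine hull F" unfolding hull using q\<nu> by (simp add: inner_add_right)
    ultimately have "?x \<in> F \<inter> U" "c \<in> F \<inter> U" using d1 d2 cF c by auto
    from graph[OF this] have "\<bar>s * m\<bar> \<le> L * norm (s *\<^sub>R q - (s * m) *\<^sub>R e)"
      by (simp add: qe)
    also have "s *\<^sub>R q - (s * m) *\<^sub>R e = s *\<^sub>R (q - m *\<^sub>R e)" by (simp add: algebra_simps)
    finally have "m \<le> L * norm (q - m *\<^sub>R e)" using s(1) m by (simp add: abs_mult)
    then have "m\<^sup>2 \<le> (L * norm (q - m *\<^sub>R e))\<^sup>2" using m by (intro power_mono) auto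
    also have "(norm (q - m *\<^sub>R e))\<^sup>2 = q \<bullet> q - 2 * m * (q \<bullet> e) + m * m * (e \<bullet> e)"
      unfolding power2_norm_eq_inner by (simp add: inner_diff_left inner_diff_right inner_commute)
    then have "(norm (q - m *\<^sub>R e))\<^sup>2 = m * \<kappa>\<^sup>2"
      unfolding qq qe ee by (simp add: m_def power2_eq_square algebra_simps)
    then have "(L * norm (q - m *\<^sub>R e))\<^sup>2 = m * (L\<^sup>2 * \<kappa>\<^sup>2)" by (simp add: power_mult_distrib)
    finally have "m \<le> L\<^sup>2 * \<kappa>\<^sup>2" using m by (simp add: power2_eq_square)
    then show ?thesis by (simp add: m_def \<kappa>_def algebra_simps)
  qed
qed

text \<open>Coordinate-free version of the local graph condition in \<open>lipschitz_domain\<close>: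
  the rotation is absorbed by taking \<open>e\<close> as the preimage of the axis and
  \<open>\<Phi>\<close> as the graph function composed with the rotation, so that
  \<open>\<Phi>\<close> is constant along \<open>e\<close>.\<close>

definition boundary_chart ::
    "'a::euclidean_space set \<Rightarrow> 'a set \<Rightarrow> 'a \<Rightarrow> ('a \<Rightarrow> real) \<Rightarrow> real \<Rightarrow> bool" where
  "boundary_chart D U e \<Phi> L \<longleftrightarrow> open U \<and> norm e = 1 \<and> 0 \<le> L \<and>
     (\<forall>y z. \<bar>\<Phi> y - \<Phi> z\<bar> \<le> L * norm (y - z)) \<and> (\<forall>y t. \<Phi> (y + t *\<^sub>R e) = \<Phi> y) \<and>
     D \<inter> U = {y\<in>U. \<Phi> y < y \<bullet> e}"

lemma lipschitz_domain_chart: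
  fixes D :: "(real^'n) set"
  assumes "lipschitz_domain D" "x \<in> frontier D"
  obtains U e \<Phi> L where "boundary_chart D U e \<Phi> L" "x \<in> U"
proof -
  have "\<exists>U R (e::'n) (f::real^'n \<Rightarrow> real) L.
        open U \<and> x \<in> U \<and> orthogonal_transformation R \<and>
        (\<forall>y z. \<bar>f y - f z\<bar> \<le> L * norm (y - z)) \<and>
        (\<forall>y t. f (y + t *\<^sub>R axis e 1) = f y) \<and>
        D \<inter> U = {y\<in>U. f (R y) < (R y) $ e}"
    using assms unfolding lipschitz_domain_def by (elim conjE) (rule bspec)
  then obtain U and R :: "real^'n \<Rightarrow> real^'n" and i :: 'n and f :: "real^'n \<Rightarrow> real" and L
    where U: "open U" "x \<in> U" and R: "orthogonal_transformation R"
    and f: "\<forall>y z. \<bar>f y - f z\<bar> \<le> L * norm (y - z)" "\<forall>y t. f (y + t *\<^sub>R axis i 1) = f y"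
    and D: "D \<inter> U = {y\<in>U. f (R y) < (R y) $ i}"
    by (elim exE conjE) (rule that)
  have lin: "linear R" using R by (rule orthogonal_transformation_linear)
  have "\<exists>e. axis i 1 = R e"
    using orthogonal_transformation_surj[OF R] by (rule surjD)
  then obtain e where "axis i 1 = R e" by blast
  then have e: "R e = axis i 1" by (rule sym)
  have Re: "y \<bullet> e = (R y) $ i" for y
  proof -
    have "y \<bullet> e = R y \<bullet> R e" using R unfolding orthogonal_transformation_def by simp
    then show ?thesis unfolding e by (simp only: cart_eq_inner_axis)
  qed
  have "norm e = 1"
    using e orthogonal_transformation_norm[OF R, of e] by simp
  moreover have "\<bar>f (R y) - f (R z)\<bar> \<le> \<bar>L\<bar> * norm (y - z)" for y z
  proof -
    have "\<bar>f (R y) - f (R z)\<bar> \<le> L * norm (R (y - z))" unfolding linear_diff[OF lin] using f(1) by blast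
    also have "\<dots> \<le> \<bar>L\<bar> * norm (R (y - z))" by (simp add: mult_right_mono)
    finally show ?thesis by (simp add: orthogonal_transformation_norm[OF R])
  qed
  moreover have "f (R (y + t *\<^sub>R e)) = f (R y)" for y t
    by (simp add: linear_add[OF lin] linear_scale[OF lin] e f(2))
  ultimately have "boundary_chart D U e (f \<circ> R) \<bar>L\<bar>"
    using U(1) unfolding boundary_chart_def comp_def Re D by simp
  then show ?thesis using U(2) by (rule that)
qed

lemma chart_mem_iff:
  assumes "boundary_chart D U e \<Phi> L" "y \<in> U"
  shows "y \<in> D \<longleftrightarrow> \<Phi> y < y \<bullet> e"
proof -
  have "D \<inter> U = {y\<in>U. \<Phi> y < y \<bullet> e}" using assms(1) by (simp add: boundary_chart_def)
  then have "y \<in> D \<inter> U \<longleftrightarrow> y \<in> {y\<in>U. \<Phi> y < y \<bullet> e}" by (rule arg_cong)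
  then show ?thesis using assms(2) by simp
qed

text \<open>If \<open>\<Phi>\<close> exceeded the height at \<open>x\<close>, it would do so on a
  neighbourhood, which then could not meet \<open>D\<close>; if the height exceeded
  \<open>\<Phi>\<close>, then \<open>x\<close> would belong to \<open>D\<close>, which is open and
  so disjoint from its frontier.\<close>

lemma chart_frontier:
  assumes chart: "boundary_chart D U e \<Phi> L" and D: "open D" and x: "x \<in> frontier D" "x \<in> U"
  shows "\<Phi> x = x \<bullet> e"
proof (rule antisym)
  have xD: "x \<in> closure D" "x \<notin> D" using x D by (auto simp: frontier_def interior_open)
  have cont: "continuous_on UNIV \<Phi>"
  proof (rule continuous_onI)
    fix y :: 'a and \<epsilon> :: real assume "\<epsilon> > 0"
    have L: "0 \<le> L" "\<And>y z. \<bar>\<Phi> y - \<Phi> z\<bar> \<le> L * norm (y - z)" using chart by (auto simp: boundary_chart_def)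
    show "\<exists>d>0. \<forall>z\<in>UNIV. dist z y < d \<longrightarrow> dist (\<Phi> z) (\<Phi> y) \<le> \<epsilon>"
    proof (intro exI[of _ "\<epsilon> / (L + 1)"] conjI ballI impI)
      show "0 < \<epsilon> / (L + 1)" using \<open>\<epsilon> > 0\<close> L by simp
      fix z assume "dist z y < \<epsilon> / (L + 1)"
      then have "(L + 1) * norm (z - y) \<le> \<epsilon>" using L by (simp add: dist_norm field_simps)
      moreover have "L * norm (z - y) \<le> (L + 1) * norm (z - y)" by (simp add: mult_right_mono)
      ultimately show "dist (\<Phi> z) (\<Phi> y) \<le> \<epsilon>" using L(2)[of z y] by (simp add: dist_real_def)
    qed
  qed
  show "\<Phi> x \<le> x \<bullet> e"
  proof (rule ccontr)
    assume neg: "\<not> \<Phi> x \<le> x \<bullet> e"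
    let ?W = "U \<inter> {y. y \<bullet> e < \<Phi> y}"
    have "open ?W" using chart cont
      by (intro open_Int open_Collect_less continuous_intros) (auto simp: boundary_chart_def)
    moreover have "x \<in> ?W" using neg x by simp
    ultimately have "?W \<inter> D \<noteq> {}" using xD(1) open_Int_closure_eq_empty[of ?W D] by blast
    then show False using chart_mem_iff[OF chart] by fastforce
  qed
  show "x \<bullet> e \<le> \<Phi> x" using xD(2) x(2) chart_mem_iff[OF chart] by (simp add: not_less)
qed

text \<open>Sliding \<open>x\<close> along \<open>e\<close> to the height of \<open>y\<close> does
  not change \<open>\<Phi>\<close> and leaves only the transversal part of \<open>x - y\<close> in
  the Lipschitz bound.\<close>

lemma chart_graph:
  assumes chart: "boundary_chart D U e \<Phi> L" and "\<Phi> x = x \<bullet> e" "\<Phi> y = y \<bullet> e"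
  shows "\<bar>(x - y) \<bullet> e\<bar> \<le> L * norm ((x - y) - ((x - y) \<bullet> e) *\<^sub>R e)"
proof -
  have "\<Phi> (x + - ((x - y) \<bullet> e) *\<^sub>R e) = \<Phi> x" using chart unfolding boundary_chart_def by blast
  then have "\<bar>(x - y) \<bullet> e\<bar> = \<bar>\<Phi> (x + - ((x - y) \<bullet> e) *\<^sub>R e) - \<Phi> y\<bar>"
    using assms(2,3) by (simp add: inner_diff_left)
  also have "\<dots> \<le> L * norm (x + - ((x - y) \<bullet> e) *\<^sub>R e - y)" using chart unfolding boundary_chart_def by blast
  finally show ?thesis by (simp add: algebra_simps)
qed

text \<open>Sweeping in one direction raises the affine dimension by at most one, so a set of
  codimension two stays within a hyperplane. Applied to intersections of distinct faces, it makes
  the overlap of their oblique prisms null.\<close>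

lemma negligible_sweep:
  fixes S :: "'a::euclidean_space set"
  assumes "aff_dim S \<le> int DIM('a) - 2"
  shows "negligible {y + t *\<^sub>R e | y t. y \<in> S}"
proof (cases "S = {}")
  case False
  then obtain p where p: "p \<in> S" by blast
  let ?H = "affine hull (insert (p + e) S)"
  have "{y + t *\<^sub>R e | y t. y \<in> S} \<subseteq> ?H"
  proof clarify
    fix y t assume y: "y \<in> S"
    have "y + t *\<^sub>R ((p + e) - p) \<in> ?H"
      using y p by (intro mem_affine_3_minus affine_affine_hull hull_inc) auto
    then show "y + t *\<^sub>R e \<in> ?H" by simp
  qed
  moreover have "negligible ?H"
  proof -
    have "aff_dim ?H \<le> int DIM('a) - 1" using assms by (simp add: aff_dim_insert)
    then have "aff_dim ?H < int DIM('a)" by simp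
    then obtain a b where "a \<noteq> 0" "?H \<subseteq> {x. a \<bullet> x = b}"
      using aff_lowdim_subset_hyperplane[of ?H] by blast
    then show ?thesis using negligible_hyperplane negligible_subset by blast
  qed
  ultimately show ?thesis by (rule negligible_subset[rotated])
qed simp

section \<open>The trace inequality\<close>

lemma cmod_sq_derivative:
  assumes "(g has_vector_derivative b) (at s)"
  shows "((\<lambda>s. (cmod (g s))\<^sup>2) has_real_derivative 2 * Re (cnj (g s) * b)) (at s)"
proof -
  have "((\<lambda>s. Re (g s)) has_real_derivative Re b) (at s)" "((\<lambda>s. Im (g s)) has_real_derivative Im b) (at s)"
    unfolding has_real_derivative_iff_has_vector_derivative
    using bounded_linear.has_vector_derivative[OF bounded_linear_Re assms]
      bounded_linear.has_vector_derivative[OF bounded_linear_Im assms] by blast+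
  from DERIV_add[OF DERIV_power[OF this(1), of 2] DERIV_power[OF this(2), of 2]]
  have "((\<lambda>s. (Re (g s))\<^sup>2 + (Im (g s))\<^sup>2) has_real_derivative 2 * Re (cnj (g s) * b)) (at s)"
    by (rule DERIV_cong) (simp add: algebra_simps)
  then show ?thesis by (simp add: cmod_power2)
qed

context fe_mesh
begin

text \<open>The common part meets the relative interior of \<open>T\<close>, so as a face of
  \<open>T\<close> it is all of \<open>T\<close>. Then \<open>T\<close> would be a proper face of
  \<open>T'\<close>, contradicting their equal dimension.\<close>

lemma interior_unique:
  assumes "T \<in> \<T>" "T' \<in> \<T>" "x \<in> interior T" "x \<in> T'"
  shows "T' = T"
proof (rule ccontr)
  assume "T' \<noteq> T"
  then have f: "(T \<inter> T') face_of T" "(T \<inter> T') face_of T'" using mesh_inter1 mesh_inter2 assms by metis+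
  have "T \<inter> T' = T"
  proof (rule ccontr)
    assume "T \<inter> T' \<noteq> T"
    then have "(T \<inter> T') \<inter> rel_interior T = {}" using face_of_disjoint_rel_interior[OF f(1)] by blast
    moreover have "x \<in> rel_interior T" using assms interior_subset_rel_interior by blast
    ultimately show False using assms interior_subset by blast
  qed
  then have "aff_dim T < aff_dim T'"
    using face_of_aff_dim_lt[OF mesh_convex[OF assms(2)], of T] f(2) \<open>T' \<noteq> T\<close> by simp
  then show False using mesh_aff_dim assms by simp
qed

lemma P1_borel: "v \<in> Vh \<Longrightarrow> v \<in> borel_measurable borel"
proof -
  assume v: "v \<in> Vh"
  have "(\<lambda>x. indicator (closure \<Omega>) x *\<^sub>R v x) \<in> borel_measurable borel"
    by (intro borel_measurable_continuous_on_indicator P1_continuous[OF v]) simp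
  moreover have "(\<lambda>x. indicator (closure \<Omega>) x *\<^sub>R v x) = v"
    using P1_outside[OF v] by (auto simp: indicator_def fun_eq_iff)
  ultimately show ?thesis by simp
qed

text \<open>On the skeleton, where the gradient is undefined, the majorant adds up the contributions of all
  elements meeting there; being defined everywhere, it can be used along every single line.\<close>

lemma gradient_majorant:
  assumes v: "v \<in> Vh"
  obtains G :: "real^'n \<Rightarrow> real" where "G \<in> borel_measurable borel" "\<And>x. 0 \<le> G x"
    "\<And>x. x \<in> \<Omega> \<Longrightarrow> x \<notin> skeleton \<Longrightarrow> G x = (\<Sum>i\<in>UNIV. cmod (grad v x $ i))"
    "\<And>y e s. norm e = 1 \<Longrightarrow> 0 \<le> s \<Longrightarrow> \<forall>r\<in>{0..s}. y + r *\<^sub>R e \<in> closure \<Omega> \<Longrightarrow>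
      ennreal ((cmod (v y))\<^sup>2) \<le> ennreal ((cmod (v (y + s *\<^sub>R e)))\<^sup>2)
        + (\<integral>\<^sup>+r. indicator {0..s} r * ennreal (2 * cmod (v (y + r *\<^sub>R e)) * G (y + r *\<^sub>R e)) \<partial>lborel)"
proof -
  obtain c g where cg: "\<And>T x. T \<in> \<T> \<Longrightarrow> x \<in> T \<Longrightarrow> v x = c T + (\<Sum>i\<in>UNIV. g T i * complex_of_real (x $ i))"
    using P1_local_coeffs[OF v] by metis
  define N where "N T = (\<Sum>i\<in>UNIV. cmod (g T i))" for T
  define G where "G x = (\<Sum>T\<in>\<T>. indicator T x * N T)" for x
  have N0: "0 \<le> N T" for T by (simp add: N_def sum_nonneg)
  have G0: "0 \<le> G x" for x by (auto simp: G_def N0 intro!: sum_nonneg)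
  have GN: "N T \<le> G x" if "T \<in> \<T>" "x \<in> T" for T x
    using member_le_sum[OF that(1), of "\<lambda>T. indicator T x * N T"] finite_mesh N0 that by (simp add: G_def)
  have GM: "G x \<le> (\<Sum>T\<in>\<T>. N T)" for x
    unfolding G_def by (intro sum_mono) (auto simp: N0 indicator_def)
  have Gb: "G \<in> borel_measurable borel"
    unfolding G_def using mesh_closed by (intro borel_measurable_sum borel_measurable_times borel_measurable_indicator) auto
  have Ggrad: "G x = (\<Sum>i\<in>UNIV. cmod (grad v x $ i))" if x: "x \<in> \<Omega>" "x \<notin> skeleton" for x
  proof -
    have "x \<in> closure \<Omega>" using x(1) closure_subset by blast
    then obtain T where T: "T \<in> \<T>" "x \<in> interior T" by (rule off_skeleton[OF _ x(2)])
    have "G x = (\<Sum>T'\<in>\<T>. if T' = T then N T else 0)"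
      unfolding G_def
    proof (rule sum.cong[OF refl])
      fix T' assume "T' \<in> \<T>"
      then have "x \<in> T' \<longleftrightarrow> T' = T"
        using interior_unique[OF T(1) _ T(2)] subsetD[OF interior_subset T(2)] by blast
      then show "indicator T' x * N T' = (if T' = T then N T else 0)" by (auto simp: indicator_def)
    qed
    also have "\<dots> = N T" using T finite_mesh by simp
    also have "\<dots> = (\<Sum>i\<in>UNIV. cmod (grad v x $ i))"
      unfolding N_def using grad_affine[OF cg T(2)] T by simp
    finally show ?thesis .
  qed
  have line: "ennreal ((cmod (v y))\<^sup>2) \<le> ennreal ((cmod (v (y + t *\<^sub>R e)))\<^sup>2)
        + (\<integral>\<^sup>+r. indicator {0..t} r * ennreal (2 * cmod (v (y + r *\<^sub>R e)) * G (y + r *\<^sub>R e)) \<partial>lborel)"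
    if e: "norm e = 1" and t: "0 \<le> t" and seg: "\<forall>r\<in>{0..t}. y + r *\<^sub>R e \<in> closure \<Omega>" for y e t
  proof -
    define w where "w r = v (y + r *\<^sub>R e)" for r
    \<comment> \<open>By convexity the line meets each element in a compact interval. Off the
      finitely many endpoints \<open>v\<close> is therefore affine along the line near each
      parameter, even when the segment runs inside a face.\<close>
    define I where "I T = {0..t} \<inter> (\<lambda>r. y + r *\<^sub>R e) -` T" for T
    have "\<exists>a b. I T = {a..b}" if "T \<in> \<T>" for T
    proof -
      have "compact (I T)" unfolding I_def using mesh_closed[OF that]
        by (intro compact_Int_closed closed_vimage continuous_intros) auto
      moreover have "convex (I T)" unfolding I_def
      proof (rule convex_Int[OF convex_real_interval(5) convexI])
        fix r s p q :: real assume "r \<in> (\<lambda>r. y + r *\<^sub>R e) -` T" "s \<in> (\<lambda>r. y + r *\<^sub>R e) -` T"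
          and pq: "0 \<le> p" "0 \<le> q" "p + q = 1"
        then have "p *\<^sub>R (y + r *\<^sub>R e) + q *\<^sub>R (y + s *\<^sub>R e) \<in> T"
          using mesh_convex[OF that] by (auto simp: convex_def)
        also have "p *\<^sub>R (y + r *\<^sub>R e) + q *\<^sub>R (y + s *\<^sub>R e) = (p + q) *\<^sub>R y + (p *\<^sub>R r + q *\<^sub>R s) *\<^sub>R e"
          by (simp add: algebra_simps)
        finally show "p *\<^sub>R r + q *\<^sub>R s \<in> (\<lambda>r. y + r *\<^sub>R e) -` T" using pq by simp
      qed
      ultimately show ?thesis using connected_compact_interval_1[of "I T"] convex_connected[of "I T"] by simp
    qed
    then obtain a b where ab: "\<And>T. T \<in> \<T> \<Longrightarrow> I T = {a T..b T}" by metis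
    define E where "E = a ` \<T> \<union> b ` \<T> \<union> {0, t}"
    have E: "finite E" unfolding E_def using finite_mesh by simp
    define f where "f r = (cmod (w r))\<^sup>2" for r
    \<comment> \<open>The value 0 at breakpoints is a filler: it keeps
      \<open>- f' r \<le> \<psi> r\<close> true at every parameter, while the fundamental theorem
      ignores finitely many points.\<close>
    define f' where "f' r = (if r \<in> E then 0 else vector_derivative f (at r))" for r
    define \<psi> where "\<psi> r = 2 * cmod (w r) * G (y + r *\<^sub>R e)" for r
    have deriv: "(f has_vector_derivative f' r) (at r) \<and> \<bar>f' r\<bar> \<le> \<psi> r" if r: "r \<in> {0<..<t} - E" for r
    proof -
      have "y + r *\<^sub>R e \<in> closure \<Omega>" using r seg by auto
      then obtain T where T: "T \<in> \<T>" "y + r *\<^sub>R e \<in> T" using Union_mesh by blast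
      then have "r \<in> I T" using r by (auto simp: I_def)
      then have rab: "r \<in> {a T<..<b T}" using ab[OF T(1)] r T(1) by (force simp: E_def)
      define \<beta> where "\<beta> = (\<Sum>i\<in>UNIV. g T i * complex_of_real (e $ i))"
      have aff: "w s = (c T + (\<Sum>i\<in>UNIV. g T i * complex_of_real (y $ i))) + of_real s * \<beta>" if "s \<in> {a T<..<b T}" for s
      proof -
        have "s \<in> I T" using ab[OF T(1)] that by auto
        then show ?thesis unfolding w_def \<beta>_def using cg[OF T(1), of "y + s *\<^sub>R e"]
          by (simp add: I_def sum.distrib algebra_simps sum_distrib_left)
      qed
      have "((\<lambda>s. (c T + (\<Sum>i\<in>UNIV. g T i * complex_of_real (y $ i))) + of_real s * \<beta>) has_vector_derivative \<beta>) (at r)"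
        by (auto intro!: derivative_eq_intros simp: has_vector_derivative_def scaleR_conv_of_real)
      then have "(w has_vector_derivative \<beta>) (at r)"
        by (rule has_vector_derivative_transform_within_open[of _ _ _ "{a T<..<b T}"]) (use aff rab in auto)
      from cmod_sq_derivative[OF this]
      have d: "(f has_vector_derivative 2 * Re (cnj (w r) * \<beta>)) (at r)"
        unfolding f_def has_real_derivative_iff_has_vector_derivative .
      then have f': "f' r = 2 * Re (cnj (w r) * \<beta>)" using r by (simp add: f'_def vector_derivative_at)
      have "cmod \<beta> \<le> N T" unfolding \<beta>_def N_def
      proof (rule sum_norm_le)
        fix i
        have "\<bar>e $ i\<bar> \<le> 1" using component_le_norm_cart[of e i] e by simp
        then show "cmod (g T i * complex_of_real (e $ i)) \<le> cmod (g T i)"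
          by (simp add: norm_mult mult_left_le)
      qed
      also have "\<dots> \<le> G (y + r *\<^sub>R e)" using GN T by blast
      finally have "cmod (cnj (w r) * \<beta>) \<le> cmod (w r) * G (y + r *\<^sub>R e)"
        by (simp add: norm_mult mult_left_mono)
      then have "\<bar>f' r\<bar> \<le> \<psi> r" unfolding f' \<psi>_def using abs_Re_le_cmod[of "cnj (w r) * \<beta>"] by simp
      with d f' show ?thesis by simp
    qed
    have wcont: "continuous_on {0..t} w" unfolding w_def
      by (intro continuous_on_compose2[OF P1_continuous[OF v]] continuous_intros) (use seg in auto)
    have fcont: "continuous_on {0..t} f" unfolding f_def by (intro continuous_intros wcont)
    have "(f' has_integral (f t - f 0)) {0..t}"
      by (rule fundamental_theorem_of_calculus_interior_strong[OF E t _ fcont]) (use deriv in blast)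
    from has_integral_neg[OF this] have F: "((\<lambda>r. - f' r) has_integral (f 0 - f t)) {0..t}"
      by simp
    have wb: "w \<in> borel_measurable borel" unfolding w_def using P1_borel[OF v] by measurable
    have \<psi>b: "\<psi> \<in> borel_measurable borel" unfolding \<psi>_def using wb Gb by measurable
    have \<psi>0: "0 \<le> \<psi> r" for r by (simp add: \<psi>_def G0)
    obtain B where B: "\<And>r. r \<in> {0..t} \<Longrightarrow> cmod (w r) \<le> B"
    proof -
      have "bounded (w ` {0..t})" using compact_continuous_image[OF wcont compact_Icc] by (rule compact_imp_bounded)
      then show ?thesis using that unfolding bounded_iff by blast
    qed
    have "\<psi> integrable_on {0..t}"
    proof (rule measurable_bounded_by_integrable_imp_integrable_real)
      show "\<psi> \<in> borel_measurable (lebesgue_on {0..t})"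
        using \<psi>b by (intro measurable_restrict_space1 measurable_completion) simp
      show "(\<lambda>r. 2 * B * (\<Sum>T\<in>\<T>. N T)) integrable_on {0..t}" by (rule integrable_const_ivl)
      show "\<bar>\<psi> r\<bar> \<le> 2 * B * (\<Sum>T\<in>\<T>. N T)" if "r \<in> {0..t}" for r
      proof -
        have "cmod (w r) * G (y + r *\<^sub>R e) \<le> B * (\<Sum>T\<in>\<T>. N T)"
          by (rule mult_mono[OF B[OF that] GM order_trans[OF norm_ge_zero B[OF that]] G0])
        then show ?thesis using \<psi>0[of r] by (simp add: \<psi>_def)
      qed
    qed auto
    then obtain J where J: "(\<psi> has_integral J) {0..t}" by blast
    have "f 0 - f t \<le> J"
    proof (rule has_integral_le[OF F J])
      fix r assume "r \<in> {0..t}"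
      then show "- f' r \<le> \<psi> r" using deriv[of r] \<psi>0[of r]
        by (cases "r \<in> E") (auto simp: f'_def E_def order_less_le)
    qed
    moreover have "(\<integral>\<^sup>+r. indicator {0..t} r * ennreal (\<psi> r) \<partial>lborel) = ennreal J"
    proof -
      have "indicator {0..t} r * ennreal (\<psi> r) = ennreal (indicator {0..t} r * \<psi> r)" for r
        by (simp split: split_indicator)
      then show ?thesis using nn_integral_has_integral_lebesgue[OF _ J] \<psi>0
        by (simp add: nn_integral_completion)
    qed
    moreover have "0 \<le> J" using has_integral_nonneg[OF J] \<psi>0 by simp
    ultimately show ?thesis
      unfolding \<psi>_def[symmetric] w_def[symmetric] f_def
      by (simp add: f_def w_def flip: ennreal_plus)
  qed
  show ?thesis by (rule that[OF Gb G0 Ggrad line])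
qed

end

text \<open>Links the Bochner integrals over \<open>lebesgue\<close> in the definitions with
  nonnegative integrals over \<open>lborel\<close>, where Fubini needs only measurability.\<close>

lemma set_nn_integral_eq_lborel:
  fixes f :: "'a::euclidean_space \<Rightarrow> real"
  assumes f: "f absolutely_integrable_on S" and nonneg: "\<And>x. x \<in> S \<Longrightarrow> 0 \<le> f x"
  shows "(\<integral>\<^sup>+x. indicator S x * ennreal (f x) \<partial>lborel) = ennreal (LINT x:S|lebesgue. f x)"
proof -
  have "(\<integral>\<^sup>+x. ennreal (indicator S x *\<^sub>R f x) \<partial>lebesgue) = ennreal (LINT x:S|lebesgue. f x)"
    using f nonneg unfolding set_integrable_def set_lebesgue_integral_def
    by (intro nn_integral_eq_integral) (auto simp: indicator_def)
  moreover have "indicator S x * ennreal (f x) = ennreal (indicator S x *\<^sub>R f x)" for x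
    by (simp split: split_indicator)
  ultimately show ?thesis by (simp add: nn_integral_completion)
qed

text \<open>Compactness of the frontier gives finitely many charts, chosen from the domain alone.
  The doubled radius leaves room to travel a distance \<open>r x\<close> along the chart direction
  from any point of \<open>ball x (r x)\<close> without leaving the chart.\<close>

lemma lipschitz_domain_atlas:
  fixes D :: "(real^'n) set"
  assumes D: "lipschitz_domain D"
  obtains X r U e \<Phi> L where "finite X" "frontier D \<subseteq> (\<Union>x\<in>X. ball x (r x))"
    "\<And>x. x \<in> X \<Longrightarrow> 0 < r x" "\<And>x. x \<in> X \<Longrightarrow> ball x (2 * r x) \<subseteq> U x"
    "\<And>x. x \<in> X \<Longrightarrow> boundary_chart D (U x) (e x) (\<Phi> x) (L x)"
proof -
  have "\<exists>r U e \<Phi> L. 0 < r \<and> ball x (2 * r) \<subseteq> U \<and> boundary_chart D U e \<Phi> L" if x: "x \<in> frontier D" for x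
  proof -
    obtain U e \<Phi> L where c: "boundary_chart D U e \<Phi> L" "x \<in> U"
      using lipschitz_domain_chart[OF D x] .
    then have "open U" by (simp add: boundary_chart_def)
    then obtain d where "d > 0" "ball x d \<subseteq> U" using c(2) by (meson open_contains_ball)
    then show ?thesis using c(1) by (intro exI[of _ "d / 2"]) auto
  qed
  then obtain r U e \<Phi> L where *: "\<And>x. x \<in> frontier D \<Longrightarrow>
      0 < r x \<and> ball x (2 * r x) \<subseteq> U x \<and> boundary_chart D (U x) (e x) (\<Phi> x) (L x)"
    by metis
  have cpt: "compact (frontier D)"
    using D by (intro compact_frontier_bounded) (simp add: lipschitz_domain_def)
  have cover: "frontier D \<subseteq> (\<Union>x\<in>frontier D. ball x (r x))"
    using * by force
  obtain X where "X \<subseteq> frontier D" "finite X" "frontier D \<subseteq> (\<Union>x\<in>X. ball x (r x))"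
    by (rule compactE_image[OF cpt open_ball cover])
  with * show ?thesis by (intro that[of X r U e \<Phi> L]) auto
qed

context fe_mesh
begin

text \<open>By conformity the intersection is a face of both; distinctness makes it proper in at
  least one of them, which costs a further dimension.\<close>

lemma aff_dim_Int_boundary_faces:
  assumes "F \<in> boundary_faces" "F' \<in> boundary_faces" "F \<noteq> F'"
  shows "aff_dim (F \<inter> F') \<le> int DIM(real^'n) - 2"
proof -
  note F = boundary_face[OF assms(1)] and F' = boundary_face[OF assms(2)]
  obtain T where T: "T \<in> \<T>" "F face_of T"
    using assms(1) by (auto simp: boundary_faces_def mesh_faces_def)
  obtain T' where T': "T' \<in> \<T>" "F' face_of T'"
    using assms(2) by (auto simp: boundary_faces_def mesh_faces_def)
  have "(T \<inter> T') face_of T" "(T \<inter> T') face_of T'"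
    using mesh_inter1[OF T(1) T'(1)] mesh_inter2[OF T(1) T'(1)] face_of_refl[OF mesh_convex[OF T(1)]]
    by (cases "T = T'"; simp)+
  from face_of_Int_subface[OF this T(2) T'(2)]
  have face: "(F \<inter> F') face_of F" "(F \<inter> F') face_of F'" by auto
  from assms(3) consider "F \<inter> F' \<noteq> F" | "F \<inter> F' \<noteq> F'" by blast
  then have "aff_dim (F \<inter> F') < int CARD('n) - 1"
    using face_of_aff_dim_lt[OF F(2) face(1)] face_of_aff_dim_lt[OF F'(2) face(2)] F(6) F'(6)
    by cases auto
  then show ?thesis by simp
qed

text \<open>Average the line estimate over lengths \<open>t\<close> in \<open>(0, r]\<close>,
  integrate over the faces, and pass to oblique prisms. These are almost disjoint parts of the
  domain, so the sum over faces is bounded by one integral over \<open>\<Omega>\<close>, however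
  many faces there are.\<close>

lemma chart_trace_bound:
  assumes chart: "boundary_chart \<Omega> U e \<Phi> L" and r: "0 < r" and ball: "ball x0 (2 * r) \<subseteq> U"
    and v: "v \<in> Vh" and G: "G \<in> borel_measurable borel"
    and line: "\<And>y e s. norm e = 1 \<Longrightarrow> 0 \<le> s \<Longrightarrow> \<forall>r\<in>{0..s}. y + r *\<^sub>R e \<in> closure \<Omega> \<Longrightarrow>
      ennreal ((cmod (v y))\<^sup>2) \<le> ennreal ((cmod (v (y + s *\<^sub>R e)))\<^sup>2)
        + (\<integral>\<^sup>+r. indicator {0..s} r * ennreal (2 * cmod (v (y + r *\<^sub>R e)) * G (y + r *\<^sub>R e)) \<partial>lborel)"
  shows "ennreal r * (\<Sum>F\<in>boundary_faces. \<integral>\<^sup>+x. indicator (face_prism F) x * indicator (ball x0 r) (face_proj F x)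
            * ennreal ((cmod (v (face_proj F x)))\<^sup>2) \<partial>lborel)
    \<le> ennreal (sqrt (1 + L\<^sup>2)) * (\<integral>\<^sup>+x. indicator \<Omega> x *
            (ennreal ((cmod (v x))\<^sup>2) + ennreal r * ennreal (2 * cmod (v x) * G x)) \<partial>lborel)"
proof -
  define B where "B = ball x0 r"
  \<comment> \<open>The left endpoint is left out because for \<open>t = 0\<close> the point lies on
    the frontier, outside the open set \<open>\<Omega>\<close>.\<close>
  define J where "J = {0<..r}"
  define \<psi> where "\<psi> x = ennreal (2 * cmod (v x) * G x)" for x
  define f where "f x = ennreal ((cmod (v x))\<^sup>2)" for x
  define q where "q x = indicator \<Omega> x * (f x + ennreal r * \<psi> x)" for x
  have e: "norm e = 1" and L: "0 \<le> L" and U: "open U" and \<Phi>e: "\<And>y t. \<Phi> (y + t *\<^sub>R e) = \<Phi> y"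
    using chart by (auto simp: boundary_chart_def)
  have ee: "e \<bullet> e = 1" using e by (simp flip: power2_norm_eq_inner)
  note [measurable] = P1_borel[OF v] G
  have [measurable]: "\<psi> \<in> borel_measurable borel" "f \<in> borel_measurable borel"
    unfolding \<psi>_def f_def by measurable
  have [measurable]: "\<Omega> \<in> sets borel" "B \<in> sets borel" "J \<in> sets borel"
    using open_domain by (auto simp: B_def J_def)
  have [measurable]: "q \<in> borel_measurable borel" unfolding q_def by measurable
  have graph: "\<Phi> y = y \<bullet> e" if "y \<in> frontier \<Omega>" "y \<in> U" for y
    using chart_frontier[OF chart open_domain that] .
  have BU: "B \<subseteq> U" using ball r by (auto simp: B_def)
  have inside: "y + t *\<^sub>R e \<in> \<Omega>" if y: "y \<in> frontier \<Omega>" "y \<in> B" and t: "t \<in> J" for y t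
  proof -
    have "dist x0 (y + t *\<^sub>R e) \<le> dist x0 y + t"
      using dist_triangle[of x0 "y + t *\<^sub>R e" y] t e by (simp add: J_def dist_norm)
    then have "y + t *\<^sub>R e \<in> ball x0 (2 * r)" using y t by (simp add: B_def J_def)
    then have "y + t *\<^sub>R e \<in> U" using ball by blast
    moreover have "\<Phi> (y + t *\<^sub>R e) < (y + t *\<^sub>R e) \<bullet> e"
      using graph[OF y(1)] y(2) BU t ee by (auto simp: \<Phi>e J_def inner_add_left)
    ultimately show ?thesis using chart_mem_iff[OF chart] by blast
  qed
  \<comment> \<open>The boundary value does not depend on \<open>t\<close>, so integrating over
    \<open>J\<close> gives the factor \<open>r\<close> on the left. The line integral on the right
    is enlarged to all of \<open>J\<close> first, which makes it a constant in
    \<open>t\<close>.\<close>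
  have pointwise: "ennreal r * f y \<le> (\<integral>\<^sup>+t. indicator J t * q (y + t *\<^sub>R e) \<partial>lborel)"
    if y: "y \<in> frontier \<Omega>" "y \<in> B" for y
  proof -
    define D where "D = (\<integral>\<^sup>+s. indicator J s * \<psi> (y + s *\<^sub>R e) \<partial>lborel)"
    have J: "(\<integral>\<^sup>+t. indicator J t * c \<partial>lborel) = ennreal r * c" for c :: ennreal
      using r by (simp add: nn_integral_multc J_def)
    have "f y \<le> f (y + t *\<^sub>R e) + D" if t: "t \<in> J" for t
    proof -
      have "y + s *\<^sub>R e \<in> closure \<Omega>" if "s \<in> {0..t}" for s
      proof (cases "s = 0")
        case True
        then show ?thesis using y(1) by (simp add: frontier_def)
      next
        case False
        then have "s \<in> J" using that t by (auto simp: J_def)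
        then show ?thesis using inside[OF y] closure_subset by blast
      qed
      then have "\<forall>s\<in>{0..t}. y + s *\<^sub>R e \<in> closure \<Omega>" by blast
      from line[OF e _ this] t
      have "f y \<le> f (y + t *\<^sub>R e) + (\<integral>\<^sup>+s. indicator {0..t} s * \<psi> (y + s *\<^sub>R e) \<partial>lborel)"
        by (simp add: f_def \<psi>_def J_def)
      also have "(\<integral>\<^sup>+s. indicator {0..t} s * \<psi> (y + s *\<^sub>R e) \<partial>lborel) \<le> D"
        unfolding D_def
      proof (rule nn_integral_mono_AE)
        show "AE s in lborel. indicator {0..t} s * \<psi> (y + s *\<^sub>R e) \<le> indicator J s * \<psi> (y + s *\<^sub>R e)"
          using AE_lborel_singleton[of "0::real"]
          by eventually_elim (use t in \<open>auto simp: J_def indicator_def\<close>)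
      qed
      finally show ?thesis by (simp add: add_left_mono)
    qed
    then have "(\<integral>\<^sup>+t. indicator J t * f y \<partial>lborel) \<le> (\<integral>\<^sup>+t. indicator J t * f (y + t *\<^sub>R e) + indicator J t * D \<partial>lborel)"
      by (intro nn_integral_mono) (auto simp: indicator_def)
    also have "\<dots> = (\<integral>\<^sup>+t. indicator J t * f (y + t *\<^sub>R e) \<partial>lborel) + ennreal r * D"
      by (subst nn_integral_add) (auto simp: J)
    also have "ennreal r * D = (\<integral>\<^sup>+t. ennreal r * (indicator J t * \<psi> (y + t *\<^sub>R e)) \<partial>lborel)"
      unfolding D_def by (rule nn_integral_cmult[symmetric]) measurable
    also have "(\<integral>\<^sup>+t. indicator J t * f (y + t *\<^sub>R e) \<partial>lborel) + \<dots>
        = (\<integral>\<^sup>+t. indicator J t * f (y + t *\<^sub>R e) + ennreal r * (indicator J t * \<psi> (y + t *\<^sub>R e)) \<partial>lborel)"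
      by (rule nn_integral_add[symmetric]) measurable
    also have "\<dots> = (\<integral>\<^sup>+t. indicator J t * q (y + t *\<^sub>R e) \<partial>lborel)"
      by (rule nn_integral_cong) (use inside[OF y] in \<open>auto simp: q_def indicator_def\<close>)
    finally show ?thesis by (simp only: J)
  qed
  \<comment> \<open>The oblique prism over \<open>F \<inter> B\<close>: the quotient is the length
    \<open>t\<close> for which \<open>x - t *\<^sub>R e\<close> lies in the hyperplane of
    \<open>F\<close>.\<close>
  define P where "P F = {x. x - (face_normal F \<bullet> (x - face_point F) / (face_normal F \<bullet> e)) *\<^sub>R e \<in> F \<inter> B
      \<and> face_normal F \<bullet> (x - face_point F) / (face_normal F \<bullet> e) \<in> J}" for F
  have closed_face: "F \<in> sets borel" if "F \<in> boundary_faces" for F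
    by (intro borel_closed compact_imp_closed boundary_face(1) that)
  have P_borel: "P F \<in> sets borel" if "F \<in> boundary_faces" for F
  proof -
    have [measurable]: "F \<in> sets borel" by (rule closed_face[OF that])
    show ?thesis unfolding P_def by measurable
  qed
  have face_bound: "ennreal r * (\<integral>\<^sup>+x. indicator (face_prism F) x * indicator B (face_proj F x) * f (face_proj F x) \<partial>lborel)
      \<le> ennreal (sqrt (1 + L\<^sup>2)) * (\<integral>\<^sup>+x. indicator (P F) x * q x \<partial>lborel)"
    if F: "F \<in> boundary_faces" for F
  proof -
    note bF = boundary_face[OF F]
    let ?\<nu> = "face_normal F" and ?p = "face_point F" and ?A = "F \<inter> B"
    have [measurable]: "F \<in> sets borel" by (rule closed_face[OF F])
    have [measurable]: "face_proj F \<in> borel_measurable borel"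
      using continuous_face_proj by (rule borel_measurable_continuous_onI)
    have split: "indicator (face_prism F) x * indicator B (face_proj F x)
        = (indicator ?A (face_proj F x) * indicator {0..1} (?\<nu> \<bullet> (x - ?p)) :: ennreal)" for x
      unfolding face_prism_eq[OF bF(6)] by (auto simp: indicator_def)
    show ?thesis
    proof (cases "?A = {}")
      case True
      then show ?thesis by (simp add: split)
    next
      case False
      define \<kappa> where "\<kappa> = ?\<nu> \<bullet> e"
      have "1 \<le> (1 + L\<^sup>2) * \<kappa>\<^sup>2"
        unfolding \<kappa>_def
      proof (rule hyperplane_transversal[OF bF(2) _ _ _ e U _ L])
        show "aff_dim F = int DIM(real^'n) - 1" using bF(6) by simp
        show "norm ?\<nu> = 1" "\<And>x y. x \<in> F \<Longrightarrow> y \<in> F \<Longrightarrow> ?\<nu> \<bullet> (x - y) = 0"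
          using face_normal[OF bF(6)] by auto
        show "F \<inter> U \<noteq> {}" using False BU by blast
        show "\<bar>(x - y) \<bullet> e\<bar> \<le> L * norm ((x - y) - ((x - y) \<bullet> e) *\<^sub>R e)" if "x \<in> F \<inter> U" "y \<in> F \<inter> U" for x y
          using chart_graph[OF chart graph graph] that bF(5) by blast
      qed
      then have \<kappa>0: "\<kappa> \<noteq> 0" by auto
      have "1 \<le> (sqrt (1 + L\<^sup>2) * \<bar>\<kappa>\<bar>)\<^sup>2"
        using \<open>1 \<le> (1 + L\<^sup>2) * \<kappa>\<^sup>2\<close> by (simp add: power_mult_distrib)
      then have "1 \<le> sqrt (1 + L\<^sup>2) * \<bar>\<kappa>\<bar>"
        using power2_le_imp_le[of 1 "sqrt (1 + L\<^sup>2) * \<bar>\<kappa>\<bar>"] by simp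
      then have \<kappa>: "1 / \<bar>\<kappa>\<bar> \<le> sqrt (1 + L\<^sup>2)" using \<kappa>0 by (simp add: divide_le_eq)
      have "ennreal r * (\<integral>\<^sup>+x. indicator (face_prism F) x * indicator B (face_proj F x) * f (face_proj F x) \<partial>lborel)
          = (\<integral>\<^sup>+x. indicator ?A (face_proj F x) * indicator {0..1} (?\<nu> \<bullet> (x - ?p)) * (ennreal r * f (face_proj F x)) \<partial>lborel)"
        unfolding split by (subst nn_integral_cmult[symmetric]) (measurable, simp add: mult_ac)
      also have "\<dots> \<le> (\<integral>\<^sup>+x. indicator ?A (face_proj F x) * indicator {0..1} (?\<nu> \<bullet> (x - ?p))
            * (\<integral>\<^sup>+t. indicator J t * q (face_proj F x + t *\<^sub>R e) \<partial>lborel) \<partial>lborel)"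
        using pointwise bF(5) by (intro nn_integral_mono) (auto simp: indicator_def subset_iff)
      also have "\<dots> = (\<integral>\<^sup>+x. (\<integral>\<^sup>+t. indicator J t * indicator ?A (face_proj F x) * indicator {0..1} (?\<nu> \<bullet> (x - ?p))
            * q (face_proj F x + t *\<^sub>R e) \<partial>lborel) \<partial>lborel)"
        by (intro nn_integral_cong, subst nn_integral_cmult[symmetric]) (measurable, simp add: mult_ac)
      also have "\<dots> = (\<integral>\<^sup>+t. (\<integral>\<^sup>+x. indicator J t * indicator ?A (face_proj F x) * indicator {0..1} (?\<nu> \<bullet> (x - ?p))
            * q (face_proj F x + t *\<^sub>R e) \<partial>lborel) \<partial>lborel)"
        by (rule lborel_pair.Fubini') measurable
      also have "\<dots> = ennreal (1 / \<bar>\<kappa>\<bar>) * (\<integral>\<^sup>+x. indicator ?A (x - (?\<nu> \<bullet> (x - ?p) / \<kappa>) *\<^sub>R e)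
            * indicator J (?\<nu> \<bullet> (x - ?p) / \<kappa>) * q x \<partial>lborel)"
        unfolding face_proj_def \<kappa>_def
        by (rule nn_integral_oblique_prism)
          (use \<kappa>0 face_normal(1)[OF bF(6)] in \<open>auto simp: \<kappa>_def simp flip: power2_norm_eq_inner\<close>)
      also have "(\<integral>\<^sup>+x. indicator ?A (x - (?\<nu> \<bullet> (x - ?p) / \<kappa>) *\<^sub>R e) * indicator J (?\<nu> \<bullet> (x - ?p) / \<kappa>) * q x \<partial>lborel)
          = (\<integral>\<^sup>+x. indicator (P F) x * q x \<partial>lborel)"
        by (intro nn_integral_cong) (auto simp: P_def \<kappa>_def indicator_def)
      also have "ennreal (1 / \<bar>\<kappa>\<bar>) * \<dots> \<le> ennreal (sqrt (1 + L\<^sup>2)) * \<dots>"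
        using \<kappa> by (intro mult_right_mono ennreal_leI) auto
      finally show ?thesis .
    qed
  qed
  define N where "N = (\<Union>(F, F')\<in>{(F, F')\<in>boundary_faces \<times> boundary_faces. F \<noteq> F'}. {y + t *\<^sub>R e | y t. y \<in> F \<inter> F'})"
  have "negligible N"
    unfolding N_def
  proof (rule negligible_Union)
    show "finite ((\<lambda>(F, F'). {y + t *\<^sub>R e | y t. y \<in> F \<inter> F'}) ` {(F, F')\<in>boundary_faces \<times> boundary_faces. F \<noteq> F'})"
      using finite_boundary_faces
      by (intro finite_imageI) (rule finite_subset[of _ "boundary_faces \<times> boundary_faces"], auto)
    show "negligible S" if "S \<in> (\<lambda>(F, F'). {y + t *\<^sub>R e | y t. y \<in> F \<inter> F'}) ` {(F, F')\<in>boundary_faces \<times> boundary_faces. F \<noteq> F'}" for S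
      using that negligible_sweep[OF aff_dim_Int_boundary_faces] by auto
  qed
  then have "AE x in lebesgue. x \<notin> N"
    by (intro AE_not_in) (simp add: negligible_iff_null_sets)
  then have AE_N: "AE x in lborel. x \<notin> N" by (simp add: AE_completion_iff)
  \<comment> \<open>The graph fixes the foot point: both feet lie on one line parallel to
    \<open>e\<close>, along which \<open>\<Phi>\<close> is constant and equals their height. They
    coincide, so \<open>x\<close> lies above a point common to both faces, which puts it in
    \<open>N\<close>.\<close>
  have unique: "F = F'" if FF: "F \<in> boundary_faces" "F' \<in> boundary_faces" "x \<in> P F" "x \<in> P F'" "x \<notin> N" for F F' x
  proof (rule ccontr)
    assume ne: "F \<noteq> F'"
    obtain y t where y: "x = y + t *\<^sub>R e" "y \<in> F \<inter> B" using FF(3) unfolding P_def by force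
    obtain y' t' where y': "x = y' + t' *\<^sub>R e" "y' \<in> F' \<inter> B" using FF(4) unfolding P_def by force
    have "\<Phi> y = y \<bullet> e" "\<Phi> y' = y' \<bullet> e"
      using graph y(2) y'(2) boundary_face(5)[OF FF(1)] boundary_face(5)[OF FF(2)] BU by blast+
    moreover have "\<Phi> y = \<Phi> y'" using \<Phi>e[of y t] \<Phi>e[of y' t'] y(1) y'(1) by simp
    moreover have "y \<bullet> e + t = y' \<bullet> e + t'"
      using arg_cong[OF trans[OF y(1)[symmetric] y'(1)], of "\<lambda>z. z \<bullet> e"] ee by (simp add: inner_add_left)
    ultimately have "t = t'" by simp
    then have "y = y'" using y(1) y'(1) by simp
    then have "x \<in> {y + t *\<^sub>R e | y t. y \<in> F \<inter> F'}" using y y' by blast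
    then have "x \<in> N" unfolding N_def using FF(1,2) ne by blast
    then show False using FF(5) by blast
  qed
  have AE_sum: "AE x in lborel. (\<Sum>F\<in>boundary_faces. indicator (P F) x * q x) \<le> q x"
    using AE_N
  proof eventually_elim
    case (elim x)
    show ?case
    proof (cases "\<exists>F\<in>boundary_faces. x \<in> P F")
      case True
      then obtain F where F: "F \<in> boundary_faces" "x \<in> P F" by blast
      have "(\<Sum>F'\<in>boundary_faces. indicator (P F') x * q x) = (\<Sum>F'\<in>boundary_faces. if F' = F then q x else 0)"
      proof (rule sum.cong[OF refl])
        fix F' assume "F' \<in> boundary_faces"
        then have "x \<in> P F' \<longleftrightarrow> F' = F" using unique[OF _ F(1) _ F(2) elim] F(2) by blast
        then show "indicator (P F') x * q x = (if F' = F then q x else 0)" by (auto simp: indicator_def)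
      qed
      then show ?thesis using F finite_boundary_faces by simp
    next
      case False
      then have "(\<Sum>F'\<in>boundary_faces. indicator (P F') x * q x) = 0" by (intro sum.neutral) auto
      then show ?thesis by simp
    qed
  qed
  have "ennreal r * (\<Sum>F\<in>boundary_faces. \<integral>\<^sup>+x. indicator (face_prism F) x * indicator B (face_proj F x) * f (face_proj F x) \<partial>lborel)
      \<le> (\<Sum>F\<in>boundary_faces. ennreal (sqrt (1 + L\<^sup>2)) * (\<integral>\<^sup>+x. indicator (P F) x * q x \<partial>lborel))"
    unfolding sum_distrib_left by (rule sum_mono[OF face_bound])
  also have "\<dots> = ennreal (sqrt (1 + L\<^sup>2)) * (\<integral>\<^sup>+x. (\<Sum>F\<in>boundary_faces. indicator (P F) x * q x) \<partial>lborel)"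
    unfolding sum_distrib_left[symmetric]
    by (subst nn_integral_sum) (use P_borel in \<open>auto intro!: borel_measurable_times_ennreal borel_measurable_indicator\<close>)
  also have "\<dots> \<le> ennreal (sqrt (1 + L\<^sup>2)) * (\<integral>\<^sup>+x. q x \<partial>lborel)"
    by (intro mult_left_mono nn_integral_mono_AE AE_sum) simp
  finally show ?thesis unfolding B_def f_def q_def \<psi>_def .
qed

end

text \<open>Used instead of a partition of unity: counting a point several times is harmless in an
  upper bound.\<close>

lemma sum_ge_of_covering:
  fixes c :: ennreal
  assumes "finite X" "\<exists>x\<in>X. y \<in> A x"
  shows "c \<le> (\<Sum>x\<in>X. indicator (A x) y * c)"
proof -
  obtain x where x: "x \<in> X" "y \<in> A x" using assms by blast
  then have "c = indicator (A x) y * c" by simp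
  also have "\<dots> \<le> (\<Sum>x\<in>X. indicator (A x) y * c)"
    using assms(1) x(1) by (intro member_le_sum) auto
  finally show ?thesis .
qed

context fe_mesh
begin

lemma bdry_sq_eq_nn_integral:
  assumes v: "v \<in> Vh"
  shows "ennreal (bdry_sq v) = (\<Sum>F\<in>boundary_faces.
    \<integral>\<^sup>+x. indicator (face_prism F) x * ennreal ((cmod (v (face_proj F x)))\<^sup>2) \<partial>lborel)"
proof -
  have "ennreal (bdry_sq v) = (\<Sum>F\<in>boundary_faces. ennreal (LINT x:face_prism F|lebesgue. (cmod (v (face_proj F x)))\<^sup>2))"
    unfolding bdry_sq_def
    by (intro sum_ennreal[symmetric]) (auto simp: set_lebesgue_integral_def intro!: integral_nonneg_AE)
  also have "\<dots> = (\<Sum>F\<in>boundary_faces.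
    \<integral>\<^sup>+x. indicator (face_prism F) x * ennreal ((cmod (v (face_proj F x)))\<^sup>2) \<partial>lborel)"
    by (intro sum.cong refl set_nn_integral_eq_lborel[symmetric] integrable_face_sq[OF v]) auto
  finally show ?thesis .
qed

text \<open>Young's inequality with weight \<open>k\<close> splits \<open>2 |v| G\<close> into
  \<open>k |v|\<^sup>2 + G\<^sup>2 / k\<close>, the split that reproduces the energy norm once
  multiplied by \<open>k\<close>. The factor \<open>CARD('n)\<close> comes from Cauchy-Schwarz, as
  \<open>G\<close> is the sum of the moduli of the partial derivatives.\<close>

lemma trace_volume_bound:
  assumes v: "v \<in> Vh" and r: "0 < r" and k: "0 < k"
    and G: "\<And>x. 0 \<le> G x" "\<And>x. x \<in> \<Omega> \<Longrightarrow> x \<notin> skeleton \<Longrightarrow> G x = (\<Sum>i\<in>UNIV. cmod (grad v x $ i))"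
  shows "(\<integral>\<^sup>+x. indicator \<Omega> x * (ennreal ((cmod (v x))\<^sup>2) + ennreal r * ennreal (2 * cmod (v x) * G x)) \<partial>lborel)
    \<le> ennreal ((1 + r * k) * mass_sq v + r / k * CARD('n) * grad_sq v)"
proof -
  define S where "S x = (\<Sum>i\<in>UNIV. (cmod (grad v x $ i))\<^sup>2)" for x
  define h where "h x = (1 + r * k) * (cmod (v x))\<^sup>2 + r / k * CARD('n) * S x" for x
  have S0: "0 \<le> S x" for x by (simp add: S_def sum_nonneg)
  have h0: "0 \<le> h x" for x using S0 r k by (simp add: h_def)
  have h_int: "h absolutely_integrable_on \<Omega>"
    unfolding h_def S_def using integrable_sq[OF v] integrable_grad_sq[OF v]
    by (intro set_integral_add set_integrable_mult_right) auto
  have "AE x in lebesgue. x \<notin> skeleton"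
    using negligible_skeleton by (intro AE_not_in) (simp add: negligible_iff_null_sets)
  then have AE: "AE x in lborel. x \<notin> skeleton" by (simp add: AE_completion_iff)
  have pt: "(cmod (v x))\<^sup>2 + r * (2 * cmod (v x) * G x) \<le> h x" if "x \<in> \<Omega>" "x \<notin> skeleton" for x
  proof -
    have "(G x)\<^sup>2 \<le> CARD('n) * S x"
      unfolding G(2)[OF that] S_def
      using sum_squared_le_sum_of_squares[of "\<lambda>i. cmod (grad v x $ i)" "UNIV :: 'n set"] by (simp add: mult.commute)
    moreover have "2 * cmod (v x) * G x \<le> k * (cmod (v x))\<^sup>2 + (G x)\<^sup>2 / k"
    proof -
      have "0 \<le> (k * cmod (v x) - G x)\<^sup>2 / k" using k by simp
      also have "\<dots> = k * (cmod (v x))\<^sup>2 + (G x)\<^sup>2 / k - 2 * cmod (v x) * G x"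
        using k by (simp add: field_simps power2_eq_square)
      finally show ?thesis by simp
    qed
    ultimately have "2 * cmod (v x) * G x \<le> k * (cmod (v x))\<^sup>2 + CARD('n) * S x / k"
      using divide_right_mono[of "(G x)\<^sup>2" "CARD('n) * S x" k] k by linarith
    from mult_left_mono[OF this, of r] r
    show ?thesis by (simp add: h_def algebra_simps)
  qed
  have "(\<integral>\<^sup>+x. indicator \<Omega> x * (ennreal ((cmod (v x))\<^sup>2) + ennreal r * ennreal (2 * cmod (v x) * G x)) \<partial>lborel)
      \<le> (\<integral>\<^sup>+x. indicator \<Omega> x * ennreal (h x) \<partial>lborel)"
  proof (rule nn_integral_mono_AE)
    show "AE x in lborel. indicator \<Omega> x * (ennreal ((cmod (v x))\<^sup>2) + ennreal r * ennreal (2 * cmod (v x) * G x))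
        \<le> indicator \<Omega> x * ennreal (h x)"
      using AE
    proof eventually_elim
      case (elim x)
      show ?case
      proof (cases "x \<in> \<Omega>")
        case True
        have "ennreal ((cmod (v x))\<^sup>2) + ennreal r * ennreal (2 * cmod (v x) * G x)
            = ennreal ((cmod (v x))\<^sup>2 + r * (2 * cmod (v x) * G x))"
          using r G(1)[of x] by (simp flip: ennreal_plus ennreal_mult)
        also have "\<dots> \<le> ennreal (h x)" using pt[OF True elim] by (rule ennreal_leI)
        finally show ?thesis using True by simp
      qed simp
    qed
  qed
  also have "\<dots> = ennreal (LINT x:\<Omega>|lebesgue. h x)"
    by (rule set_nn_integral_eq_lborel[OF h_int h0])
  also have "(LINT x:\<Omega>|lebesgue. h x) = (1 + r * k) * mass_sq v + r / k * CARD('n) * grad_sq v"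
    unfolding h_def S_def mass_sq_def grad_sq_def
    using integrable_sq[OF v] integrable_grad_sq[OF v]
    by (subst set_integral_add) (auto intro!: set_integrable_mult_right)
  finally show ?thesis .
qed

lemma trace_inequality_atlas:
  assumes X: "finite X" "frontier \<Omega> \<subseteq> (\<Union>x\<in>X. ball x (r x))"
    and r: "\<And>x. x \<in> X \<Longrightarrow> 0 < r x" "\<And>x. x \<in> X \<Longrightarrow> ball x (2 * r x) \<subseteq> U x"
    and chart: "\<And>x. x \<in> X \<Longrightarrow> boundary_chart \<Omega> (U x) (e x) (\<Phi> x) (L x)"
    and v: "v \<in> Vh" and k: "0 < k0" "k0 \<le> k"
  shows "k * bdry_sq v \<le> (\<Sum>x\<in>X. sqrt (1 + (L x)\<^sup>2) * (1 + 1 / (r x * k0) + CARD('n))) * (norm_1k \<Omega> k v)\<^sup>2"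
proof -
  obtain G where G: "G \<in> borel_measurable borel" "\<And>x. 0 \<le> G x"
    "\<And>x. x \<in> \<Omega> \<Longrightarrow> x \<notin> skeleton \<Longrightarrow> G x = (\<Sum>i\<in>UNIV. cmod (grad v x $ i))"
    "\<And>y e s. norm e = 1 \<Longrightarrow> 0 \<le> s \<Longrightarrow> \<forall>r\<in>{0..s}. y + r *\<^sub>R e \<in> closure \<Omega> \<Longrightarrow>
      ennreal ((cmod (v y))\<^sup>2) \<le> ennreal ((cmod (v (y + s *\<^sub>R e)))\<^sup>2)
        + (\<integral>\<^sup>+r. indicator {0..s} r * ennreal (2 * cmod (v (y + r *\<^sub>R e)) * G (y + r *\<^sub>R e)) \<partial>lborel)"
    by (rule gradient_majorant[OF v]) (rule that)
  have k': "0 < k" using k by linarith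
  define Q where "Q x = (1 + r x * k) * mass_sq v + r x / k * CARD('n) * grad_sq v" for x
  define K where "K x = sqrt (1 + (L x)\<^sup>2)" for x
  have K0: "0 \<le> K x" for x by (simp add: K_def)
  have Q0: "0 \<le> Q x" if "x \<in> X" for x
    using r(1)[OF that] k' mass_sq_nonneg grad_sq_nonneg by (simp add: Q_def)
  define S where "S x = (\<Sum>F\<in>boundary_faces. \<integral>\<^sup>+y. indicator (face_prism F) y * indicator (ball x (r x)) (face_proj F y)
            * ennreal ((cmod (v (face_proj F y)))\<^sup>2) \<partial>lborel)" for x
  have S: "S x \<le> ennreal (K x / r x * Q x)" if x: "x \<in> X" for x
  proof -
    have rx: "0 < r x" using r(1) x .
    have "ennreal (r x) * S x \<le> ennreal (K x) * (\<integral>\<^sup>+y. indicator \<Omega> y *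
            (ennreal ((cmod (v y))\<^sup>2) + ennreal (r x) * ennreal (2 * cmod (v y) * G y)) \<partial>lborel)"
      unfolding S_def K_def by (rule chart_trace_bound[OF chart[OF x] rx r(2)[OF x] v G(1)]) (rule G(4))
    also have "\<dots> \<le> ennreal (K x) * ennreal (Q x)"
      unfolding Q_def by (intro mult_left_mono trace_volume_bound[OF v rx k' G(2,3)]) auto
    finally have "ennreal (r x) * S x \<le> ennreal (K x) * ennreal (Q x)" .
    from mult_left_mono[OF this, of "ennreal (1 / r x)"]
    have "(ennreal (1 / r x) * ennreal (r x)) * S x \<le> ennreal (1 / r x) * (ennreal (K x) * ennreal (Q x))"
      by (simp only: mult.assoc) simp
    then show ?thesis using rx K0[of x] Q0[OF x] by (simp flip: ennreal_mult)
  qed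
  have "ennreal (bdry_sq v) \<le> (\<Sum>x\<in>X. S x)"
  proof -
    have "ennreal (bdry_sq v) \<le> (\<Sum>F\<in>boundary_faces. \<integral>\<^sup>+y. (\<Sum>x\<in>X. indicator (face_prism F) y * indicator (ball x (r x)) (face_proj F y)
            * ennreal ((cmod (v (face_proj F y)))\<^sup>2)) \<partial>lborel)"
      unfolding bdry_sq_eq_nn_integral[OF v]
    proof (intro sum_mono nn_integral_mono)
      fix F y assume F: "F \<in> boundary_faces"
      let ?c = "ennreal ((cmod (v (face_proj F y)))\<^sup>2)"
      show "indicator (face_prism F) y * ?c \<le> (\<Sum>x\<in>X. indicator (face_prism F) y * indicator (ball x (r x)) (face_proj F y) * ?c)"
      proof (cases "y \<in> face_prism F")
        case True
        then have "face_proj F y \<in> frontier \<Omega>"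
          using boundary_face(5)[OF F] face_prism_eq[OF boundary_face(6)[OF F]] by blast
        then have "\<exists>x\<in>X. face_proj F y \<in> ball x (r x)" using X(2) by blast
        from sum_ge_of_covering[OF X(1) this, of ?c] True show ?thesis by simp
      qed simp
    qed
    also have "\<dots> = (\<Sum>F\<in>boundary_faces. \<Sum>x\<in>X. \<integral>\<^sup>+y. indicator (face_prism F) y * indicator (ball x (r x)) (face_proj F y)
            * ennreal ((cmod (v (face_proj F y)))\<^sup>2) \<partial>lborel)"
    proof (intro sum.cong refl nn_integral_sum)
      fix F x assume F: "F \<in> boundary_faces"
      have fp: "face_proj F \<in> borel_measurable borel"
        using continuous_face_proj by (rule borel_measurable_continuous_onI)
      have [measurable]: "face_prism F \<in> sets borel"
        by (intro borel_closed compact_imp_closed compact_face_prism boundary_face(1)[OF F])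
      have [measurable]: "(\<lambda>y. indicator (ball x (r x)) (face_proj F y) :: ennreal) \<in> borel_measurable borel"
        by (rule measurable_compose[OF fp]) (intro borel_measurable_indicator borel_open open_ball)
      have [measurable]: "(\<lambda>y. v (face_proj F y)) \<in> borel_measurable borel"
        by (rule measurable_compose[OF fp P1_borel[OF v]])
      show "(\<lambda>y. indicator (face_prism F) y * indicator (ball x (r x)) (face_proj F y)
            * ennreal ((cmod (v (face_proj F y)))\<^sup>2)) \<in> borel_measurable lborel"
        by measurable
    qed
    also have "\<dots> = (\<Sum>x\<in>X. S x)" unfolding S_def by (rule sum.swap)
    finally show ?thesis .
  qed
  also have "\<dots> \<le> (\<Sum>x\<in>X. ennreal (K x / r x * Q x))" by (rule sum_mono[OF S])
  also have "\<dots> = ennreal (\<Sum>x\<in>X. K x / r x * Q x)"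
    using r(1) K0 Q0 by (intro sum_ennreal mult_nonneg_nonneg divide_nonneg_pos) auto
  finally have "bdry_sq v \<le> (\<Sum>x\<in>X. K x / r x * Q x)"
    by (rule ennreal_le_iff[THEN iffD1, rotated])
      (use r(1) K0 Q0 in \<open>intro sum_nonneg mult_nonneg_nonneg divide_nonneg_pos, auto\<close>)
  then have "k * bdry_sq v \<le> (\<Sum>x\<in>X. k * (K x / r x * Q x))"
    unfolding sum_distrib_left[symmetric] using k' by (intro mult_left_mono) auto
  also have "\<dots> \<le> (\<Sum>x\<in>X. K x * (1 + 1 / (r x * k0) + CARD('n)) * (norm_1k \<Omega> k v)\<^sup>2)"
  proof (rule sum_mono)
    fix x assume x: "x \<in> X"
    have rx: "0 < r x" using r(1) x .
    have "k * (1 / r x * Q x) = (k / r x + k\<^sup>2) * mass_sq v + CARD('n) * grad_sq v"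
      using rx k' by (simp add: Q_def field_simps power2_eq_square)
    also have "\<dots> \<le> (1 + 1 / (r x * k0)) * (k\<^sup>2 * mass_sq v) + CARD('n) * grad_sq v"
    proof -
      \<comment> \<open>The lower bound on \<open>k\<close> absorbs the lower-order mass term into
        the leading one and produces \<open>1 / (r x * k0)\<close> in the constant.\<close>
      have "k / r x \<le> k\<^sup>2 / (r x * k0)"
        using rx k k' by (simp add: field_simps power2_eq_square)
      then have "k / r x + k\<^sup>2 \<le> (1 + 1 / (r x * k0)) * k\<^sup>2" by (simp add: algebra_simps)
      from mult_right_mono[OF this mass_sq_nonneg[of v]] show ?thesis by (simp add: mult.assoc)
    qed
    also have "\<dots> \<le> (1 + 1 / (r x * k0) + CARD('n)) * (k\<^sup>2 * mass_sq v) + (1 + 1 / (r x * k0) + CARD('n)) * grad_sq v"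
      using rx k by (intro add_mono[OF mult_right_mono mult_right_mono])
        (simp_all add: mass_sq_nonneg grad_sq_nonneg)
    also have "\<dots> = (1 + 1 / (r x * k0) + CARD('n)) * (norm_1k \<Omega> k v)\<^sup>2"
      by (simp add: norm_1k_sq algebra_simps)
    finally have "k * (1 / r x * Q x) \<le> (1 + 1 / (r x * k0) + CARD('n)) * (norm_1k \<Omega> k v)\<^sup>2" .
    from mult_left_mono[OF this K0[of x]]
    show "k * (K x / r x * Q x) \<le> K x * (1 + 1 / (r x * k0) + CARD('n)) * (norm_1k \<Omega> k v)\<^sup>2"
      by (simp add: mult_ac)
  qed
  finally show ?thesis by (simp add: K_def sum_distrib_right)
qed

end

text \<open>The order of quantifiers is the point: \<open>C\<close> is built from an atlas of
  \<open>\<Omega>\<close> and from \<open>k0\<close> before the mesh, the function and the wave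
  number are given.\<close>

lemma trace_inequality:
  fixes \<Omega> :: "(real^'n) set"
  assumes \<Omega>: "lipschitz_domain \<Omega>" and k0: "0 < k0"
  shows "\<exists>C. \<forall>\<sigma> \<T> v k. sr_mesh \<sigma> \<T> (closure \<Omega>) \<longrightarrow> v \<in> P1 \<T> (closure \<Omega>) \<longrightarrow> k0 \<le> k \<longrightarrow>
    k * fe_mesh.bdry_sq \<T> \<Omega> v \<le> C * (norm_1k \<Omega> k v)\<^sup>2"
proof -
  obtain X r U e \<Phi> L where atlas: "finite X" "frontier \<Omega> \<subseteq> (\<Union>x\<in>X. ball x (r x))"
    "\<And>x. x \<in> X \<Longrightarrow> 0 < r x" "\<And>x. x \<in> X \<Longrightarrow> ball x (2 * r x) \<subseteq> U x"
    "\<And>x. x \<in> X \<Longrightarrow> boundary_chart \<Omega> (U x) (e x) (\<Phi> x) (L x)"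
    by (rule lipschitz_domain_atlas[OF \<Omega>]) (rule that)
  show ?thesis
  proof (rule exI[of _ "\<Sum>x\<in>X. sqrt (1 + (L x)\<^sup>2) * (1 + 1 / (r x * k0) + CARD('n))"], intro allI impI)
    fix \<sigma> \<T> v k
    assume mesh: "sr_mesh \<sigma> \<T> (closure \<Omega>)" and v: "v \<in> P1 \<T> (closure \<Omega>)" and k: "k0 \<le> k"
    interpret fe_mesh \<sigma> \<T> \<Omega>
      using mesh \<Omega> by unfold_locales (auto simp: lipschitz_domain_def)
    show "k * bdry_sq v \<le> (\<Sum>x\<in>X. sqrt (1 + (L x)\<^sup>2) * (1 + 1 / (r x * k0) + CARD('n))) * (norm_1k \<Omega> k v)\<^sup>2"
      by (rule trace_inequality_atlas[OF atlas v k0 k])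
  qed
qed

section \<open>Finite overlap and the main estimate\<close>

text \<open>Cauchy-Schwarz over the nonzero terms only, so the constant counts active indices rather
  than all of \<open>I\<close>.\<close>

lemma cmod_sum_sq_le:
  fixes a :: "'i \<Rightarrow> complex"
  assumes "finite I" "card {i\<in>I. a i \<noteq> 0} \<le> M"
  shows "(cmod (\<Sum>i\<in>I. a i))\<^sup>2 \<le> M * (\<Sum>i\<in>I. (cmod (a i))\<^sup>2)"
proof -
  define J where "J = {i\<in>I. a i \<noteq> 0}"
  have "(\<Sum>i\<in>I. a i) = (\<Sum>i\<in>J. a i)"
    using assms(1) by (intro sum.mono_neutral_right) (auto simp: J_def)
  then have "cmod (\<Sum>i\<in>I. a i) \<le> (\<Sum>i\<in>J. cmod (a i))" by (simp add: sum_norm_le)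
  then have "(cmod (\<Sum>i\<in>I. a i))\<^sup>2 \<le> (\<Sum>i\<in>J. cmod (a i))\<^sup>2" by (intro power_mono) auto
  also have "\<dots> \<le> (\<Sum>i\<in>J. (cmod (a i))\<^sup>2) * card J" by (rule sum_squared_le_sum_of_squares)
  also have "\<dots> \<le> (\<Sum>i\<in>I. (cmod (a i))\<^sup>2) * M"
    using assms by (intro mult_mono sum_mono2 sum_nonneg) (auto simp: J_def)
  finally show ?thesis by (simp add: mult.commute)
qed

lemma set_integral_sum:
  fixes f :: "'i \<Rightarrow> 'a \<Rightarrow> 'b::{banach, second_countable_topology}"
  assumes "\<And>i. i \<in> I \<Longrightarrow> set_integrable M A (f i)"
  shows "(LINT x:A|M. \<Sum>i\<in>I. f i x) = (\<Sum>i\<in>I. LINT x:A|M. f i x)"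
  using assms unfolding set_lebesgue_integral_def set_integrable_def scaleR_sum_right
  by (rule Bochner_Integration.integral_sum)

context fe_mesh
begin

text \<open>An interior point of a fine element \<open>T\<close> lies in some coarse
  \<open>K\<close>. As \<open>K\<close> is a union of fine elements, one of them contains that point
  and must be \<open>T\<close>; so \<open>T\<close> lies within a single coarse element.\<close>

lemma coarse_P1_subset:
  assumes coarse: "sr_mesh \<sigma>' \<T>H (closure \<Omega>)" "\<forall>K\<in>\<T>H. \<exists>S\<subseteq>\<T>. K = \<Union>S"
  shows "P1 \<T>H (closure \<Omega>) \<subseteq> Vh"
proof
  fix v assume v: "v \<in> P1 \<T>H (closure \<Omega>)"
  have "\<exists>c g. \<forall>x\<in>T. v x = c + (\<Sum>i\<in>UNIV. g i * complex_of_real (x $ i))" if T: "T \<in> \<T>" for T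
  proof -
    obtain x where x: "x \<in> interior T" using mesh_interior[OF T] by blast
    then have "x \<in> closure \<Omega>" using mesh_subset[OF T] interior_subset by blast
    moreover have "\<Union>\<T>H = closure \<Omega>" using coarse(1) by (simp add: sr_mesh_def)
    ultimately have "x \<in> \<Union>\<T>H" by simp
    then obtain K where K: "K \<in> \<T>H" "x \<in> K" by blast
    from bspec[OF coarse(2) K(1)] K(2) obtain S T' where S: "S \<subseteq> \<T>" "K = \<Union>S" "T' \<in> S" "x \<in> T'"
      by blast
    then have "T' = T" using interior_unique[OF T _ x] by blast
    then have "T \<subseteq> K" using S by blast
    moreover have "\<exists>c g. \<forall>x\<in>K. v x = c + (\<Sum>i\<in>UNIV. g i * complex_of_real (x $ i))"
      using v K(1) unfolding P1_def by blast
    ultimately show ?thesis by blast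
  qed
  then show "v \<in> Vh" using v unfolding P1_def by blast
qed

text \<open>Supports live in closures, whereas the overlap count concerns the subdomains themselves.
  Two density arguments bridge the gap: first a point of \<open>Om2\<close> is found near
  \<open>x\<close>, then its neighbourhood \<open>O2\<close> is seen to meet
  \<open>Om1\<close>.\<close>

lemma subdomains_meet:
  assumes Om: "Om1 = O1 \<inter> closure \<Omega>" "Om2 = O2 \<inter> closure \<Omega>" "open O2"
    and x: "x \<in> interior (closure Om1)" "x \<in> interior (closure Om2)"
  shows "Om1 \<inter> Om2 \<noteq> {}"
proof -
  let ?W = "interior (closure Om1) \<inter> interior (closure Om2)"
  have "?W \<inter> closure Om2 \<noteq> {}" using x interior_subset by blast
  then have "?W \<inter> Om2 \<noteq> {}" using open_Int_closure_eq_empty[of ?W Om2] by blast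
  then obtain y where y: "y \<in> interior (closure Om1)" "y \<in> Om2" by blast
  then have "O2 \<inter> closure Om1 \<noteq> {}" using Om(2) interior_subset by blast
  then have "O2 \<inter> Om1 \<noteq> {}" using open_Int_closure_eq_empty[OF Om(3)] by blast
  then show ?thesis using Om by blast
qed

text \<open>Off the skeleton the bound is pointwise: at most \<open>1 + Cov\<close> of the functions
  are active at a point, the 1 being the coarse one. The same count serves the gradients, which
  vanish outside the closed supports.\<close>

lemma norm_1k_sum_le:
  fixes w :: "nat \<Rightarrow> real^'n \<Rightarrow> complex"
  assumes Om: "\<And>l. l \<in> {1..N} \<Longrightarrow> open (Omt l)" "\<And>l. l \<in> {1..N} \<Longrightarrow> Om l = Omt l \<inter> closure \<Omega>"
    "\<And>l. l \<in> {1..N} \<Longrightarrow> \<exists>S\<subseteq>\<T>. closure (Om l) = \<Union>S"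
    and Cov: "\<And>l. l \<in> {1..N} \<Longrightarrow> card {l'\<in>{1..N}. Om l \<inter> Om l' \<noteq> {}} \<le> Cov"
    and w: "\<And>l. l \<le> N \<Longrightarrow> w l \<in> Vh"
    and supp: "\<And>l. l \<in> {1..N} \<Longrightarrow> closure {x. w l x \<noteq> 0} \<subseteq> closure (Om l)"
  shows "(norm_1k \<Omega> k (\<lambda>x. \<Sum>l\<le>N. w l x))\<^sup>2 \<le> (1 + real Cov) * (\<Sum>l\<le>N. (norm_1k \<Omega> k (w l))\<^sup>2)"
proof -
  have W: "(\<lambda>x. \<Sum>l\<le>N. w l x) \<in> Vh" using w by (intro P1_sum) auto
  have active: "card A \<le> 1 + Cov"
    if x: "x \<in> \<Omega>" "x \<notin> skeleton" and A: "A \<subseteq> {..N}" "\<And>l. l \<in> A \<Longrightarrow> x \<in> closure {y. w l y \<noteq> 0}" for x A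
  proof -
    have int: "x \<in> interior (closure (Om l))" if l: "l \<in> A - {0}" for l
    proof -
      have l': "l \<in> {1..N}" using A(1) l by auto
      then have "x \<in> closure (Om l)" using supp A(2) l by blast
      moreover obtain S where S: "S \<subseteq> \<T>" "closure (Om l) = \<Union>S" using Om(3)[OF l'] by blast
      ultimately obtain T where T: "T \<in> S" "x \<in> T" by blast
      then have "x \<notin> frontier T" using x(2) S(1) unfolding skeleton_def by blast
      then have "x \<in> interior T" using T S(1) mesh_closed by (auto simp: frontier_def)
      moreover have "T \<subseteq> closure (Om l)" using S T by blast
      ultimately show ?thesis using interior_mono by blast
    qed
    have fin: "finite A" using A(1) finite_subset by blast
    \<comment> \<open>Every active subdomain contains \<open>x\<close> in the interior of its
      closure, hence meets one fixed active subdomain; the overlap count of that one bounds them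
      all.\<close>
    have "card (A - {0}) \<le> Cov"
    proof (cases "A - {0} = {}")
      case False
      then obtain l0 where l0: "l0 \<in> A - {0}" by blast
      then have l0': "l0 \<in> {1..N}" using A(1) by auto
      have "A - {0} \<subseteq> {l'\<in>{1..N}. Om l0 \<inter> Om l' \<noteq> {}}"
      proof
        fix l assume l: "l \<in> A - {0}"
        then have l': "l \<in> {1..N}" using A(1) by auto
        have "Om l0 \<inter> Om l \<noteq> {}"
          by (rule subdomains_meet[OF Om(2)[OF l0'] Om(2)[OF l'] Om(1)[OF l'] int[OF l0] int[OF l]])
        then show "l \<in> {l'\<in>{1..N}. Om l0 \<inter> Om l' \<noteq> {}}" using l' by blast
      qed
      then have "card (A - {0}) \<le> card {l'\<in>{1..N}. Om l0 \<inter> Om l' \<noteq> {}}"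
        by (intro card_mono) auto
      then show ?thesis using Cov[OF l0'] by linarith
    qed (simp only: card.empty)
    moreover have "card A \<le> card (A - {0}) + 1"
      using card_Diff1_le[of A 0] fin by (cases "0 \<in> A") (auto simp: card_Diff_singleton)
    ultimately show ?thesis by linarith
  qed
  have pt: "(cmod (\<Sum>l\<le>N. w l x))\<^sup>2 \<le> (1 + real Cov) * (\<Sum>l\<le>N. (cmod (w l x))\<^sup>2)"
      "(\<Sum>i\<in>UNIV. (cmod (grad (\<lambda>x. \<Sum>l\<le>N. w l x) x $ i))\<^sup>2)
        \<le> (1 + real Cov) * (\<Sum>l\<le>N. \<Sum>i\<in>UNIV. (cmod (grad (w l) x $ i))\<^sup>2)"
    if x: "x \<in> \<Omega>" "x \<notin> skeleton" for x
  proof -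
    have "card {l\<in>{..N}. w l x \<noteq> 0} \<le> 1 + Cov"
    proof (rule active[OF x])
      fix l assume "l \<in> {l\<in>{..N}. w l x \<noteq> 0}"
      then have "x \<in> {y. w l y \<noteq> 0}" by simp
      then show "x \<in> closure {y. w l y \<noteq> 0}" by (rule subsetD[OF closure_subset])
    qed blast
    from cmod_sum_sq_le[OF _ this]
    show "(cmod (\<Sum>l\<le>N. w l x))\<^sup>2 \<le> (1 + real Cov) * (\<Sum>l\<le>N. (cmod (w l x))\<^sup>2)" by simp
    have xc: "x \<in> closure \<Omega>" using x(1) closure_subset by blast
    have "(cmod (grad (\<lambda>x. \<Sum>l\<le>N. w l x) x $ i))\<^sup>2 \<le> (1 + real Cov) * (\<Sum>l\<le>N. (cmod (grad (w l) x $ i))\<^sup>2)" for i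
    proof -
      have "card {l\<in>{..N}. grad (w l) x $ i \<noteq> 0} \<le> 1 + Cov"
      proof (rule active[OF x])
        fix l assume "l \<in> {l\<in>{..N}. grad (w l) x $ i \<noteq> 0}"
        then show "x \<in> closure {y. w l y \<noteq> 0}"
          using grad_eq_0_outside_support[of x "w l"] by (cases "x \<in> closure {y. w l y \<noteq> 0}") simp_all
      qed blast
      from cmod_sum_sq_le[OF _ this] show ?thesis
        using grad_sum[OF _ _ xc x(2), of "{..N}" w "closure \<Omega>" i] w by simp
    qed
    then have "(\<Sum>i\<in>UNIV. (cmod (grad (\<lambda>x. \<Sum>l\<le>N. w l x) x $ i))\<^sup>2)
        \<le> (\<Sum>i\<in>UNIV. (1 + real Cov) * (\<Sum>l\<le>N. (cmod (grad (w l) x $ i))\<^sup>2))" by (rule sum_mono)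
    also have "\<dots> = (1 + real Cov) * (\<Sum>l\<le>N. \<Sum>i\<in>UNIV. (cmod (grad (w l) x $ i))\<^sup>2)"
      unfolding sum_distrib_left[symmetric] by (subst sum.swap) (rule refl)
    finally show "(\<Sum>i\<in>UNIV. (cmod (grad (\<lambda>x. \<Sum>l\<le>N. w l x) x $ i))\<^sup>2)
        \<le> (1 + real Cov) * (\<Sum>l\<le>N. \<Sum>i\<in>UNIV. (cmod (grad (w l) x $ i))\<^sup>2)" .
  qed
  have AE: "AE x in lebesgue. x \<notin> skeleton"
    using negligible_skeleton by (intro AE_not_in) (simp add: negligible_iff_null_sets)
  have "mass_sq (\<lambda>x. \<Sum>l\<le>N. w l x) \<le> (LINT x:\<Omega>|lebesgue. (1 + real Cov) * (\<Sum>l\<le>N. (cmod (w l x))\<^sup>2))"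
    unfolding mass_sq_def
  proof (rule set_integral_mono_AE[OF integrable_sq[OF W]])
    show "(\<lambda>x. (1 + real Cov) * (\<Sum>l\<le>N. (cmod (w l x))\<^sup>2)) absolutely_integrable_on \<Omega>"
      using integrable_sq w by (intro set_integrable_mult_right absolutely_integrable_sum) auto
    show "AE x\<in>\<Omega> in lebesgue. (cmod (\<Sum>l\<le>N. w l x))\<^sup>2 \<le> (1 + real Cov) * (\<Sum>l\<le>N. (cmod (w l x))\<^sup>2)"
      using AE by eventually_elim (use pt(1) in blast)
  qed
  also have "\<dots> = (1 + real Cov) * (\<Sum>l\<le>N. mass_sq (w l))"
    unfolding mass_sq_def set_integral_mult_right
    using integrable_sq w by (subst set_integral_sum) auto
  finally have mass: "mass_sq (\<lambda>x. \<Sum>l\<le>N. w l x) \<le> (1 + real Cov) * (\<Sum>l\<le>N. mass_sq (w l))" .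
  have "grad_sq (\<lambda>x. \<Sum>l\<le>N. w l x)
      \<le> (LINT x:\<Omega>|lebesgue. (1 + real Cov) * (\<Sum>l\<le>N. \<Sum>i\<in>UNIV. (cmod (grad (w l) x $ i))\<^sup>2))"
    unfolding grad_sq_def
  proof (rule set_integral_mono_AE[OF integrable_grad_sq[OF W]])
    show "(\<lambda>x. (1 + real Cov) * (\<Sum>l\<le>N. \<Sum>i\<in>UNIV. (cmod (grad (w l) x $ i))\<^sup>2)) absolutely_integrable_on \<Omega>"
      using w by (intro set_integrable_mult_right absolutely_integrable_sum[OF finite_atMost] integrable_grad_sq) auto
    show "AE x\<in>\<Omega> in lebesgue. (\<Sum>i\<in>UNIV. (cmod (grad (\<lambda>x. \<Sum>l\<le>N. w l x) x $ i))\<^sup>2)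
        \<le> (1 + real Cov) * (\<Sum>l\<le>N. \<Sum>i\<in>UNIV. (cmod (grad (w l) x $ i))\<^sup>2)"
      using AE by eventually_elim (use pt(2) in blast)
  qed
  also have "\<dots> = (1 + real Cov) * (\<Sum>l\<le>N. grad_sq (w l))"
    unfolding grad_sq_def set_integral_mult_right
    using integrable_grad_sq w by (subst set_integral_sum) auto
  finally have "grad_sq (\<lambda>x. \<Sum>l\<le>N. w l x) \<le> (1 + real Cov) * (\<Sum>l\<le>N. grad_sq (w l))" .
  from add_mono[OF this mult_left_mono[OF mass zero_le_power2[of k]]]
  show ?thesis by (simp add: norm_1k_sq sum.distrib distrib_left mult.left_commute flip: sum_distrib_left)
qed

lemma norm_Q_eps_le:
  assumes setting: "dd_setting \<sigma>' Cov c\<delta> cv Cv cs Cs cb Cb \<Omega> \<T> \<T>H N Omt Om \<delta>"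
    and k: "0 < k" and \<epsilon>0: "\<epsilon> \<noteq> 0" and \<epsilon>: "\<bar>\<epsilon>\<bar> \<le> Ce * k\<^sup>2" and \<eta>: "cmod \<eta> \<le> Ch * k"
    and sign: "0 \<le> Re (cnj (z_of k \<epsilon>) * \<eta>)"
    and trace: "\<And>w. w \<in> Vh \<Longrightarrow> k * bdry_sq w \<le> Ct * (norm_1k \<Omega> k w)\<^sup>2"
    and v: "v \<in> Vh"
  shows "norm_1k \<Omega> k (Q_eps \<T> \<T>H \<Omega> Om N k \<epsilon> \<eta> v)
    \<le> 4 * (1 + \<bar>Ce\<bar> + \<bar>Ch\<bar> * \<bar>Ct\<bar>) * (1 + real Cov) * (1 + \<bar>Ce\<bar>) * (k\<^sup>2 / \<bar>\<epsilon>\<bar>) * norm_1k \<Omega> k v"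
proof -
  let ?a = "a_eps \<T> \<Omega> k \<epsilon> \<eta>" and ?V = "Vloc \<T> \<T>H \<Omega> Om" and ?N = "norm_1k \<Omega> k"
  define \<theta> where "\<theta> = - cnj (z_of k \<epsilon>) / of_real (cmod (z_of k \<epsilon>))"
  define \<alpha> where "\<alpha> = \<bar>\<epsilon>\<bar> / (2 * (1 + Ce) * k\<^sup>2)"
  define C where "C = 1 + \<bar>Ce\<bar> + \<bar>Ch\<bar> * \<bar>Ct\<bar>"
  interpret sesquilinear_on Vh ?a by (rule sesquilinear_a_eps)
  \<comment> \<open>A nonzero \<open>\<epsilon>\<close> within the bound forces the constant to be
    positive, which makes \<open>\<alpha>\<close> positive.\<close>
  have "0 < Ce * k\<^sup>2" using \<epsilon> \<epsilon>0 by linarith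
  then have Ce: "0 < Ce" using k by (simp add: zero_less_mult_iff)
  have \<alpha>: "0 < \<alpha>" using Ce k \<epsilon>0 by (simp add: \<alpha>_def)
  have C: "0 < C" by (simp add: C_def add_pos_nonneg)
  have coercive: "\<alpha> * (?N u)\<^sup>2 \<le> Im (\<theta> * ?a u u)" for u
    unfolding \<alpha>_def \<theta>_def by (rule a_eps_coercive[OF k \<epsilon>0 \<epsilon> sign])
  have V_sub: "?V l \<subseteq> Vh" for l
    using coarse_P1_subset[of \<sigma>' \<T>H] setting unfolding dd_setting_def Vloc_def by auto
  obtain X where X: "finite X" "\<And>v. v \<in> Vh \<Longrightarrow> (\<And>x. x \<in> X \<Longrightarrow> v x = 0) \<Longrightarrow> v = (\<lambda>x. 0)"
    using P1_separated by metis
  define w where "w l = proj_a ?a (?V l) v" for l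
  have w: "w l \<in> ?V l \<and> (\<forall>\<phi>\<in>?V l. ?a (w l) \<phi> = ?a v \<phi>)" for l
    unfolding w_def
  proof (rule proj_a_works[OF X(1) V_sub])
    show "(\<lambda>x. 0) \<in> ?V l" by (simp add: Vloc_def P1_zero)
    show "(\<lambda>x. u x + u' x) \<in> ?V l" if "u \<in> ?V l" "u' \<in> ?V l" for u u'
    proof (cases "l = 0")
      case False
      have "{x. u x + u' x \<noteq> 0} \<subseteq> {x. u x \<noteq> 0} \<union> {x. u' x \<noteq> 0}" by auto
      then have "closure {x. u x + u' x \<noteq> 0} \<subseteq> closure {x. u x \<noteq> 0} \<union> closure {x. u' x \<noteq> 0}"
        unfolding closure_Un[symmetric] by (rule closure_mono)
      moreover have "(\<lambda>x. u x + u' x) \<in> Vh" using that V_sub by (blast intro: P1_add)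
      ultimately show ?thesis using that False unfolding Vloc_def by simp blast
    qed (use that in \<open>simp add: Vloc_def P1_add\<close>)
    show "(\<lambda>x. c * u x) \<in> ?V l" if "u \<in> ?V l" for u c
    proof (cases "l = 0")
      case False
      have "{x. c * u x \<noteq> 0} \<subseteq> {x. u x \<noteq> 0}" by auto
      then have "closure {x. c * u x \<noteq> 0} \<subseteq> closure {x. u x \<noteq> 0}" by (rule closure_mono)
      moreover have "(\<lambda>x. c * u x) \<in> Vh" using that V_sub by (blast intro: P1_scale)
      ultimately show ?thesis using that False unfolding Vloc_def by (simp del: mult_eq_0_iff) blast
    qed (use that in \<open>simp add: Vloc_def P1_scale\<close>)
    show "u = (\<lambda>x. 0)" if "u \<in> ?V l" "\<And>x. x \<in> X \<Longrightarrow> u x = 0" for u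
      using X(2) that V_sub by blast
    show "u = (\<lambda>x. 0)" if "u \<in> ?V l" "?a u u = 0" for u
    proof -
      have "\<alpha> * (?N u)\<^sup>2 \<le> 0" using coercive[of u] that(2) by simp
      then have "?N u = 0" using \<alpha> by (simp add: mult_le_0_iff)
      then show ?thesis using norm_1k_eq_0[OF _ _ k] that(1) V_sub by blast
    qed
  qed (rule v)
  have wV: "w l \<in> Vh" for l using w V_sub by blast
  have "?N (\<lambda>x. \<Sum>l\<le>N. w l x) \<le> 2 * C * (1 + real Cov) / \<alpha> * ?N v"
  proof (rule norm_sum_projections_le[where \<theta> = \<theta>])
    show "?a (w l) (w l) = ?a v (w l)" for l using w by blast
    show "cmod (?a u u') \<le> C * ((?N u)\<^sup>2 + (?N u')\<^sup>2)" if "u \<in> Vh" "u' \<in> Vh" for u u'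
      unfolding C_def by (rule a_eps_bounded[OF that \<epsilon> \<eta> k trace])
    show "cmod \<theta> \<le> 1" by (simp add: \<theta>_def norm_divide)
    show "(?N (\<lambda>x. \<Sum>l\<le>N. w l x))\<^sup>2 \<le> (1 + real Cov) * (\<Sum>l\<le>N. (?N (w l))\<^sup>2)"
    proof (rule norm_1k_sum_le)
      fix l assume l: "l \<in> {1..N}"
      have D: "open (Omt l) \<and> Om l = Omt l \<inter> closure \<Omega> \<and> (\<exists>S\<subseteq>\<T>. S \<noteq> {} \<and> closure (Om l) = \<Union>S)
          \<and> card {l'\<in>{1..N}. Om l \<inter> Om l' \<noteq> {}} \<le> Cov"
        using setting l unfolding dd_setting_def
        by (elim conjE) (drule (1) bspec, elim conjE, intro conjI; assumption)
      then show "open (Omt l)" "Om l = Omt l \<inter> closure \<Omega>" "\<exists>S\<subseteq>\<T>. closure (Om l) = \<Union>S"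
        "card {l'\<in>{1..N}. Om l \<inter> Om l' \<noteq> {}} \<le> Cov" by blast+
      show "closure {x. w l x \<noteq> 0} \<subseteq> closure (Om l)" using w[of l] l by (simp add: Vloc_def)
    qed (rule wV)
  qed (use wV v norm_1k_nonneg norm_1k_scale C coercive \<alpha> in auto)
  \<comment> \<open>The 4 combines the 2 of \<open>product_bound\<close> with the 2 in the
    denominator of \<open>\<alpha>\<close>.\<close>
  also have "2 * C * (1 + real Cov) / \<alpha> = 4 * C * (1 + real Cov) * (1 + \<bar>Ce\<bar>) * (k\<^sup>2 / \<bar>\<epsilon>\<bar>)"
    using Ce \<epsilon>0 k by (simp add: \<alpha>_def field_simps)
  finally show ?thesis by (simp add: Q_eps_def w_def C_def)
qed

end

theorem theorem4p3:
  fixes \<Omega> :: "(real^'n) set"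
    and \<sigma> c\<delta> cv Cv cs Cs cb Cb k0 C\<epsilon> C\<eta> :: real and Cov :: nat
  assumes "CARD('n) = 2 \<or> CARD('n) = 3"
    and "lipschitz_domain \<Omega>"
    and "k0 > 0"
  shows "\<exists>c>0. \<forall>(\<T>::(real^'n) set set) \<T>H N Omt Om \<delta> k \<epsilon> (\<eta>::complex).
     dd_setting \<sigma> Cov c\<delta> cv Cv cs Cs cb Cb \<Omega> \<T> \<T>H N Omt Om \<delta> \<and>
     k0 \<le> k \<and> \<epsilon> \<noteq> 0 \<and> \<bar>\<epsilon>\<bar> \<le> C\<epsilon> * k\<^sup>2 \<and> cmod \<eta> \<le> C\<eta> * k \<and>
     0 \<le> Re (cnj (z_of k \<epsilon>) * \<eta>)
     \<longrightarrow> (\<forall>v\<in>P1 \<T> (closure \<Omega>).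
            norm_1k \<Omega> k (Q_eps \<T> \<T>H \<Omega> Om N k \<epsilon> \<eta> v) \<le> c * (k\<^sup>2 / \<bar>\<epsilon>\<bar>) * norm_1k \<Omega> k v)"
proof -
  from trace_inequality[OF assms(2,3)] obtain Ct where
    trace: "\<forall>\<sigma> \<T> v k. sr_mesh \<sigma> \<T> (closure \<Omega>) \<longrightarrow> v \<in> P1 \<T> (closure \<Omega>) \<longrightarrow> k0 \<le> k \<longrightarrow>
      k * fe_mesh.bdry_sq \<T> \<Omega> v \<le> Ct * (norm_1k \<Omega> k v)\<^sup>2" ..
  \<comment> \<open>The domain and \<open>k0\<close> enter only through \<open>Ct\<close>, fixed
    before the mesh and the parameters. Absolute values make the constant positive whatever the
    signs of \<open>C\<epsilon>\<close>, \<open>C\<eta>\<close> and \<open>Ct\<close>.\<close>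
  let ?c = "4 * (1 + \<bar>C\<epsilon>\<bar> + \<bar>C\<eta>\<bar> * \<bar>Ct\<bar>) * (1 + real Cov) * (1 + \<bar>C\<epsilon>\<bar>)"
  show ?thesis
  proof (intro exI[of _ ?c] conjI allI impI ballI)
    show "0 < ?c" by (simp add: add_pos_nonneg)
    fix \<T> :: "(real^'n) set set" and \<T>H N Omt Om \<delta> k \<epsilon> and \<eta> :: complex and v
    assume *: "dd_setting \<sigma> Cov c\<delta> cv Cv cs Cs cb Cb \<Omega> \<T> \<T>H N Omt Om \<delta> \<and>
     k0 \<le> k \<and> \<epsilon> \<noteq> 0 \<and> \<bar>\<epsilon>\<bar> \<le> C\<epsilon> * k\<^sup>2 \<and> cmod \<eta> \<le> C\<eta> * k \<and> 0 \<le> Re (cnj (z_of k \<epsilon>) * \<eta>)"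
      and v: "v \<in> P1 \<T> (closure \<Omega>)"
    then have mesh: "sr_mesh \<sigma> \<T> (closure \<Omega>)" by (simp add: dd_setting_def)
    interpret fe_mesh \<sigma> \<T> \<Omega>
      using mesh assms(2) by unfold_locales (auto simp: lipschitz_domain_def)
    show "norm_1k \<Omega> k (Q_eps \<T> \<T>H \<Omega> Om N k \<epsilon> \<eta> v) \<le> ?c * (k\<^sup>2 / \<bar>\<epsilon>\<bar>) * norm_1k \<Omega> k v"
    proof (rule norm_Q_eps_le)
      show "k * bdry_sq w \<le> Ct * (norm_1k \<Omega> k w)\<^sup>2" if "w \<in> P1 \<T> (closure \<Omega>)" for w
        using trace mesh that * by blast
    qed (use * v assms(3) in auto)
  qed
qed

end
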